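(* Let $\mathcal{A}$ be a finite alphabet, let $\varphi\colon \mathcal{A}\to\mathcal{A}^*$ be a primitive substitution, let $x$ be a one-sided or an admissible two-sided fixed point of $\varphi$, assume that $x$ is nonperiodic, and let $a=x_0$. Let $X$ be the (one-sided or two-sided, according to $x$) system generated by $x$, i.e. the orbit closure of $x$. Let $\mathrm{R}_a$ be the (finite) set of return words to $a$ in $x$, let $\tau\colon\mathrm{R}_a\to\mathrm{R}_a^*$ be the return substitution of $\varphi$ to $a$, let $M_{\tau}$ denote the incidence matrix of $\tau$, and let $s\geq 0$ denote the size of the largest Jordan block of $M_{\tau}$ corresponding to the eigenvalue $0$ (with $s=0$ if $0$ is not an eigenvalue of $M_\tau$). The following conditions are equivalent: (i) $x$ is an automatic sequence; (ii) there is a finite alphabet $\mathcal{B}$ and a coding $\varrho\colon \mathcal{A}\to\mathcal{B}$ such that $y=\varrho(x)$ is nonperiodic and automatic; (iii) $X$ is an automatic system; (iv) $X$ has an infinite automatic system $Y$ as a (topological) factor; (v) the row vector $(|\varphi^s(w)|)_{w\in\mathrm{R}_{a}}$ is a left eigenvector of $M_{\tau}$.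
   Context: Words and sequences. For a finite alphabet $\mathcal{A}$, $\mathcal{A}^*$ is the set of finite words over $\mathcal{A}$ and $|u|$ is the length of a word $u$. One-sided sequences are elements of $\mathcal{A}^{\mathbf{N}}$ with $\mathbf{N}=\{0,1,2,\dots\}$; two-sided sequences are elements of $\mathcal{A}^{\mathbf{Z}}$. $\mathrm{L}(x)$ denotes the set of finite words appearing in $x$. Substitutions. A morphism $\varphi\colon\mathcal{A}\to\mathcal{B}^*$ is extended to words by concatenation and to sequences; on two-sided sequences $\varphi(\ldots x_{-1}.x_0\ldots)=\ldots\varphi(x_{-1}).\varphi(x_0)\ldots$, where the dot marks the position $0$. A substitution is a morphism $\varphi\colon\mathcal{A}\to\mathcal{A}^*$; it has constant length $k$ if $|\varphi(b)|=k$ for all $b\in\mathcal{A}$. A coding is a map $\mathcal{A}\to\mathcal{B}$ (applied letterwise). A fixed point of $\varphi$ is a one-sided or two-sided sequence $x$ with $\varphi(x)=x$. A two-sided fixed point $x$ is admissible if the word $x_{-1}x_0$ appears in $\varphi^n(b)$ for some $b\in\mathcal{A}$, $n\geq1$. The incidence matrix is $M_\varphi=(|\varphi(b)|_c)_{c,b\in\mathcal{A}}$ (row index $c$, column index $b$), where $|\varphi(b)|_c$ is the number of occurrences of $c$ in $\varphi(b)$. $\varphi$ is primitive if some power $M_\varphi^n$, $n\geq 1$, has all entries strictly positive. Automaticity. For $k\geq2$, a (one-sided or two-sided) sequence is $k$-automatic if it is the image under a coding of a (one-sided, resp. two-sided) fixed point of a substitution of constant length $k$. It is automatic if it is $k$-automatic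 for some $k\ge 2$. Systems. $T$ denotes the shift $T((x_n)_n)=(x_{n+1})_n$. A subshift is a closed set $X\subset\mathcal{A}^{\mathbf{Z}}$ (two-sided) or $X\subset\mathcal{A}^{\mathbf{N}}$ (one-sided) with $T(X)\subset X$. The system generated by $x$ is the closure of $\{T^n(x): n\in\mathbf{Z}\}$ if $x$ is two-sided, and of $\{T^n(x): n\in\mathbf{N}\}$ if $x$ is one-sided. A subshift is an automatic system if it is generated by some automatic sequence (two-sided for two-sided systems, one-sided for one-sided systems). A subshift $Y$ is a (topological) factor of $X$ if there is a continuous surjection $X\to Y$ commuting with $T$ (one-sided systems are considered with one-sided factors, two-sided systems with two-sided factors). Return words. A word $w\in\mathrm{L}(x)$ is a return word to $a$ in $x$ if $w$ starts with $a$, $w$ has exactly one occurrence of $a$, and $wa\in \mathrm{L}(x)$; $\mathrm{R}_a$ is the set of all return words to $a$ in $x$. In the situation of the claim $\mathrm{R}_a$ is finite, every word that is a concatenation of elements of $\mathrm{R}_a$ has a unique such factorisation, and for each $w\in\mathrm{R}_a$ the word $\varphi(w)$ is a concatenation of elements of $\mathrm{R}_a$. The return substitution $\tau\colon\mathrm{R}_a\to\mathrm{R}_a^*$ (with $\mathrm{R}_a$ regarded as an alphabet) sends $w\in\mathrm{R}_a$ to the unique factorisation of $\varphi(w)$ over $\mathrm{R}_a$. In (v), $|\varphi^s(w)|$ is the length of $\varphi^s(w)$ as a word over $\mathcal{A}$. *)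

theory Defs
  imports
    "HOL-Analysis.Function_Topology"
    "HOL-Library.Sublist"
    "Jordan_Normal_Form.Jordan_Normal_Form_Existence"
begin

(* A sequence over the alphabet A is a function 'i => 'a with values in A.  The index type 'i is
   only ever nat (one-sided sequences) or int (two-sided sequences).  Alphabets are sets, since the
   return words to a letter are themselves used as letters. *)

definition seqs :: "'a set \<Rightarrow> ('i \<Rightarrow> 'a) set" where
  "seqs A = {x. range x \<subseteq> A}"

definition periodic :: "('i::comm_semiring_1 \<Rightarrow> 'a) \<Rightarrow> bool" where
  "periodic x \<longleftrightarrow> (\<exists>p::nat. 0 < p \<and> (\<forall>i. x (i + of_nat p) = x i))"

definition language :: "('i::comm_semiring_1 \<Rightarrow> 'a) \<Rightarrow> 'a list set" where
  "language x = {w. \<exists>i. \<forall>j<length w. w ! j = x (i + of_nat j)}"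


section \<open>Substitutions\<close>

definition substitution :: "'a set \<Rightarrow> ('a \<Rightarrow> 'a list) \<Rightarrow> bool" where
  "substitution A \<phi> \<longleftrightarrow> finite A \<and> (\<forall>b\<in>A. set (\<phi> b) \<subseteq> A)"

definition constant_length :: "'a set \<Rightarrow> ('a \<Rightarrow> 'a list) \<Rightarrow> nat \<Rightarrow> bool" where
  "constant_length A \<phi> k \<longleftrightarrow> (\<forall>b\<in>A. length (\<phi> b) = k)"

definition subst_word :: "('a \<Rightarrow> 'b list) \<Rightarrow> 'a list \<Rightarrow> 'b list" where
  "subst_word \<phi> w = concat (map \<phi> w)"

(* y = \<phi>(x).  Here p i is the position in y at which the block \<phi>(x_i) begins; the
   block \<phi>(x_0) begins at position 0.  The last clause says that the blocks exhaust y, so that y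
   is determined by x. *)
definition is_image_seq ::
    "('a \<Rightarrow> 'b list) \<Rightarrow> ('i::comm_semiring_1 \<Rightarrow> 'a) \<Rightarrow> ('i \<Rightarrow> 'b) \<Rightarrow> bool" where
  "is_image_seq \<phi> x y \<longleftrightarrow> (\<exists>p :: 'i \<Rightarrow> 'i.
      p 0 = 0 \<and>
      (\<forall>i. p (i + 1) = p i + of_nat (length (\<phi> (x i)))) \<and>
      (\<forall>i. \<forall>j<length (\<phi> (x i)). y (p i + of_nat j) = \<phi> (x i) ! j) \<and>
      (\<forall>m. \<exists>i. \<exists>j<length (\<phi> (x i)). m = p i + of_nat j))"

definition fixed_point ::
    "'a set \<Rightarrow> ('a \<Rightarrow> 'a list) \<Rightarrow> ('i::comm_semiring_1 \<Rightarrow> 'a) \<Rightarrow> bool" where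
  "fixed_point A \<phi> x \<longleftrightarrow> x \<in> seqs A \<and> is_image_seq \<phi> x x"

definition admissible :: "'a set \<Rightarrow> ('a \<Rightarrow> 'a list) \<Rightarrow> (int \<Rightarrow> 'a) \<Rightarrow> bool" where
  "admissible A \<phi> x \<longleftrightarrow>
     (\<exists>b\<in>A. \<exists>n\<ge>1. sublist [x (-1), x 0] ((subst_word \<phi> ^^ n) [b]))"

(* An arbitrary fixed ordering of a finite alphabet, used to index rows and columns. *)
definition letters :: "'a set \<Rightarrow> 'a list" where
  "letters A = (SOME bs. distinct bs \<and> set bs = A)"

definition incidence_matrix :: "'a set \<Rightarrow> ('a \<Rightarrow> 'a list) \<Rightarrow> 'r::semiring_1 mat" where
  "incidence_matrix A \<phi> = mat (card A) (card A)
     (\<lambda>(i, j). of_nat (count_list (\<phi> (letters A ! j)) (letters A ! i)))"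

definition primitive :: "'a set \<Rightarrow> ('a \<Rightarrow> 'a list) \<Rightarrow> bool" where
  "primitive A \<phi> \<longleftrightarrow> (\<exists>n\<ge>1. \<forall>i<card A. \<forall>j<card A.
     (incidence_matrix A \<phi> ^\<^sub>m n :: nat mat) $$ (i, j) > 0)"


section \<open>Automatic sequences\<close>

(* Every finite alphabet can be renamed to a finite set of natural numbers, so it is enough to let
   the auxiliary alphabet C range over these. *)
definition k_automatic :: "nat \<Rightarrow> ('i::comm_semiring_1 \<Rightarrow> 'a) \<Rightarrow> bool" where
  "k_automatic k x \<longleftrightarrow> (\<exists>(C :: nat set) \<psi> z (\<rho> :: nat \<Rightarrow> 'a).
     substitution C \<psi> \<and> constant_length C \<psi> k \<and> fixed_point C \<psi> z \<and> x = \<rho> \<circ> z)"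

definition automatic :: "('i::comm_semiring_1 \<Rightarrow> 'a) \<Rightarrow> bool" where
  "automatic x \<longleftrightarrow> (\<exists>k\<ge>2. k_automatic k x)"


section \<open>Systems\<close>

definition shift :: "('i::comm_semiring_1 \<Rightarrow> 'a) \<Rightarrow> ('i \<Rightarrow> 'a)" where
  "shift x = (\<lambda>i. x (i + 1))"

definition full_shift :: "'a set \<Rightarrow> ('i \<Rightarrow> 'a) topology" where
  "full_shift A = product_topology (\<lambda>_. discrete_topology A) UNIV"

definition subshift :: "'a set \<Rightarrow> ('i::comm_semiring_1 \<Rightarrow> 'a) set \<Rightarrow> bool" where
  "subshift A X \<longleftrightarrow> closedin (full_shift A) X \<and> shift ` X \<subseteq> X"

(* The exponent n of the shift ranges over the index type: over nat in the one-sided case and over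
   all of int in the two-sided case. *)
definition orbit_closure ::
    "'a set \<Rightarrow> ('i::comm_semiring_1 \<Rightarrow> 'a) \<Rightarrow> ('i \<Rightarrow> 'a) set" where
  "orbit_closure A x = full_shift A closure_of range (\<lambda>n. \<lambda>i. x (i + n))"

definition automatic_system :: "'a set \<Rightarrow> ('i::comm_semiring_1 \<Rightarrow> 'a) set \<Rightarrow> bool" where
  "automatic_system A X \<longleftrightarrow>
     subshift A X \<and> (\<exists>x\<in>seqs A. automatic x \<and> X = orbit_closure A x)"

definition topological_factor ::
    "'a set \<Rightarrow> ('i::comm_semiring_1 \<Rightarrow> 'a) set \<Rightarrow> 'b set \<Rightarrow> ('i \<Rightarrow> 'b) set \<Rightarrow> bool" where
  "topological_factor A X B Y \<longleftrightarrow> (\<exists>f.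
     continuous_map (subtopology (full_shift A) X) (subtopology (full_shift B) Y) f \<and>
     f ` X = Y \<and> (\<forall>z\<in>X. f (shift z) = shift (f z)))"


section \<open>Return words\<close>

definition return_words :: "('i::comm_semiring_1 \<Rightarrow> 'a) \<Rightarrow> 'a \<Rightarrow> 'a list set" where
  "return_words x a = {w \<in> language x.
     w \<noteq> [] \<and> hd w = a \<and> count_list w a = 1 \<and> w @ [a] \<in> language x}"

definition return_subst ::
    "('i::comm_semiring_1 \<Rightarrow> 'a) \<Rightarrow> 'a \<Rightarrow> ('a \<Rightarrow> 'a list) \<Rightarrow> 'a list \<Rightarrow> 'a list list" where
  "return_subst x a \<phi> w =
     (THE vs. vs \<in> lists (return_words x a) \<and> concat vs = subst_word \<phi> w)"


section \<open>Linear algebra\<close>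

(* The sizes of the Jordan blocks for a given eigenvalue do not depend on the choice of the Jordan
   normal form; the value is 0 if there is no such block. *)
definition largest_jordan_block :: "complex mat \<Rightarrow> complex \<Rightarrow> nat" where
  "largest_jordan_block M ev =
     Max (insert 0 {n. \<exists>n_as. jordan_nf M n_as \<and> (n, ev) \<in> set n_as})"

definition left_eigenvector :: "'r::comm_ring_1 mat \<Rightarrow> 'r vec \<Rightarrow> bool" where
  "left_eigenvector M v \<longleftrightarrow> (\<exists>ev. eigenvector (transpose_mat M) v ev)"

definition length_vector :: "('a \<Rightarrow> 'a list) \<Rightarrow> nat \<Rightarrow> 'a list set \<Rightarrow> complex vec" where
  "length_vector \<phi> s R =
     vec_of_list (map (\<lambda>w. of_nat (length ((subst_word \<phi> ^^ s) w))) (letters R))"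


definition all_equivalent :: "bool list \<Rightarrow> bool" where
  "all_equivalent Ps \<longleftrightarrow> (\<forall>P\<in>set Ps. \<forall>Q\<in>set Ps. P \<longleftrightarrow> Q)"

end

theory Submission
  imports Defs "HOL-Number_Theory.Cong" "HOL-Analysis.T1_Spaces"
begin

text \<open>Conditions (i)--(iii) lead to (iv) by codings and compactness. Given (iv), let \<open>y\<close> be a nonperiodic
  \<open>k\<close>-automatic sequence that is the image of a point of \<open>X\<close> under a sliding block code. The word
  \<open>\<phi>^n(a)\<close> recurs in \<open>x\<close> at distance \<open>|\<phi>^n(w)|\<close> for every return word \<open>w\<close>, so a word of comparable length
  recurs in \<open>y\<close> at this distance. In a \<open>k\<close>-automatic sequence this forces \<open>|\<phi>^n(w)|\<close> to be divisible,
  up to a bounded factor, by a power of \<open>k\<close> comparable to \<open>|\<phi>^n(a)|\<close>. Hence the directions of the vectors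
  \<open>L_n = (|\<phi>^n(w)|)_w\<close> lie in a finite set, two of them coincide, and a Perron--Frobenius argument
  gives \<open>L_{n+1} = \<theta> L_n\<close> for some \<open>n\<close>. As \<open>L_{n+1} = L_n M\<close>, the vector \<open>L_1 - \<theta> L_0\<close> is killed by
  a power of \<open>M\<close>, hence by \<open>M^s\<close>. No form of Cobham's theorem is needed. Conversely, if
  \<open>L_{s+1} = k L_s\<close>, then \<open>k\<close> is an integer, and cutting \<open>x = \<phi>^s(x)\<close> into the blocks \<open>\<phi>^s(w)\<close> exhibits
  \<open>x\<close> as \<open>k\<close>-automatic.\<close>


section \<open>Long repetitions in automatic sequences\<close>

text \<open>The estimate on repetitions is useful only if its constant \<open>c\<close> does not
  depend on the scale \<open>k ^ m\<close>, while the recurrence windows of \<open>y\<close> do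
  depend on it. The way out: at scale \<open>m\<close>, recurrence matters only through the relation
  on the states \<open>C\<close> that identifies two states with the same image block of length
  \<open>k ^ m\<close>, and a finite set carries only finitely many relations. A second obstacle is
  the treatment of two index types. Points of \<open>X\<close> enter through their words.
  Admissibility gives a two-sided \<open>x\<close> and its right half the same language, hence the
  same return words and the same \<open>\<tau>\<close>, so the path from an automatic factor to the
  eigenvector runs over the naturals in both cases. Where genuine indices matter, the index type is
  a commutative semiring in which every element or its negative is a natural number. Nonperiodicity
  excludes the degenerate one-letter case and keeps the coded systems infinite; passing from
  eventual periodicity to periodicity always uses recurrence.\<close>

definition agree :: "(nat \<Rightarrow> 'b) \<Rightarrow> nat \<Rightarrow> nat \<Rightarrow> nat \<Rightarrow> bool" where
  "agree y i j L \<longleftrightarrow> (\<forall>t<L. y (i + t) = y (j + t))"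

definition uniformly_recurrent :: "(nat \<Rightarrow> 'b) \<Rightarrow> bool" where
  "uniformly_recurrent y \<longleftrightarrow> (\<forall>i L. \<exists>N. \<forall>j. \<exists>j'\<in>{j..j+N}. agree y i j' L)"

definition eventually_periodic :: "(nat \<Rightarrow> 'b) \<Rightarrow> bool" where
  "eventually_periodic y \<longleftrightarrow> (\<exists>p>0. \<exists>M. \<forall>i\<ge>M. y (i + p) = y i)"

lemma agree_refl: "agree y i i L"
  by (simp add: agree_def)

lemma agree_sym: "agree y i j L \<Longrightarrow> agree y j i L"
  by (simp add: agree_def)

lemma agree_trans: "agree y i j L \<Longrightarrow> agree y j k L \<Longrightarrow> agree y i k L"
  by (simp add: agree_def)

lemma agree_offset: "agree y i j L \<Longrightarrow> s + L' \<le> L \<Longrightarrow> agree y (i + s) (j + s) L'"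
  unfolding agree_def by (metis add.assoc add_less_cancel_left order_less_le_trans)

lemma agree_mono: "agree y i j L \<Longrightarrow> L' \<le> L \<Longrightarrow> agree y i j L'"
  using agree_offset[of y i j L 0 L'] by simp

lemma agree_iff_map: "agree y i j L \<longleftrightarrow> map y [i..<i+L] = map y [j..<j+L]"
  unfolding agree_def by (auto simp: list_eq_iff_nth_eq)

text \<open>The set of residues at which a word occurs is finite, so a long word that realises all of
  them keeps realising all of them wherever it reoccurs.\<close>

lemma uniformly_recurrent_residue:
  fixes y :: "nat \<Rightarrow> 'b"
  assumes fin: "finite (range y)" and rec: "uniformly_recurrent y" and p: "p > 0"
  shows "\<exists>N. \<forall>i j. \<exists>j'\<in>{j..j+N}. j' mod p = i mod p \<and> agree y i j' L"
proof -
  define key where "key i = (i mod p, map y [i..<i+L])" for i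
  have "range key \<subseteq> {..<p} \<times> {w. set w \<subseteq> range y \<and> length w = L}"
    using p by (auto simp: key_def)
  then have finkey: "finite (range key)"
    by (rule finite_subset) (intro finite_cartesian_product finite_lessThan finite_lists_length_eq fin)
  obtain S where S: "finite S" "key ` S = range key"
    using finite_subset_image[OF finkey, of key UNIV] by auto
  \<comment> \<open>Every pair of a residue and a word that occurs at all has a representative below
    \<open>M\<close>, so the prefix of length \<open>M + L\<close> shows all pairs.\<close>
  define M where "M = Suc (Max (insert 0 S))"
  have rep: "\<exists>o'<M. key o' = key i" for i
  proof -
    obtain o' where "o' \<in> S" "key o' = key i" using S(2) by (metis imageE rangeI)
    moreover have "o' \<le> Max (insert 0 S)" using S(1) \<open>o' \<in> S\<close> by simp
    ultimately show ?thesis unfolding M_def by (meson le_imp_less_Suc)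
  qed
  obtain N where N: "\<And>j. \<exists>j'\<in>{j..j+N}. agree y 0 j' (M + L)"
    using rec unfolding uniformly_recurrent_def by blast
  have "\<exists>j'\<in>{j..j+(N+M)}. j' mod p = i mod p \<and> agree y i j' L" for i j
  proof -
    obtain j' where j': "j' \<in> {j..j+N}" "agree y 0 j' (M + L)" using N by blast
    define Res where "Res = {o' mod p | o'. agree y i o' L}"
    have sub: "Res \<subseteq> {..<p}" using p by (auto simp: Res_def)
    then have finRes: "finite Res" by (rule finite_subset) simp
    define h where "h r = (j' + r) mod p" for r
    have real: "\<exists>o'<M. o' mod p = r \<and> agree y i o' L" if "r \<in> Res" for r
    proof -
      obtain o1 where o1: "r = o1 mod p" "agree y i o1 L" using \<open>r \<in> Res\<close> by (auto simp: Res_def)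
      obtain o' where "o' < M" "key o' = key o1" using rep by blast
      then have "o' mod p = o1 mod p" "agree y o1 o' L" by (auto simp: key_def agree_iff_map)
      with o1 \<open>o' < M\<close> show ?thesis by (metis agree_trans)
    qed
    have shifted: "agree y i (j' + o') L" if "o' < M" "agree y i o' L" for o'
    proof -
      have "agree y (0 + o') (j' + o') L" using j'(2) by (rule agree_offset) (use that in simp)
      with that show ?thesis by (metis add_0 agree_trans)
    qed
    have "h ` Res \<subseteq> Res"
    proof (rule image_subsetI)
      fix r assume "r \<in> Res"
      then obtain o' where o': "o' < M" "o' mod p = r" "agree y i o' L" using real by blast
      have "h r = (j' + o') mod p" unfolding h_def o'(2)[symmetric] by (simp add: mod_add_right_eq)
      then show "h r \<in> Res" using shifted[OF o'(1,3)] by (auto simp: Res_def)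
    qed
    moreover have "inj_on h Res"
    proof (rule inj_onI)
      fix r r' assume "r \<in> Res" "r' \<in> Res" "h r = h r'"
      then have "[j' + r = j' + r'] (mod p)" by (simp add: h_def cong_def)
      then have "[r = r'] (mod p)" by (simp add: cong_add_lcancel_nat)
      moreover have "r < p" "r' < p" using sub \<open>r \<in> Res\<close> \<open>r' \<in> Res\<close> by auto
      ultimately show "r = r'" by (simp add: cong_def)
    qed
    ultimately have "h ` Res = Res" using finRes by (simp add: endo_inj_surj)
    moreover have "i mod p \<in> Res" unfolding Res_def using agree_refl by blast
    ultimately obtain r where r: "r \<in> Res" "h r = i mod p" by (metis imageE)
    then obtain o' where o': "o' < M" "o' mod p = r" "agree y i o' L" using real by blast
    have "(j' + o') mod p = i mod p" using r(2) o'(2) unfolding h_def by (metis mod_add_right_eq)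
    then show ?thesis using shifted[OF o'(1,3)] j'(1) o'(1)
      by (intro bexI[of _ "j' + o'"]) auto
  qed
  then show ?thesis by blast
qed

text \<open>With at most \<open>Q\<close> words of length \<open>Q\<close>, the number of words of
  length \<open>n\<close> fails to grow at some \<open>n < Q\<close>, so each word of length
  \<open>n\<close> has a single continuation. Two equal words of length \<open>n\<close> at distance
  \<open>d\<close> then agree forever. It is applied to a sequence whose letters are blocks of
  \<open>y\<close>.\<close>

lemma morse_hedlund:
  fixes Y :: "nat \<Rightarrow> 'b"
  assumes fin: "finite (range (\<lambda>l. map Y [l..<l+Q]))"
    and few: "card (range (\<lambda>l. map Y [l..<l+Q])) \<le> Q"
  shows "eventually_periodic Y"
proof -
  define W where "W n = range (\<lambda>l. map Y [l..<l+n])" for n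
  have take_W: "W n = take n ` W m" if "n \<le> m" for n m
  proof -
    have "take n (map Y [l..<l+m]) = map Y [l..<l+n]" for l
      using that by (simp add: take_map)
    then show ?thesis unfolding W_def by (auto simp: image_image)
  qed
  have finW: "finite (W n)" if "n \<le> Q" for n
    using take_W[OF that] fin unfolding W_def by simp
  have "\<exists>n<Q. card (W (Suc n)) \<le> card (W n)"
  proof (rule ccontr)
    assume "\<not> ?thesis"
    then have grow: "card (W n) < card (W (Suc n))" if "n < Q" for n using that by auto
    have "n \<le> Q \<Longrightarrow> Suc n \<le> card (W n)" for n
    proof (induction n)
      case 0
      then show ?case by (simp add: W_def)
    next
      case (Suc n)
      then show ?case using grow[of n] by simp
    qed
    from this[of Q] few show False by (simp add: W_def)
  qed
  then obtain n where n: "n < Q" "card (W (Suc n)) \<le> card (W n)" by blast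
  have inj: "inj_on (take n) (W (Suc n))"
  proof (rule eq_card_imp_inj_on)
    show "finite (W (Suc n))" using n(1) by (intro finW) simp
    then show "card (take n ` W (Suc n)) = card (W (Suc n))"
      using take_W[of n "Suc n"] n(2) card_image_le[of "W (Suc n)" "take n"] by simp
  qed
  have determined: "agree Y l l' (Suc n)" if "agree Y l l' n" for l l'
  proof -
    have "take n (map Y [l..<l+Suc n]) = take n (map Y [l'..<l'+Suc n])"
      using that by (simp add: agree_iff_map take_map)
    moreover have "map Y [l..<l+Suc n] \<in> W (Suc n)" "map Y [l'..<l'+Suc n] \<in> W (Suc n)"
      by (auto simp: W_def)
    ultimately show ?thesis using inj by (simp only: agree_iff_map inj_on_eq_iff)
  qed
  have "finite (W n)" using n(1) by (intro finW) simp
  then have "\<not> inj (\<lambda>l. map Y [l..<l+n])"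
    unfolding W_def using finite_imageD infinite_UNIV_nat by blast
  then obtain l l' where "l \<noteq> l'" "agree Y l l' n" by (auto simp: inj_def agree_iff_map)
  then obtain l d where d: "d > 0" "agree Y l (l + d) n"
    by (metis agree_sym less_imp_add_positive linorder_neqE_nat)
  have step: "agree Y (l + t) (l + d + t) n" for t
  proof (induction t)
    case 0
    then show ?case using d by simp
  next
    case (Suc t)
    from determined[OF this] have "agree Y (l + t + 1) (l + d + t + 1) n"
      by (rule agree_offset) simp
    then show ?case by (simp add: add.assoc)
  qed
  have "Y (l + t + d) = Y (l + t)" for t
  proof -
    have "agree Y (l + t) (l + d + t) (Suc n)" by (rule determined[OF step])
    then have "Y (l + t + 0) = Y (l + d + t + 0)" unfolding agree_def by (elim allE[of _ 0]) simp
    then show ?thesis by (simp add: ac_simps)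
  qed
  then have "\<forall>i\<ge>l. Y (i + d) = Y i" by (metis le_iff_add)
  then show ?thesis unfolding eventually_periodic_def using d(1) by blast
qed

lemma eventually_periodic_blocks:
  assumes e: "e > 0" and per: "eventually_periodic (\<lambda>l. map (\<lambda>t. y (b + e * l + t)) [0..<e])"
  shows "eventually_periodic y"
proof -
  obtain p M where p: "p > 0"
    "\<And>l. l \<ge> M \<Longrightarrow> map (\<lambda>t. y (b + e * (l + p) + t)) [0..<e] = map (\<lambda>t. y (b + e * l + t)) [0..<e]"
    using per unfolding eventually_periodic_def by blast
  have "y (i + e * p) = y i" if i: "i \<ge> b + e * M" for i
  proof -
    define l where "l = (i - b) div e"
    define t where "t = (i - b) mod e"
    have it: "i = b + e * l + t" "t < e" using i e by (auto simp: l_def t_def)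
    have "M \<le> l"
    proof -
      have "e * M div e \<le> (i - b) div e" using i by (intro div_le_mono) simp
      then show ?thesis using e by (simp add: l_def)
    qed
    from arg_cong[OF p(2)[OF this], of "\<lambda>w. w ! t"] it(2)
    have "y (b + e * (l + p) + t) = y (b + e * l + t)" by simp
    then show ?thesis using it(1) by (simp add: algebra_simps)
  qed
  then show ?thesis unfolding eventually_periodic_def
    using p(1) e by (intro exI[of _ "e * p"]) auto
qed

text \<open>Serves to lower the exponent until the quotient lies just above \<open>K\<close>: there
  it is at most \<open>k * K\<close>, which bounds the number of shifts in the main argument
  independently of the scale.\<close>

lemma least_exceeding:
  fixes Q :: "nat \<Rightarrow> nat"
  assumes "Q 0 \<le> K" "Q m > K" "\<And>m. Q (Suc m) \<le> k * Q m"
  shows "\<exists>m'\<le>m. Q m' > K \<and> Q m' \<le> k * K"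
proof -
  define m' where "m' = (LEAST m. Q m > K)"
  have m': "Q m' > K" "m' \<le> m" unfolding m'_def using assms(2) by (auto intro: LeastI Least_le)
  then obtain m0 where m0: "m' = Suc m0" using assms(1) by (metis not_less old.nat.exhaust)
  have "\<not> Q m0 > K" using not_less_Least[of m0 "\<lambda>m. Q m > K"] m0 unfolding m'_def by auto
  then have "Q m' \<le> k * K" using assms(3)[of m0] m0 by (meson le_trans mult_le_mono2 not_le)
  with m' show ?thesis by blast
qed

lemma quotient_step:
  fixes k d :: nat
  assumes k: "k > 0"
  shows "k ^ Suc m div gcd d (k ^ Suc m) \<le> k * (k ^ m div gcd d (k ^ m))"
proof -
  let ?g = "gcd d (k ^ m)" let ?g' = "gcd d (k ^ Suc m)"
  have "?g dvd ?g'" by (intro gcd_mono) auto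
  moreover have "?g' > 0" "?g > 0" using k by auto
  ultimately have "?g \<le> ?g'" by (simp add: dvd_imp_le)
  then have "k ^ Suc m div ?g' \<le> k ^ Suc m div ?g" by (rule div_le_mono2[OF \<open>?g > 0\<close>])
  also have "\<dots> = k * (k ^ m div ?g)" by (simp add: div_mult_swap)
  finally show ?thesis .
qed

text \<open>By Bezout the multiples of \<open>r\<close> reach every multiple of the gcd modulo
  \<open>N\<close>. The additive order of \<open>r\<close> modulo \<open>N\<close> is
  \<open>N div gcd r N\<close>, so that many multiples are enough.\<close>

lemma multiple_of_gcd_residue:
  fixes r N l :: nat
  assumes N: "N > 0"
  shows "\<exists>j < N div gcd r N. (j * r) mod N = (gcd r N * l) mod N"
proof -
  let ?g = "gcd r N" let ?Q = "N div ?g"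
  have g: "?g > 0" using N by simp
  have Q: "?Q > 0" using N by (metis N div_greater_zero_iff gcd_le2_nat g not_gr_zero)
  obtain u where u: "[r * u = ?g] (mod N)" using cong_solve_nat[of r N] by (metis N gcd_0_nat less_irrefl gcd.commute)
  define j where "j = (u * l) mod ?Q"
  have "N dvd ?Q * r"
  proof -
    have "?Q * r = N * (r div ?g)" by (metis div_mult_swap dvd_div_mult gcd_dvd1 gcd_dvd2 mult.commute)
    then show ?thesis by simp
  qed
  have "[j * r = u * l * r] (mod N)"
  proof -
    have "u * l = ?Q * (u * l div ?Q) + j" unfolding j_def by simp
    then have "u * l * r = (?Q * r) * (u * l div ?Q) + j * r" by (metis distrib_right mult.assoc mult.commute)
    then show ?thesis using \<open>N dvd ?Q * r\<close> by (simp add: cong_def mod_add_left_eq[symmetric] dvd_imp_mod_0)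
  qed
  also have "[u * l * r = ?g * l] (mod N)" using cong_scalar_right[OF u, of l] by (simp add: mult.commute mult.left_commute)
  finally have "(j * r) mod N = (?g * l) mod N" by (simp add: cong_def)
  moreover have "j < ?Q" using Q by (simp add: j_def)
  ultimately show ?thesis by blast
qed


lemma uniformly_recurrent_blocks:
  fixes y :: "nat \<Rightarrow> 'b"
  assumes fin: "finite (range y)" and rec: "uniformly_recurrent y" and p: "p > 0"
  shows "\<exists>W. \<forall>i j. \<exists>j'\<in>{j..j+W}. agree y (p * i) (p * j') L"
proof -
  obtain N where N: "\<And>i j. \<exists>j'\<in>{j..j+N}. j' mod p = i mod p \<and> agree y i j' L"
    using uniformly_recurrent_residue[OF assms] by metis
  have "\<exists>j'\<in>{j..j+N}. agree y (p * i) (p * j') L" for i j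
  proof -
    obtain h where h: "h \<in> {p*j..p*j+N}" "h mod p = (p * i) mod p" "agree y (p * i) h L"
      using N[of "p * j" "p * i"] by blast
    then obtain j' where j': "h = p * j'" by auto
    have "p * j' \<le> p * j + p * N" using h(1) j' p
      by (metis add_le_cancel_left atLeastAtMost_iff le_trans mult_le_mono1 nat_mult_1 One_nat_def Suc_leI)
    then have "j' \<le> j + N" using p by (metis distrib_left mult_le_cancel1)
    moreover have "j \<le> j'" using h(1) j' p by simp
    ultimately show ?thesis using h(3) j' by auto
  qed
  then show ?thesis by blast
qed

text \<open>An occurrence of a long word at distance \<open>d\<close> makes every block of length \<open>k ^ m\<close> that starts at
  a multiple of \<open>gcd d (k ^ m)\<close> one of the at most \<open>card C\<close> aligned ones; by the Morse--Hedlund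
  theorem these starting points cannot be too dense.\<close>

lemma long_repetition_distance:
  fixes y :: "nat \<Rightarrow> 'b" and z :: "nat \<Rightarrow> 'c" and g :: "nat \<Rightarrow> 'c \<Rightarrow> nat \<Rightarrow> 'b"
  assumes fin: "finite (range y)" and rec: "uniformly_recurrent y"
    and np: "\<not> eventually_periodic y" and k: "k \<ge> 2"
    and C: "finite C" "range z \<subseteq> C"
    and blocks: "\<And>m n i. i < k ^ m \<Longrightarrow> y (k ^ m * n + i) = g m (z n) i"
  shows "\<exists>c. \<forall>m i d. agree y i (i + d) (c * k ^ m) \<longrightarrow> k ^ m div gcd d (k ^ m) \<le> card C"
proof -
  define K where "K = card C"
  \<comment> \<open>Bounds how often the remainder \<open>r\<close> of \<open>d\<close> has to be
    added below: at most \<open>k * K\<close> multiples of \<open>r\<close> cover all residues in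
    question.\<close>
  define J where "J = k * K + 1"
  define E where "E m = {(c, c'). c \<in> C \<and> c' \<in> C \<and> (\<forall>i<k ^ m. g m c i = g m c' i)}" for m
  have kpos: "k ^ m > 0" for m using k by simp
  have agree_E: "agree y (k ^ m * i) (k ^ m * j) (L * k ^ m) \<longleftrightarrow> (\<forall>t<L. (z (i + t), z (j + t)) \<in> E m)"
    for m i j L
  proof
    assume ag: "agree y (k ^ m * i) (k ^ m * j) (L * k ^ m)"
    show "\<forall>t<L. (z (i + t), z (j + t)) \<in> E m"
    proof (intro allI impI)
      fix t assume "t < L"
      then have "k ^ m * t + k ^ m \<le> L * k ^ m"
        by (metis Suc_leI add.commute mult.commute mult_Suc mult_le_mono1)
      then have "agree y (k ^ m * i + k ^ m * t) (k ^ m * j + k ^ m * t) (k ^ m)"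
        using ag by (intro agree_offset)
      then have "\<forall>s<k ^ m. y (k ^ m * (i + t) + s) = y (k ^ m * (j + t) + s)"
        by (simp add: agree_def distrib_left)
      then show "(z (i + t), z (j + t)) \<in> E m" using C(2) by (auto simp: E_def blocks)
    qed
  next
    assume E: "\<forall>t<L. (z (i + t), z (j + t)) \<in> E m"
    show "agree y (k ^ m * i) (k ^ m * j) (L * k ^ m)"
      unfolding agree_def
    proof (intro allI impI)
      fix u assume u: "u < L * k ^ m"
      define t s where "t = u div k ^ m" and "s = u mod k ^ m"
      have u_eq: "u = k ^ m * t + s" "s < k ^ m" using kpos by (simp_all add: t_def s_def)
      have "t < L" using u kpos by (simp add: t_def less_mult_imp_div_less)
      then have "g m (z (i + t)) s = g m (z (j + t)) s" using E u_eq(2) by (auto simp: E_def)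
      then have "y (k ^ m * (i + t) + s) = y (k ^ m * (j + t) + s)" using u_eq(2) by (simp add: blocks)
      then show "y (k ^ m * i + u) = y (k ^ m * j + u)" by (simp add: u_eq(1) distrib_left add.assoc)
    qed
  qed
  \<comment> \<open>\<open>P\<close> depends on the scale only through \<open>E m\<close>, one of
    finitely many subsets of \<open>C \<times> C\<close>. This makes \<open>W\<close>, and then
    \<open>c\<close>, uniform in \<open>m\<close>.\<close>
  define P where "P e W \<longleftrightarrow> (\<forall>i j. \<exists>j'\<in>{j..j+W}. \<forall>t<J+1. (z (i + t), z (j' + t)) \<in> e)" for e W
  have "range E \<subseteq> Pow (C \<times> C)" by (auto simp: E_def)
  then have finE: "finite (range E)" by (rule finite_subset) (simp add: C(1))
  have "\<exists>W. P (E m) W" for m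
    using uniformly_recurrent_blocks[OF fin rec kpos[of m], of "(J+1) * k ^ m"]
    unfolding P_def agree_E .
  then have "\<forall>e\<in>range E. \<exists>W. P e W" by blast
  then obtain Wf where Wf: "\<And>m. P (E m) (Wf (E m))" by (metis rangeI)
  define W where "W = Max (Wf ` range E)"
  have "Wf (E m) \<le> W" for m unfolding W_def using finE by (intro Max_ge) auto
  moreover have P_mono: "P e w \<Longrightarrow> w \<le> w' \<Longrightarrow> P e w'" for e w w'
    unfolding P_def by (metis add_le_cancel_left atLeastAtMost_iff le_trans)
  ultimately have "P (E m) W" for m using Wf by blast
  then have window: "\<exists>j'\<in>{j..j+W}. agree y (k ^ m * i) (k ^ m * j') ((J+1) * k ^ m)" for m i j
    unfolding P_def agree_E by blast
  \<comment> \<open>Enough room to round \<open>i\<close> up to a multiple of \<open>k ^ m\<close>,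
    move on by up to \<open>W\<close> blocks and read \<open>J\<close> blocks.\<close>
  define c where "c = W + J + 3"
  have main: False if ag: "agree y i (i + d) (c * k ^ m)"
    and Q: "k ^ m div gcd d (k ^ m) > K" "k ^ m div gcd d (k ^ m) \<le> k * K" for m i d
  proof -
    let ?N = "k ^ m"
    define q r where "q = d div ?N" and "r = d mod ?N"
    have d: "d = ?N * q + r" "r < ?N" using kpos by (simp_all add: q_def r_def)
    have gr: "gcd r ?N = gcd d ?N" unfolding r_def by (metis gcd.commute gcd_red_nat)
    \<comment> \<open>The word of \<open>J + 1\<close> blocks at \<open>n\<close> reappears at block
      \<open>n' + q\<close>. Going \<open>r\<close> further leads to \<open>?N * n' + d\<close>,
      where the repetition shows the same word as at the aligned position
      \<open>?N * n'\<close>.\<close>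
    have one: "\<exists>n'. agree y (?N * n + r) (?N * n') (J * ?N)" for n
    proof -
      define n0 where "n0 = Suc (i div ?N)"
      obtain j' where j': "j' \<in> {n0 + q..n0 + q + W}" "agree y (?N * n) (?N * j') ((J+1) * ?N)"
        using window by blast
      define n' where "n' = j' - q"
      have n': "j' = n' + q" "n0 \<le> n'" "n' \<le> n0 + W" using j'(1) by (auto simp: n'_def)
      have "agree y (?N * n + r) (?N * j' + r) (J * ?N)"
        by (rule agree_offset[OF j'(2)]) (use d(2) in simp)
      moreover have "?N * j' + r = ?N * n' + d" using n'(1) d(1) by (simp add: distrib_left)
      moreover have "agree y (?N * n') (?N * n' + d) (J * ?N)"
      proof -
        have i_eq: "i = ?N * (i div ?N) + i mod ?N" "i mod ?N < ?N" using kpos by simp_all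
        have lo: "i \<le> ?N * n'"
        proof -
          have "i \<le> ?N * n0" using i_eq unfolding n0_def mult_Suc_right by linarith
          also have "\<dots> \<le> ?N * n'" using n'(2) by simp
          finally show ?thesis .
        qed
        have "?N * n' \<le> ?N * (i div ?N) + ?N * Suc W"
          using n'(3) unfolding n0_def by (metis add_Suc add_Suc_right distrib_left mult_le_mono2)
        then have hi: "?N * n' - i \<le> ?N * Suc W" using i_eq(1) by linarith
        have "(?N * n' - i) + J * ?N \<le> ?N * Suc W + J * ?N" using hi by simp
        also have "\<dots> \<le> c * ?N" unfolding c_def by (simp add: algebra_simps)
        finally have "agree y (i + (?N * n' - i)) (i + d + (?N * n' - i)) (J * ?N)"
          using ag by (intro agree_offset)
        then show ?thesis using lo by (simp add: add.commute add.left_commute)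
      qed
      ultimately show ?thesis by (metis agree_sym agree_trans)
    qed
    \<comment> \<open>Each further addition of \<open>r\<close> costs one block of agreement. The
      first leaves \<open>J\<close> blocks, so one block is still left after \<open>J\<close>
      additions.\<close>
    have many: "j \<ge> 1 \<Longrightarrow> j \<le> J \<Longrightarrow> \<exists>n'. agree y (?N * n + j * r) (?N * n') ((J + 1 - j) * ?N)" for j n
    proof (induction j rule: nat_induct_at_least)
      case base
      then show ?case using one[of n] by simp
    next
      case (Suc j)
      then obtain n' where n': "agree y (?N * n + j * r) (?N * n') ((J + 1 - j) * ?N)" by auto
      have "r + (J - j) * ?N \<le> (J + 1 - j) * ?N" using Suc.prems d(2)
        by (simp add: Suc_diff_le)
      then have "agree y (?N * n + j * r + r) (?N * n' + r) ((J - j) * ?N)"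
        by (rule agree_offset[OF n'])
      moreover obtain n'' where "agree y (?N * n' + r) (?N * n'') (J * ?N)" using one by blast
      then have "agree y (?N * n' + r) (?N * n'') ((J - j) * ?N)" by (rule agree_mono) simp
      ultimately have "agree y (?N * n + j * r + r) (?N * n'') ((J - j) * ?N)" by (rule agree_trans)
      then show ?case by (auto simp: algebra_simps)
    qed
    have aligned: "\<exists>n'. agree y (?N * n + j * r) (?N * n') ?N" if "j \<le> J" for n j
    proof (cases "j = 0")
      case True
      then show ?thesis using agree_refl[of y "?N * n"] by auto
    next
      case False
      with that obtain n' where "agree y (?N * n + j * r) (?N * n') ((J + 1 - j) * ?N)"
        using many[of j n] by auto
      then have "agree y (?N * n + j * r) (?N * n') ?N"
        by (rule agree_mono) (use that in \<open>simp add: Suc_diff_le\<close>)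
      then show ?thesis by blast
    qed
    define e where "e = gcd r ?N"
    define Qm where "Qm = ?N div e"
    have e: "e > 0" "e dvd ?N" using kpos by (auto simp: e_def)
    have NQ: "?N = e * Qm" using e by (simp add: Qm_def)
    have QK: "K < Qm" "Qm \<le> k * K" using Q by (simp_all add: Qm_def e_def gr)
    \<comment> \<open>Starting at \<open>b\<close> ensures \<open>j * r \<le> b + e * l\<close>, so
      the difference, a multiple of \<open>?N\<close>, has a natural quotient.\<close>
    define b where "b = J * ?N"
    have dense: "\<exists>n'. agree y (b + e * l) (?N * n') ?N" for l
    proof -
      obtain j where j: "j < Qm" "(j * r) mod ?N = (e * l) mod ?N"
        using multiple_of_gcd_residue[OF kpos[of m], of r l] by (auto simp: Qm_def e_def)
      have "j \<le> J" using j(1) QK(2) by (simp add: J_def)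
      have "j * r \<le> b + e * l"
        using \<open>j \<le> J\<close> d(2) unfolding b_def by (simp add: mult_le_mono trans_le_add1)
      moreover have "(b + e * l) mod ?N = (j * r) mod ?N" using j(2) by (simp add: b_def)
      ultimately obtain n where "b + e * l = ?N * n + j * r"
        by (metis add.commute mod_eq_nat2E)
      then show ?thesis using aligned[OF \<open>j \<le> J\<close>, of n] by simp
    qed
    define Y where "Y l = map (\<lambda>t. y (b + e * l + t)) [0..<e]" for l
    define word where "word c = map (\<lambda>l. map (\<lambda>t. g m c (e * l + t)) [0..<e]) [0..<Qm]" for c
    \<comment> \<open>\<open>Qm\<close> consecutive letters of \<open>Y\<close> spell a word of
      length \<open>?N\<close>, which equals an aligned block and is determined by its state; hence
      at most \<open>K < Qm\<close> such words exist.\<close>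
    have sub: "range (\<lambda>l. map Y [l..<l+Qm]) \<subseteq> word ` C"
    proof (rule image_subsetI)
      fix l
      obtain n' where n': "agree y (b + e * l) (?N * n') ?N" using dense by blast
      have "map Y [l..<l+Qm] = word (z n')"
      proof (rule nth_equalityI)
        fix l' assume "l' < length (map Y [l..<l+Qm])"
        then have l': "l' < Qm" by simp
        have "y (b + e * (l + l') + t) = g m (z n') (e * l' + t)" if "t < e" for t
        proof -
          have "e * l' + t < ?N"
          proof -
            have "e * l' + t < e * Suc l'" using that by simp
            also have "\<dots> \<le> ?N" unfolding NQ using l' by (intro mult_le_mono2) simp
            finally show ?thesis .
          qed
          then show ?thesis using n' blocks[of "e * l' + t" m n']
            by (simp add: agree_def distrib_left add.assoc)
        qed
        then show "map Y [l..<l+Qm] ! l' = word (z n') ! l'" using l' by (simp add: Y_def word_def)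
      qed (simp add: word_def)
      then show "map Y [l..<l+Qm] \<in> word ` C" using C(2) by auto
    qed
    have "finite (word ` C)" using C(1) by simp
    then have "card (range (\<lambda>l. map Y [l..<l+Qm])) \<le> card (word ` C)" by (rule card_mono[OF _ sub])
    also have "\<dots> \<le> K" unfolding K_def using C(1) by (rule card_image_le)
    finally have "eventually_periodic Y"
      using QK(1) finite_subset[OF sub \<open>finite (word ` C)\<close>]
      by (intro morse_hedlund) (blast, meson le_trans less_imp_le)
    then have "eventually_periodic y"
      unfolding Y_def by (rule eventually_periodic_blocks[OF e(1)])
    with np show False by blast
  qed
  have "k ^ m div gcd d (k ^ m) \<le> K" if ag: "agree y i (i + d) (c * k ^ m)" for m i d
  proof (rule ccontr)
    assume "\<not> ?thesis"
    \<comment> \<open>The start of the descent: at exponent 0 the quotient is 1, and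
      \<open>C\<close> is nonempty.\<close>
    moreover have "k ^ 0 div gcd d (k ^ 0) \<le> K"
    proof -
      have "C \<noteq> {}" using C(2) by auto
      then show ?thesis using C(1) by (simp add: K_def Suc_le_eq card_gt_0_iff)
    qed
    moreover have "k > 0" using k by simp
    ultimately obtain m' where m': "m' \<le> m" "k ^ m' div gcd d (k ^ m') > K"
        "k ^ m' div gcd d (k ^ m') \<le> k * K"
      using least_exceeding[of "\<lambda>m. k ^ m div gcd d (k ^ m)" K m k] quotient_step[of k _ d] by auto
    have "c * k ^ m' \<le> c * k ^ m" using m'(1) k by (intro mult_le_mono2 power_increasing) auto
    with ag have "agree y i (i + d) (c * k ^ m')" by (rule agree_mono)
    then show False using main m'(2,3) by blast
  qed
  then show ?thesis unfolding K_def by blast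
qed


section \<open>Iterated substitutions\<close>

lemma letters_props:
  assumes "finite A"
  shows distinct_letters: "distinct (letters A)" and set_letters: "set (letters A) = A"
    and length_letters: "length (letters A) = card A"
proof -
  obtain bs where bs: "set bs = A" "distinct bs" using finite_distinct_list[OF assms] by blast
  have "distinct (letters A) \<and> set (letters A) = A"
    unfolding letters_def by (rule someI[of _ bs]) (use bs in simp)
  then show "distinct (letters A)" "set (letters A) = A" "length (letters A) = card A"
    using distinct_card[of "letters A"] by simp_all
qed

lemma nth_letters_in: "finite A \<Longrightarrow> i < card A \<Longrightarrow> letters A ! i \<in> A"
  by (metis length_letters nth_mem set_letters)

lemma nth_letters_surj: "finite A \<Longrightarrow> b \<in> A \<Longrightarrow> \<exists>i<card A. letters A ! i = b"
  by (metis in_set_conv_nth length_letters set_letters)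

lemma sum_list_letters:
  fixes h :: "'a \<Rightarrow> 'r::semiring_1"
  assumes "finite A" "set w \<subseteq> A"
  shows "sum_list (map h w) = (\<Sum>l<card A. of_nat (count_list w (letters A ! l)) * h (letters A ! l))"
proof -
  have "sum_list (map h w) = (\<Sum>b\<in>A. of_nat (count_list w b) * h b)"
    using assms(2)
  proof (induction w)
    case (Cons c w)
    have "(\<Sum>b\<in>A. of_nat (count_list (c # w) b) * h b)
        = (\<Sum>b\<in>A. (if b = c then h b else 0) + of_nat (count_list w b) * h b)"
      by (intro sum.cong) (auto simp: algebra_simps)
    also have "\<dots> = h c + sum_list (map h w)"
      using Cons assms(1) by (simp add: sum.distrib)
    finally show ?case by simp
  qed simp
  also have "\<dots> = (\<Sum>l<card A. of_nat (count_list w (letters A ! l)) * h (letters A ! l))"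
  proof -
    have "bij_betw (\<lambda>l. letters A ! l) {..<card A} A"
      using bij_betw_nth[OF distinct_letters[OF assms(1)]] length_letters[OF assms(1)] set_letters[OF assms(1)]
      by simp
    then show ?thesis by (rule sum.reindex_bij_betw[symmetric])
  qed
  finally show ?thesis .
qed


section \<open>Iterates of a substitution and primitivity\<close>

abbreviation iterate :: "('a \<Rightarrow> 'a list) \<Rightarrow> nat \<Rightarrow> 'a list \<Rightarrow> 'a list" where
  "iterate \<phi> n \<equiv> subst_word \<phi> ^^ n"

lemma subst_word_Nil [simp]: "subst_word \<phi> [] = []"
  by (simp add: subst_word_def)

lemma subst_word_Cons: "subst_word \<phi> (b # w) = \<phi> b @ subst_word \<phi> w"
  by (simp add: subst_word_def)

lemma subst_word_append [simp]: "subst_word \<phi> (u @ v) = subst_word \<phi> u @ subst_word \<phi> v"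
  by (simp add: subst_word_def)

lemma subst_word_single: "subst_word \<phi> [b] = \<phi> b"
  by (simp add: subst_word_def)

lemma iterate_Nil [simp]: "iterate \<phi> n [] = []"
  by (induction n) auto

lemma iterate_append [simp]: "iterate \<phi> n (u @ v) = iterate \<phi> n u @ iterate \<phi> n v"
  by (induction n) auto

lemma iterate_concat: "iterate \<phi> n (concat ws) = concat (map (iterate \<phi> n) ws)"
  by (induction ws) auto

lemma iterate_iterate: "iterate \<phi> m (iterate \<phi> n w) = iterate \<phi> (m + n) w"
  by (simp add: funpow_add)

lemma iterate_Suc_right: "iterate \<phi> (Suc n) w = iterate \<phi> n (subst_word \<phi> w)"
  by (simp add: funpow_swap1)

lemma iterate_Cons: "iterate \<phi> n (b # w) = iterate \<phi> n [b] @ iterate \<phi> n w"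
  using iterate_append[of n \<phi> "[b]" w] by simp

lemma iterate_eq_Nil: "\<phi> b = [] \<Longrightarrow> n \<ge> 1 \<Longrightarrow> iterate \<phi> n [b] = []"
  by (cases n) (simp, simp only: iterate_Suc_right subst_word_single iterate_Nil)

lemma set_subst_word: "set (subst_word \<phi> w) = (\<Union>b\<in>set w. set (\<phi> b))"
  by (simp add: subst_word_def)

lemma set_iterate: "set (iterate \<phi> n w) = (\<Union>b\<in>set w. set (iterate \<phi> n [b]))"
proof (induction w)
  case (Cons b w)
  then show ?case by (subst iterate_Cons) simp
qed simp

lemma sublist_iterate: "sublist u v \<Longrightarrow> sublist (iterate \<phi> n u) (iterate \<phi> n v)"
  unfolding sublist_def by (metis iterate_append)

lemma substitution_iterate:
  assumes "substitution A \<phi>" "set w \<subseteq> A"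
  shows "set (iterate \<phi> n w) \<subseteq> A"
proof (induction n)
  case (Suc n)
  have "set (iterate \<phi> (Suc n) w) = (\<Union>b\<in>set (iterate \<phi> n w). set (\<phi> b))"
    by (simp add: set_subst_word)
  also have "\<dots> \<subseteq> A" using Suc assms(1) unfolding substitution_def by blast
  finally show ?case .
qed (simp add: assms(2))

lemma incidence_matrix_power:
  assumes A: "finite A" "substitution A \<phi>" and ij: "i < card A" "j < card A"
  shows "(incidence_matrix A \<phi> ^\<^sub>m n :: nat mat) $$ (i, j)
    = count_list (iterate \<phi> n [letters A ! j]) (letters A ! i)"
  using ij
proof (induction n arbitrary: i j)
  case 0
  then show ?case using distinct_letters[OF A(1)] length_letters[OF A(1)]
    by (auto simp: incidence_matrix_def nth_eq_iff_index_eq)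
next
  case (Suc n)
  let ?M = "incidence_matrix A \<phi> :: nat mat"
  have carrier: "?M \<in> carrier_mat (card A) (card A)" by (simp add: incidence_matrix_def)
  then have carrier_n: "?M ^\<^sub>m n \<in> carrier_mat (card A) (card A)" by (rule pow_carrier_mat)
  let ?b = "letters A ! j" let ?c = "letters A ! i"
  have sub: "set (\<phi> ?b) \<subseteq> A" using nth_letters_in[OF A(1) Suc.prems(2)] A(2) by (auto simp: substitution_def)
  have "(?M ^\<^sub>m Suc n) $$ (i, j) = (\<Sum>l<card A. (?M ^\<^sub>m n) $$ (i, l) * ?M $$ (l, j))"
    using carrier carrier_n Suc.prems by (simp add: scalar_prod_def atLeast0LessThan)
  also have "\<dots> = (\<Sum>l<card A. of_nat (count_list (\<phi> ?b) (letters A ! l)) *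
      count_list (iterate \<phi> n [letters A ! l]) ?c)"
    using Suc by (intro sum.cong) (auto simp: incidence_matrix_def)
  also have "\<dots> = sum_list (map (\<lambda>c. count_list (iterate \<phi> n [c]) ?c) (\<phi> ?b))"
    by (rule sum_list_letters[OF A(1) sub, symmetric])
  also have "\<dots> = count_list (iterate \<phi> n (\<phi> ?b)) ?c"
  proof -
    have "sum_list (map (\<lambda>c. count_list (iterate \<phi> n [c]) ?c) w) = count_list (iterate \<phi> n w) ?c" for w
    proof (induction w)
      case (Cons b w)
      then show ?case by (subst iterate_Cons) simp
    qed simp
    then show ?thesis .
  qed
  also have "iterate \<phi> n (\<phi> ?b) = iterate \<phi> (Suc n) [?b]"
    by (simp only: iterate_Suc_right subst_word_single)
  finally show ?case .
qed

text \<open>Positivity at one exponent \<open>n0\<close> spreads to all larger ones, as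
  \<open>\<phi>^(n - n0)(b)\<close> contains some letter \<open>d\<close> and
  \<open>\<phi>^n0(d)\<close> contains all letters. Iterates never become empty: an erased letter
  \<open>d\<close> could not occur in \<open>\<phi>^n0(d)\<close>.\<close>

lemma primitive_letters:
  assumes A: "finite A" "substitution A \<phi>" "primitive A \<phi>"
  shows "\<exists>n0\<ge>1. \<forall>n\<ge>n0. \<forall>b\<in>A. \<forall>c\<in>A. c \<in> set (iterate \<phi> n [b])"
proof -
  obtain n0 where n0: "n0 \<ge> 1" "\<And>i j. i < card A \<Longrightarrow> j < card A \<Longrightarrow>
      (incidence_matrix A \<phi> ^\<^sub>m n0 :: nat mat) $$ (i, j) > 0"
    using A(3) unfolding primitive_def by blast
  have base: "c \<in> set (iterate \<phi> n0 [b])" if "b \<in> A" "c \<in> A" for b c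
  proof -
    obtain i j where "i < card A" "letters A ! i = c" "j < card A" "letters A ! j = b"
      using nth_letters_surj[OF A(1)] \<open>b \<in> A\<close> \<open>c \<in> A\<close> by metis
    then have "count_list (iterate \<phi> n0 [b]) c > 0"
      using n0(2) incidence_matrix_power[OF A(1,2)] by metis
    then show ?thesis by (metis count_notin less_irrefl)
  qed
  have "\<forall>b\<in>A. \<forall>c\<in>A. c \<in> set (iterate \<phi> n [b])" if "n \<ge> n0" for n
  proof (intro ballI)
    fix b c assume "b \<in> A" "c \<in> A"
    have "set (iterate \<phi> (n - n0) [b]) \<subseteq> A" using substitution_iterate[OF A(2)] \<open>b \<in> A\<close> by simp
    have "iterate \<phi> m [b'] \<noteq> []" if "b' \<in> A" for m b'
    proof (induction m)
      case (Suc m)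
      then obtain d where "d \<in> set (iterate \<phi> m [b'])" by (meson last_in_set)
      moreover have "d \<in> A" using substitution_iterate[OF A(2), of "[b']" m] \<open>d \<in> _\<close> that by auto
      then have "\<phi> d \<noteq> []"
        using base[of d d] n0(1) iterate_eq_Nil[of \<phi> d n0] by force
      ultimately show ?case by (force simp: subst_word_def[of _ "iterate \<phi> m [b']"])
    qed simp
    from this[OF \<open>b \<in> A\<close>] obtain d where d: "d \<in> set (iterate \<phi> (n - n0) [b])" by (meson last_in_set)
    with \<open>set (iterate \<phi> (n - n0) [b]) \<subseteq> A\<close> have "c \<in> set (iterate \<phi> n0 [d])" using base \<open>c \<in> A\<close> by blast
    with d have "c \<in> set (iterate \<phi> n0 (iterate \<phi> (n - n0) [b]))" by (subst set_iterate) blast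
    then show "c \<in> set (iterate \<phi> n [b])" using \<open>n \<ge> n0\<close> by (simp add: iterate_iterate del: funpow.simps)
  qed
  with n0(1) show ?thesis by blast
qed

lemma primitive_nonempty:
  assumes A: "finite A" "substitution A \<phi>" "primitive A \<phi>" and b: "b \<in> A"
  shows "\<phi> b \<noteq> []"
proof -
  obtain n0 where n0: "n0 \<ge> 1" "b \<in> set (iterate \<phi> n0 [b])" using primitive_letters[OF A] b by blast
  then show ?thesis
    using iterate_eq_Nil[of \<phi> b n0] by force
qed

lemma length_iterate_mono:
  assumes A: "finite A" "substitution A \<phi>" "primitive A \<phi>" and w: "set w \<subseteq> A" and mn: "m \<le> n"
  shows "length (iterate \<phi> m w) \<le> length (iterate \<phi> n w)"
proof -
  have one: "length w \<le> length (subst_word \<phi> w)" if "set w \<subseteq> A" for w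
    using that
  proof (induction w)
    case (Cons b w)
    then have "\<phi> b \<noteq> []" using primitive_nonempty[OF A] by simp
    then have "length (\<phi> b) \<ge> 1" by (simp add: Suc_leI)
    then show ?case using Cons by (simp add: subst_word_Cons)
  qed simp
  show ?thesis
    by (rule lift_Suc_mono_le[OF _ mn, of "\<lambda>n. length (iterate \<phi> n w)"])
      (use one substitution_iterate[OF A(2) w] in simp)
qed

text \<open>Two letters make every \<open>\<phi>^n0(b)\<close> at least twice as long as
  \<open>b\<close>. With a single letter \<open>\<phi>\<close> could be the identity.\<close>

lemma length_iterate_unbounded:
  assumes A: "finite A" "substitution A \<phi>" "primitive A \<phi>" and two: "c \<in> A" "c' \<in> A" "c \<noteq> c'"
  shows "\<exists>n1. \<forall>n\<ge>n1. \<forall>b\<in>A. L \<le> length (iterate \<phi> n [b])"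
proof -
  obtain n0 where n0: "\<And>b c. b \<in> A \<Longrightarrow> c \<in> A \<Longrightarrow> c \<in> set (iterate \<phi> n0 [b])"
    using primitive_letters[OF A] by blast
  have two_b: "2 \<le> length (iterate \<phi> n0 [b])" if "b \<in> A" for b
  proof -
    have "{c, c'} \<subseteq> set (iterate \<phi> n0 [b])" using n0 two that by auto
    then have "card {c, c'} \<le> card (set (iterate \<phi> n0 [b]))" by (intro card_mono) auto
    also have "\<dots> \<le> length (iterate \<phi> n0 [b])" by (rule card_length)
    finally show ?thesis using two(3) by simp
  qed
  have double: "2 * length w \<le> length (iterate \<phi> n0 w)" if "set w \<subseteq> A" for w
    using that
  proof (induction w)
    case (Cons b w)
    then show ?case using two_b[of b] by (subst iterate_Cons) simp
  qed simp
  have pow: "2 ^ j \<le> length (iterate \<phi> (n0 * j) [b])" if "b \<in> A" for j b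
  proof (induction j)
    case (Suc j)
    have "2 * length (iterate \<phi> (n0 * j) [b]) \<le> length (iterate \<phi> n0 (iterate \<phi> (n0 * j) [b]))"
      by (rule double) (use substitution_iterate[OF A(2)] that in simp)
    with Suc show ?case by (simp add: iterate_iterate)
  qed simp
  have "L \<le> length (iterate \<phi> n [b])" if "n \<ge> n0 * L" "b \<in> A" for n b
  proof -
    have "L \<le> 2 ^ L" by (simp add: less_imp_le)
    also have "\<dots> \<le> length (iterate \<phi> (n0 * L) [b])" by (rule pow[OF that(2)])
    also have "\<dots> \<le> length (iterate \<phi> n [b])" using that by (intro length_iterate_mono[OF A]) auto
    finally show ?thesis .
  qed
  then show ?thesis by blast
qed


section \<open>Occurrences of words and positions of image blocks\<close>

definition occurs :: "('i::comm_semiring_1 \<Rightarrow> 'a) \<Rightarrow> 'i \<Rightarrow> 'a list \<Rightarrow> bool" where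
  "occurs x i w \<longleftrightarrow> (\<forall>j<length w. w ! j = x (i + of_nat j))"

lemma language_iff: "w \<in> language x \<longleftrightarrow> (\<exists>i. occurs x i w)"
  by (simp add: language_def occurs_def)

lemma occurs_Nil [simp]: "occurs x i []"
  by (simp add: occurs_def)

lemma occurs_Cons: "occurs x i (b # w) \<longleftrightarrow> x i = b \<and> occurs x (i + 1) w"
  unfolding occurs_def by (auto simp: All_less_Suc2 add.assoc)

lemma occurs_append: "occurs x i (u @ v) \<longleftrightarrow> occurs x i u \<and> occurs x (i + of_nat (length u)) v"
proof (induction u arbitrary: i)
  case (Cons b u)
  have "i + 1 + of_nat (length u) = i + of_nat (length (b # u))" by (simp add: add.assoc)
  with Cons[of "i + 1"] show ?case by (simp add: occurs_Cons)
qed simp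

lemma occurs_map: "occurs x i (map (\<lambda>j. x (i + of_nat j)) [0..<n])"
  by (simp add: occurs_def)

lemma occurs_eq: "occurs x i u \<Longrightarrow> occurs x i v \<Longrightarrow> length u = length v \<Longrightarrow> u = v"
  by (simp add: occurs_def list_eq_iff_nth_eq)

lemma occurs_nat: "occurs (\<lambda>n. x (of_nat n)) i w \<Longrightarrow> occurs x (of_nat i) w"
  by (simp add: occurs_def)

lemma language_sublist: "w \<in> language x \<Longrightarrow> sublist v w \<Longrightarrow> v \<in> language x"
  by (auto simp: language_iff sublist_def occurs_append)

lemma language_set: "x \<in> seqs A \<Longrightarrow> w \<in> language x \<Longrightarrow> set w \<subseteq> A"
  by (auto simp: language_def seqs_def in_set_conv_nth image_subset_iff)

text \<open>The block structure of a fixed point on an index set \<open>D\<close> closed under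
  successor. \<open>D\<close> is the whole index type except where a one-sided sequence is viewed as
  living on the nonnegative integers.\<close>

locale expansion =
  fixes \<phi> :: "'a \<Rightarrow> 'a list" and D :: "'i::comm_semiring_1 set" and x :: "'i \<Rightarrow> 'a" and p :: "'i \<Rightarrow> 'i"
  assumes D_0: "0 \<in> D" and D_step: "i \<in> D \<Longrightarrow> i + 1 \<in> D" and D_p: "i \<in> D \<Longrightarrow> p i \<in> D"
    and p_0: "p 0 = 0"
    and p_step: "i \<in> D \<Longrightarrow> p (i + 1) = p i + of_nat (length (\<phi> (x i)))"
    and occurs_p: "i \<in> D \<Longrightarrow> occurs x (p i) (\<phi> (x i))"
begin

lemma D_add: "i \<in> D \<Longrightarrow> i + of_nat n \<in> D"
proof (induction n)
  case (Suc n)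
  then show ?case using D_step[of "i + of_nat n"] by (simp add: algebra_simps)
qed simp

lemma p_word:
  assumes "i \<in> D" "occurs x i w"
  shows "p (i + of_nat (length w)) = p i + of_nat (length (subst_word \<phi> w)) \<and> occurs x (p i) (subst_word \<phi> w)"
  using assms
proof (induction w arbitrary: i)
  case (Cons b w)
  then have b: "x i = b" "occurs x (i + 1) w" by (auto simp: occurs_Cons)
  with Cons.IH[of "i + 1"] D_step[OF Cons.prems(1)]
  have "p (i + 1 + of_nat (length w)) = p (i + 1) + of_nat (length (subst_word \<phi> w))"
    "occurs x (p (i + 1)) (subst_word \<phi> w)" by auto
  then show ?case using p_step[OF Cons.prems(1)] occurs_p[OF Cons.prems(1)] b(1)
    by (simp add: subst_word_Cons occurs_append algebra_simps)
qed simp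

lemma pos_D: "i \<in> D \<Longrightarrow> (p ^^ n) i \<in> D"
  by (induction n) (auto intro: D_p)

lemma pos_0: "(p ^^ n) 0 = 0"
  by (induction n) (auto simp: p_0)

lemma pos_word:
  assumes "i \<in> D" "occurs x i w"
  shows pos_add: "(p ^^ n) (i + of_nat (length w)) = (p ^^ n) i + of_nat (length (iterate \<phi> n w))"
    and occurs_pos: "occurs x ((p ^^ n) i) (iterate \<phi> n w)"
proof -
  have "(p ^^ n) (i + of_nat (length w)) = (p ^^ n) i + of_nat (length (iterate \<phi> n w))
      \<and> occurs x ((p ^^ n) i) (iterate \<phi> n w)"
    by (induction n) (use assms p_word pos_D in auto)
  then show "(p ^^ n) (i + of_nat (length w)) = (p ^^ n) i + of_nat (length (iterate \<phi> n w))"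
    "occurs x ((p ^^ n) i) (iterate \<phi> n w)" by auto
qed

lemma occurs_prefix: "occurs x 0 (iterate \<phi> n [x 0])"
  using occurs_pos[of 0 "[x 0]" n] by (simp add: D_0 pos_0 occurs_Cons)

end

lemma fixed_point_expansion:
  assumes "fixed_point A \<phi> x"
  shows "\<exists>p. expansion \<phi> UNIV x p"
  using assms unfolding fixed_point_def is_image_seq_def expansion_def occurs_def by auto


section \<open>Return words\<close>

text \<open>The part of being a return word that does not refer to the sequence. Factorisation into
  such words is pure combinatorics; membership in the language is added afterwards.\<close>

definition marked :: "'a \<Rightarrow> 'a list \<Rightarrow> bool" where
  "marked a w \<longleftrightarrow> w \<noteq> [] \<and> hd w = a \<and> count_list w a = 1"

lemma marked_iff: "marked a w \<longleftrightarrow> (\<exists>w'. w = a # w' \<and> a \<notin> set w')"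
  by (cases w) (auto simp: marked_def count_list_0_iff)

lemma return_words_iff: "w \<in> return_words x a \<longleftrightarrow> marked a w \<and> w @ [a] \<in> language x"
  using language_sublist[of "w @ [a]" x w] by (auto simp: return_words_def marked_def)

lemma concat_marked: "vs \<in> lists (Collect (marked a)) \<Longrightarrow> concat vs = [] \<or> hd (concat vs) = a"
  by (cases vs) (auto simp: marked_iff)

lemma takeWhile_unmarked:
  "a \<notin> set u \<Longrightarrow> v = [] \<or> hd v = a \<Longrightarrow> takeWhile (\<lambda>b. b \<noteq> a) (u @ v) = u"
  by (induction u) (cases v; auto)+

text \<open>The cuts are forced: one before each occurrence of \<open>a\<close>.\<close>

lemma marked_factorization_unique:
  assumes "vs \<in> lists (Collect (marked a))" "vs' \<in> lists (Collect (marked a))" "concat vs = concat vs'"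
  shows "vs = vs'"
  using assms
proof (induction vs arbitrary: vs' rule: list.induct)
  case Nil
  then show ?case by (cases vs') (auto simp: marked_def)
next
  case (Cons v vs)
  have v: "marked a v" using Cons.prems(1) by simp
  then have "vs' \<noteq> []" using Cons.prems(3) by (auto simp: marked_def)
  then obtain v' vs'' where vs': "vs' = v' # vs''" by (meson list.exhaust)
  have v': "marked a v'" using Cons.prems(2) vs' by simp
  obtain u u' where u: "v = a # u" "a \<notin> set u" "v' = a # u'" "a \<notin> set u'"
    using v v' unfolding marked_iff by blast
  have lists: "vs \<in> lists (Collect (marked a))" "vs'' \<in> lists (Collect (marked a))"
    using Cons.prems vs' by auto
  have eq: "u @ concat vs = u' @ concat vs''" using Cons.prems(3) vs' u by simp
  have "u = u'"
    using takeWhile_unmarked[OF u(2) concat_marked[OF lists(1)]]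
      takeWhile_unmarked[OF u(4) concat_marked[OF lists(2)]] eq by simp
  with eq Cons.IH[OF lists] show ?case using vs' u by simp
qed

lemma marked_factorization_exists:
  assumes "u = [] \<or> hd u = a"
  shows "\<exists>vs\<in>lists (Collect (marked a)). concat vs = u"
  using assms
proof (induction u rule: length_induct)
  case (1 u)
  show ?case
  proof (cases u)
    case Nil
    then show ?thesis by (intro bexI[of _ "[]"]) auto
  next
    case (Cons b u')
    let ?t = "takeWhile (\<lambda>b. b \<noteq> a) u'" and ?d = "dropWhile (\<lambda>b. b \<noteq> a) u'"
    have "b = a" using 1(2) Cons by simp
    have "?d = [] \<or> hd ?d = a" using hd_dropWhile[of "\<lambda>b. b \<noteq> a" u'] by blast
    moreover have "length ?d < length u" using Cons by (simp add: le_imp_less_Suc length_dropWhile_le)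
    ultimately obtain vs where vs: "vs \<in> lists (Collect (marked a))" "concat vs = ?d" using 1(1) by blast
    have "a \<notin> set ?t" by (auto dest: set_takeWhileD)
    then have "marked a (a # ?t)" by (simp add: marked_iff)
    with vs \<open>b = a\<close> Cons show ?thesis by (intro bexI[of _ "(a # ?t) # vs"]) auto
  qed
qed

lemma marked_factorizationE:
  assumes "u = [] \<or> hd u = a"
  obtains vs where "vs \<in> lists (Collect (marked a))" "concat vs = u"
  using marked_factorization_exists[OF assms] by (elim bexE)

text \<open>Each factor is followed by the initial \<open>a\<close> of the next one, the last factor
  by the \<open>a\<close> appended to the whole word.\<close>

lemma marked_factorization_language:
  assumes vs: "vs \<in> lists (Collect (marked a))" and lang: "concat vs @ [a] \<in> language x"
  shows "vs \<in> lists (return_words x a)"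
proof (rule in_listsI, rule ballI)
  fix v assume "v \<in> set vs"
  then obtain vs1 vs2 where split: "vs = vs1 @ v # vs2" by (meson split_list)
  have "vs2 \<in> lists (Collect (marked a))" using vs split by auto
  then obtain t where t: "concat vs2 @ [a] = a # t"
    using concat_marked by (metis append_Cons append_Nil hd_Cons_tl)
  have "concat vs @ [a] = concat vs1 @ (v @ [a]) @ t" using t by (simp add: split)
  then have "v @ [a] \<in> language x" using lang by (metis language_sublist sublist_appendI)
  then show "v \<in> return_words x a" using vs split by (auto simp: return_words_iff)
qed

text \<open>Since \<open>w\<close> starts with \<open>a\<close> and is followed by \<open>a\<close>,
  both of its ends are cuts. Gluing factorisations of the two sides around \<open>w\<close> gives
  the unique factorisation of the whole.\<close>

lemma marked_factorization_factor:
  assumes vs: "vs \<in> lists (Collect (marked a))" and eq: "concat vs = s @ w @ a # t" and w: "marked a w"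
  shows "w \<in> set vs"
proof -
  have "s = [] \<or> hd s = a" using concat_marked[OF vs] unfolding eq by (cases s) simp_all
  then obtain vs1 where vs1: "vs1 \<in> lists (Collect (marked a))" "concat vs1 = s"
    by (rule marked_factorizationE)
  have "a # t = [] \<or> hd (a # t) = a" by simp
  then obtain vs2 where vs2: "vs2 \<in> lists (Collect (marked a))" "concat vs2 = a # t"
    by (rule marked_factorizationE)
  have "vs = vs1 @ w # vs2"
    by (rule marked_factorization_unique[OF vs]) (use vs1 vs2 w eq in \<open>simp_all\<close>)
  then show ?thesis by simp
qed

lemma return_words_lists: "vs \<in> lists (return_words x a) \<Longrightarrow> vs \<in> lists (Collect (marked a))"
  by (auto simp: return_words_iff)

lemma return_subst_factorization:
  assumes "vs \<in> lists (return_words x a)" "concat vs = subst_word \<phi> w"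
  shows "return_subst x a \<phi> w = vs"
  unfolding return_subst_def
proof (rule the_equality)
  show "vs \<in> lists (return_words x a) \<and> concat vs = subst_word \<phi> w" using assms by blast
  show "us = vs" if "us \<in> lists (return_words x a) \<and> concat us = subst_word \<phi> w" for us
    using that assms by (intro marked_factorization_unique[of us a vs] return_words_lists) auto
qed


text \<open>The distinct letters \<open>c\<close> and \<open>c'\<close> come from nonperiodicity and
  make the iterates grow. A two-sided fixed point is represented here by its right half.\<close>

locale primitive_sequence = expansion \<phi> UNIV x p
  for \<phi> :: "'a \<Rightarrow> 'a list" and x :: "nat \<Rightarrow> 'a" and p +
  fixes A :: "'a set" and c c' :: 'a
  assumes A: "finite A" "substitution A \<phi>" "primitive A \<phi>"
    and x_A: "x \<in> seqs A" and two: "c \<in> A" "c' \<in> A" "c \<noteq> c'"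
begin

abbreviation "a \<equiv> x 0"
abbreviation "R \<equiv> return_words x a"

lemma x_in: "x i \<in> A"
  using x_A by (auto simp: seqs_def)

lemma iterate_in: "b \<in> A \<Longrightarrow> set (iterate \<phi> n [b]) \<subseteq> A"
  using substitution_iterate[OF A(2), of "[b]"] by simp

lemma iterate_length_pos: "b \<in> A \<Longrightarrow> 1 \<le> length (iterate \<phi> n [b])"
  using length_iterate_mono[OF A, of "[b]" 0 n] by simp

lemma hd_iterate: "\<exists>u. iterate \<phi> n [a] = a # u"
proof -
  obtain b u where bu: "iterate \<phi> n [a] = b # u"
    using iterate_length_pos[OF x_in, of n 0] by (cases "iterate \<phi> n [a]") auto
  with occurs_prefix[of n] have "b = a" by (simp add: occurs_Cons)
  with bu show ?thesis by blast
qed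

lemma language_iterate: "w \<in> language x \<Longrightarrow> iterate \<phi> n w \<in> language x"
  by (auto simp: language_iff intro: occurs_pos)

lemma prefix_in_iterate: "\<exists>n0. \<forall>n\<ge>n0. \<forall>i w. occurs x i w \<longrightarrow> i + length w \<le> L \<longrightarrow> sublist w (iterate \<phi> n [a])"
proof -
  obtain n0 where n0: "\<And>n b. n \<ge> n0 \<Longrightarrow> b \<in> A \<Longrightarrow> L \<le> length (iterate \<phi> n [b])"
    using length_iterate_unbounded[OF A two] by blast
  have "sublist w (iterate \<phi> n [a])" if n: "n \<ge> n0" and w: "occurs x i w" "i + length w \<le> L" for n i w
  proof -
    let ?v = "iterate \<phi> n [a]"
    have len: "i + length w \<le> length ?v" using n0[OF n x_in] w(2) by (meson le_trans)
    have v: "?v = take i ?v @ take (length w) (drop i ?v) @ drop (length w) (drop i ?v)"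
      by (simp only: append_take_drop_id)
    have "occurs x (0 + of_nat (length (take i ?v))) (take (length w) (drop i ?v) @ drop (length w) (drop i ?v))"
      using occurs_prefix[of n] v by (metis occurs_append)
    then have "occurs x i (take (length w) (drop i ?v))" using len by (simp add: occurs_append)
    then have "take (length w) (drop i ?v) = w" using len by (intro occurs_eq[OF _ w(1)]) auto
    then show ?thesis using v by (metis sublist_appendI)
  qed
  then show ?thesis by blast
qed

lemma language_in_iterate: "v \<in> language x \<Longrightarrow> \<exists>n0. \<forall>n\<ge>n0. \<forall>b\<in>A. sublist v (iterate \<phi> n [b])"
proof -
  assume "v \<in> language x"
  then obtain i where i: "occurs x i v" by (auto simp: language_iff)
  obtain n1 where n1: "\<And>n. n \<ge> n1 \<Longrightarrow> sublist v (iterate \<phi> n [a])"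
    using prefix_in_iterate[of "i + length v"] i by auto
  obtain n0 where n0: "\<And>b. b \<in> A \<Longrightarrow> a \<in> set (iterate \<phi> n0 [b])"
    using primitive_letters[OF A] x_in by blast
  have "sublist v (iterate \<phi> n [b])" if "n \<ge> n1 + n0" "b \<in> A" for n b
  proof -
    have "sublist [a] (iterate \<phi> n0 [b])" using n0[OF that(2)]
      by (metis split_list append_Cons append_Nil sublist_appendI)
    then have "sublist (iterate \<phi> (n - n0) [a]) (iterate \<phi> (n - n0) (iterate \<phi> n0 [b]))"
      by (rule sublist_iterate)
    moreover have "sublist v (iterate \<phi> (n - n0) [a])" using that by (intro n1) simp
    ultimately show ?thesis using that(1) by (auto simp: iterate_iterate intro: sublist_order.order.trans)
  qed
  then show ?thesis by blast
qed

lemma length_iterate_bound: "\<exists>B. \<forall>b\<in>A. length (iterate \<phi> n [b]) \<le> B"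
  using A(1) by (intro exI[of _ "Max ((\<lambda>b. length (iterate \<phi> n [b])) ` A)"]) auto

text \<open>The sequence is a product of blocks \<open>\<phi>^n(x_i)\<close>, each of length at most
  \<open>B\<close> and each containing \<open>v\<close>. The next block boundary is at most
  \<open>B\<close> away, the occurrence inside the block at most another \<open>B\<close>.\<close>

lemma occurs_recurrent:
  assumes "v \<in> language x"
  shows "\<exists>N. \<forall>j. \<exists>j'\<in>{j..j+N}. occurs x j' v"
proof -
  obtain n where n: "\<And>b. b \<in> A \<Longrightarrow> sublist v (iterate \<phi> n [b])" using language_in_iterate[OF assms] by blast
  obtain B where B: "\<And>b. b \<in> A \<Longrightarrow> length (iterate \<phi> n [b]) \<le> B" using length_iterate_bound by blast
  let ?P = "p ^^ n"
  have step: "?P (Suc i) = ?P i + length (iterate \<phi> n [x i])" for i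
    using pos_add[of i "[x i]" n] by (simp add: occurs_Cons)
  have ge: "i \<le> ?P i" for i
  proof (induction i)
    case (Suc i)
    then show ?case using step[of i] iterate_length_pos[OF x_in, of n i] by linarith
  qed simp
  have "\<exists>j'\<in>{j..j+(B+B)}. occurs x j' v" for j
  proof -
    define i where "i = (LEAST i. j \<le> ?P i)"
    have i: "j \<le> ?P i" unfolding i_def using ge by (rule LeastI)
    have "?P i \<le> j + B"
    proof (cases i)
      case 0
      then show ?thesis by (simp add: pos_0)
    next
      case (Suc i')
      then have "\<not> j \<le> ?P i'" using not_less_Least[of i' "\<lambda>i. j \<le> ?P i"] by (simp add: i_def)
      then show ?thesis using step[of i'] B[OF x_in, of i'] Suc by simp
    qed
    moreover obtain u w where uw: "iterate \<phi> n [x i] = u @ v @ w"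
      using n[OF x_in, of i] by (auto simp: sublist_def)
    moreover have "occurs x (?P i) (iterate \<phi> n [x i])"
      using occurs_pos[of i "[x i]" n] by (simp add: occurs_Cons)
    moreover have "length u \<le> B" using uw B[OF x_in, of i] by simp
    ultimately show ?thesis using i by (intro bexI[of _ "?P i + length u"]) (auto simp: occurs_append)
  qed
  then show ?thesis by blast
qed

lemma return_word_length: "\<exists>N. \<forall>i w. occurs x i w \<longrightarrow> length w > N \<longrightarrow> a \<in> set w"
proof -
  have "occurs x 0 [a]" by (simp add: occurs_Cons)
  then have "[a] \<in> language x" unfolding language_iff by blast
  then obtain N where N: "\<And>j. \<exists>j'\<in>{j..j+N}. occurs x j' [a]"
    using occurs_recurrent[of "[a]"] by blast
  have "a \<in> set w" if w: "occurs x i w" "length w > N" for i w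
  proof -
    obtain j where j: "j \<in> {i..i+N}" "x j = a" using N[of i] by (auto simp: occurs_Cons)
    then have "w ! (j - i) = a" "j - i < length w" using w by (auto simp: occurs_def)
    then show ?thesis by (metis nth_mem)
  qed
  then show ?thesis by blast
qed

lemma R_bounded: "\<exists>N. \<forall>w\<in>R. length w \<le> N"
proof -
  obtain N where N: "\<And>i w. occurs x i w \<Longrightarrow> length w > N \<Longrightarrow> a \<in> set w" using return_word_length by blast
  have "length w \<le> Suc N" if w: "w \<in> R" for w
  proof -
    obtain w' where w': "w = a # w'" "a \<notin> set w'" using w by (auto simp: return_words_iff marked_iff)
    obtain i where "occurs x i (w @ [a])" using w by (auto simp: return_words_iff language_iff)
    then have "occurs x (i + 1) w'" using w'(1) by (simp add: occurs_append occurs_Cons)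
    with N w' show ?thesis by (metis length_Cons not_less_eq_eq not_le)
  qed
  then show ?thesis by blast
qed

lemma R_sub: "w \<in> R \<Longrightarrow> set w \<subseteq> A"
  using language_set[OF x_A, of "w @ [a]"] by (simp add: return_words_iff)

lemma finite_R: "finite R"
proof -
  obtain N where "\<And>w. w \<in> R \<Longrightarrow> length w \<le> N" using R_bounded by blast
  then have "R \<subseteq> {w. set w \<subseteq> A \<and> length w \<le> N}" using R_sub by blast
  then show ?thesis using finite_lists_length_le[OF A(1)] finite_subset by blast
qed

lemma R_nonempty: "R \<noteq> {}"
proof -
  obtain N where N: "\<And>i w. occurs x i w \<Longrightarrow> length w > N \<Longrightarrow> a \<in> set w" using return_word_length by blast
  have "a \<in> set (map (\<lambda>j. x (1 + of_nat j)) [0..<Suc N])" by (rule N[OF occurs_map]) simp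
  then obtain j where j: "x (Suc j) = a" by auto
  let ?u = "map (\<lambda>i. x (0 + of_nat i)) [0..<Suc j]"
  have u: "occurs x 0 ?u" by (rule occurs_map)
  have "?u = [] \<or> hd ?u = a" by (subst hd_map) (simp_all del: upt_Suc)
  then obtain vs where vs: "vs \<in> lists (Collect (marked a))" "concat vs = ?u"
    by (rule marked_factorizationE)
  have "occurs x 0 (?u @ [a])" using u j by (simp add: occurs_append occurs_Cons)
  then have "concat vs @ [a] \<in> language x" unfolding vs(2) language_iff by blast
  with vs(1) have "vs \<in> lists R" by (rule marked_factorization_language)
  moreover have "vs \<noteq> []" using vs(2) by auto
  ultimately show ?thesis by (cases vs) auto
qed

lemma iterate_factorization:
  assumes "w \<in> R"
  shows "\<exists>vs\<in>lists R. concat vs = iterate \<phi> n w"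
proof -
  obtain w' where w': "w = a # w'" using assms by (auto simp: return_words_iff marked_iff)
  obtain u where u: "iterate \<phi> n [a] = a # u" using hd_iterate by blast
  have "iterate \<phi> n w = a # u @ iterate \<phi> n w'" unfolding w' by (subst iterate_Cons) (simp add: u)
  then have "iterate \<phi> n w = [] \<or> hd (iterate \<phi> n w) = a" by simp
  then obtain vs where vs: "vs \<in> lists (Collect (marked a))" "concat vs = iterate \<phi> n w"
    by (rule marked_factorizationE)
  have "iterate \<phi> n (w @ [a]) \<in> language x" using assms unfolding return_words_iff by (intro language_iterate) blast
  then have "(concat vs @ [a]) @ u \<in> language x" by (simp add: u vs(2))
  then have "concat vs @ [a] \<in> language x" by (rule language_sublist) simp
  from marked_factorization_language[OF vs(1) this] vs(2) show ?thesis by (rule bexI[rotated])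
qed

lemma return_subst_word:
  assumes "w \<in> R"
  shows return_subst_lists: "return_subst x a \<phi> w \<in> lists R"
    and concat_return_subst: "concat (return_subst x a \<phi> w) = subst_word \<phi> w"
proof -
  have one: "iterate \<phi> 1 w = subst_word \<phi> w" by simp
  obtain vs where vs: "vs \<in> lists R" "concat vs = subst_word \<phi> w"
    using iterate_factorization[OF assms, of 1] unfolding one by (elim bexE)
  then show "return_subst x a \<phi> w \<in> lists R" "concat (return_subst x a \<phi> w) = subst_word \<phi> w"
    unfolding return_subst_factorization[OF vs] .
qed

text \<open>Primitivity of the return substitution, phrased through factorisations instead of matrix
  powers. A word \<open>w' a\<close> occurs in \<open>\<phi>^n(a)\<close> for large
  \<open>n\<close>, hence in the prefix of \<open>\<phi>^n(w)\<close>, and there \<open>w'\<close>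
  must be a factor.\<close>

lemma return_words_appear:
  "\<exists>n0. \<forall>n\<ge>n0. \<forall>w\<in>R. \<forall>vs\<in>lists R. concat vs = iterate \<phi> n w \<longrightarrow> R \<subseteq> set vs"
proof -
  have "\<exists>n0. \<forall>n\<ge>n0. sublist (w' @ [a]) (iterate \<phi> n [a])" if "w' \<in> R" for w'
    using that language_in_iterate[of "w' @ [a]"] x_in by (meson return_words_iff)
  then obtain f where f: "\<And>w' n. w' \<in> R \<Longrightarrow> n \<ge> f w' \<Longrightarrow> sublist (w' @ [a]) (iterate \<phi> n [a])" by metis
  have "w' \<in> set vs" if n: "n \<ge> Max (f ` R)" and w: "w \<in> R" "w' \<in> R" and vs: "vs \<in> lists R" "concat vs = iterate \<phi> n w"
    for n w w' vs
  proof -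
    have "f w' \<le> Max (f ` R)" using w(2) finite_R by simp
    with n have "f w' \<le> n" by simp
    then obtain s t where st: "iterate \<phi> n [a] = s @ (w' @ [a]) @ t" using f[OF w(2)] unfolding sublist_def by blast
    obtain u where u: "w = a # u" using w(1) unfolding return_words_iff marked_iff by blast
    have "iterate \<phi> n w = iterate \<phi> n [a] @ iterate \<phi> n u" unfolding u by (rule iterate_Cons)
    then have "concat vs = s @ w' @ a # (t @ iterate \<phi> n u)" unfolding vs(2) st by simp
    moreover have "marked a w'" using w(2) unfolding return_words_iff by blast
    ultimately show ?thesis using return_words_lists[OF vs(1)] by (intro marked_factorization_factor[of vs a])
  qed
  then show ?thesis by blast
qed

text \<open>Every letter occurs in one fixed iterate of \<open>a\<close>, and return words have
  bounded length, so the constant does not depend on \<open>n\<close>.\<close>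

lemma length_iterate_comparable: "\<exists>C>0. \<forall>n. \<forall>w\<in>R. length (iterate \<phi> n w) \<le> C * length (iterate \<phi> n [a])"
proof -
  obtain n0 where n0: "\<And>b. b \<in> A \<Longrightarrow> b \<in> set (iterate \<phi> n0 [a])"
    using primitive_letters[OF A] x_in by blast
  obtain B where B: "\<And>b. b \<in> A \<Longrightarrow> length (iterate \<phi> n0 [b]) \<le> B" using length_iterate_bound by blast
  obtain N where N: "\<And>w. w \<in> R \<Longrightarrow> length w \<le> N" using R_bounded by blast
  have word: "length (iterate \<phi> n w) \<le> length w * M" if "\<And>b. b \<in> set w \<Longrightarrow> length (iterate \<phi> n [b]) \<le> M" for n w M
    using that
  proof (induction w)
    case (Cons b w)
    then have "length (iterate \<phi> n [b]) \<le> M" "length (iterate \<phi> n w) \<le> length w * M" by auto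
    then show ?case by (subst iterate_Cons) simp
  qed simp
  have letter: "length (iterate \<phi> n [b]) \<le> B * length (iterate \<phi> n [a])" if "b \<in> A" for n b
  proof -
    have "sublist [b] (iterate \<phi> n0 [a])" using n0[OF that]
      by (metis split_list append_Cons append_Nil sublist_appendI)
    then have "sublist (iterate \<phi> n [b]) (iterate \<phi> n (iterate \<phi> n0 [a]))" by (rule sublist_iterate)
    then have "length (iterate \<phi> n [b]) \<le> length (iterate \<phi> n (iterate \<phi> n0 [a]))" by (rule sublist_length_le)
    \<comment> \<open>Exchanging the two iterations leaves the fixed exponent \<open>n0\<close>
      outside, where the growth per letter is bounded by \<open>B\<close>.\<close>
    also have "iterate \<phi> n (iterate \<phi> n0 [a]) = iterate \<phi> n0 (iterate \<phi> n [a])"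
      by (simp add: iterate_iterate add.commute)
    also have "length \<dots> \<le> length (iterate \<phi> n [a]) * B"
      by (rule word) (use B iterate_in[OF x_in] in blast)
    finally show ?thesis by (simp add: mult.commute)
  qed
  have "length (iterate \<phi> n w) \<le> Suc (N * B) * length (iterate \<phi> n [a])" if "w \<in> R" for n w
  proof -
    have "length (iterate \<phi> n w) \<le> length w * (B * length (iterate \<phi> n [a]))"
      by (rule word) (use letter R_sub[OF that] in blast)
    also have "\<dots> \<le> N * (B * length (iterate \<phi> n [a]))" using N[OF that] by simp
    finally show ?thesis by simp
  qed
  then show ?thesis by blast
qed

end


section \<open>Powers of a matrix beyond its nilpotent part\<close>

lemma diag_block_mat_factor:
  fixes F G H :: "'b \<Rightarrow> 'c::comm_ring_1 mat"
  assumes "\<And>b. b \<in> set bs \<Longrightarrow>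
    F b \<in> carrier_mat (d b) (d b) \<and> G b \<in> carrier_mat (d b) (d b) \<and> H b \<in> carrier_mat (d b) (d b) \<and> F b = G b * H b"
  shows "diag_block_mat (map F bs) = diag_block_mat (map G bs) * diag_block_mat (map H bs)
    \<and> diag_block_mat (map F bs) \<in> carrier_mat (sum_list (map d bs)) (sum_list (map d bs))
    \<and> diag_block_mat (map G bs) \<in> carrier_mat (sum_list (map d bs)) (sum_list (map d bs))
    \<and> diag_block_mat (map H bs) \<in> carrier_mat (sum_list (map d bs)) (sum_list (map d bs))"
  using assms
proof (induction bs)
  case (Cons b bs)
  let ?n = "d b" and ?m = "sum_list (map d bs)"
  let ?F = "diag_block_mat (map F bs)" and ?G = "diag_block_mat (map G bs)" and ?H = "diag_block_mat (map H bs)"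
  have IH: "?F = ?G * ?H" "?F \<in> carrier_mat ?m ?m" "?G \<in> carrier_mat ?m ?m" "?H \<in> carrier_mat ?m ?m"
    using Cons.IH[OF Cons.prems[OF list.set_intros(2)]] by blast+
  have b: "F b \<in> carrier_mat ?n ?n" "G b \<in> carrier_mat ?n ?n" "H b \<in> carrier_mat ?n ?n" "F b = G b * H b"
    using Cons.prems[OF list.set_intros(1)] by blast+
  have eqs: "diag_block_mat (map K (b # bs)) = four_block_mat (K b) (0\<^sub>m ?n ?m) (0\<^sub>m ?m ?n) (diag_block_mat (map K bs))"
    if "K b \<in> carrier_mat ?n ?n" "diag_block_mat (map K bs) \<in> carrier_mat ?m ?m" for K :: "'b \<Rightarrow> 'c mat"
    using that by (simp add: Let_def)
  have "four_block_mat (G b) (0\<^sub>m ?n ?m) (0\<^sub>m ?m ?n) ?G * four_block_mat (H b) (0\<^sub>m ?n ?m) (0\<^sub>m ?m ?n) ?H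
      = four_block_mat (G b * H b + 0\<^sub>m ?n ?m * 0\<^sub>m ?m ?n) (G b * 0\<^sub>m ?n ?m + 0\<^sub>m ?n ?m * ?H)
          (0\<^sub>m ?m ?n * H b + ?G * 0\<^sub>m ?m ?n) (0\<^sub>m ?m ?n * 0\<^sub>m ?n ?m + ?G * ?H)"
    using b IH by (intro mult_four_block_mat) auto
  also have "\<dots> = four_block_mat (F b) (0\<^sub>m ?n ?m) (0\<^sub>m ?m ?n) ?F"
    using b IH by simp
  finally have "diag_block_mat (map F (b # bs)) = diag_block_mat (map G (b # bs)) * diag_block_mat (map H (b # bs))"
    by (simp only: eqs[OF b(1) IH(2)] eqs[OF b(2) IH(3)] eqs[OF b(3) IH(4)])
  moreover have "four_block_mat (K b) (0\<^sub>m ?n ?m) (0\<^sub>m ?m ?n) (diag_block_mat (map K bs)) \<in> carrier_mat (?n + ?m) (?n + ?m)"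
    if "K b \<in> carrier_mat ?n ?n" "diag_block_mat (map K bs) \<in> carrier_mat ?m ?m" for K :: "'b \<Rightarrow> 'c mat"
    using that by (rule four_block_carrier_mat)
  ultimately show ?case
    using eqs[OF b(1) IH(2)] eqs[OF b(2) IH(3)] eqs[OF b(3) IH(4)] b IH
    by (simp del: diag_block_mat.simps)
qed simp

text \<open>A nilpotent block of size at most \<open>s\<close> vanishes at the power
  \<open>s\<close>; any other block is invertible, and \<open>Z\<close> is its inverse.\<close>

lemma jordan_block_power_factor:
  fixes ev :: complex
  assumes "ev = 0 \<Longrightarrow> n \<le> s"
  shows "\<exists>Z\<in>carrier_mat n n. jordan_block n ev ^\<^sub>m s = jordan_block n ev ^\<^sub>m Suc s * Z"
proof (cases "ev = 0")
  case True
  then have "jordan_block n ev ^\<^sub>m s = 0\<^sub>m n n" using assms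
    by (intro eq_matI) (auto simp: jordan_block_zero_pow)
  then show ?thesis by (intro bexI[of _ "0\<^sub>m n n"]) auto
next
  case False
  let ?J = "jordan_block n ev"
  have J: "?J \<in> carrier_mat n n" by simp
  have "det ?J = prod_list (diag_mat ?J)"
    by (rule det_upper_triangular[OF _ J]) (auto simp: jordan_block_def)
  then have det: "det ?J \<noteq> 0" using False by (simp add: prod_list_diag_prod)
  define B where "B = inverse (det ?J) \<cdot>\<^sub>m adj_mat ?J"
  have B: "B \<in> carrier_mat n n" unfolding B_def using adj_mat(1)[OF J] by simp
  have "?J * B = inverse (det ?J) \<cdot>\<^sub>m (?J * adj_mat ?J)"
    unfolding B_def by (rule mult_smult_distrib[OF J adj_mat(1)[OF J]])
  also have "\<dots> = 1\<^sub>m n" unfolding adj_mat(2)[OF J] using det by (auto simp: smult_smult_assoc)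
  finally have JB: "?J * B = 1\<^sub>m n" .
  have "?J ^\<^sub>m Suc s * B = ?J ^\<^sub>m s * (?J * B)"
    using B by (simp add: assoc_mult_mat[OF pow_carrier_mat[OF J] J])
  also have "\<dots> = ?J ^\<^sub>m s" unfolding JB by simp
  finally show ?thesis using B by metis
qed

lemma pow_mat_Suc_left: "A \<in> carrier_mat n n \<Longrightarrow> A ^\<^sub>m Suc k = A * (A ^\<^sub>m k)"
proof (induction k)
  case (Suc k)
  have "A ^\<^sub>m Suc (Suc k) = (A * A ^\<^sub>m k) * A" using Suc by simp
  also have "\<dots> = A * (A ^\<^sub>m k * A)" using Suc.prems by (intro assoc_mult_mat) auto
  finally show ?case by simp
qed simp

lemma transpose_pow_mat:
  fixes A :: "'c::comm_ring_1 mat"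
  assumes A: "A \<in> carrier_mat n n"
  shows "transpose_mat (A ^\<^sub>m k) = transpose_mat A ^\<^sub>m k"
proof (induction k)
  case 0
  then show ?case using A by simp
next
  case (Suc k)
  have "transpose_mat (A ^\<^sub>m Suc k) = transpose_mat A * transpose_mat (A ^\<^sub>m k)"
    using A by (simp add: transpose_mult[of _ n n _ n])
  also have "\<dots> = transpose_mat A ^\<^sub>m Suc k"
    unfolding Suc using A by (intro pow_mat_Suc_left[symmetric]) simp
  finally show ?case .
qed

text \<open>Says that the column space of the powers of \<open>M\<close> stops shrinking at
  \<open>s\<close>. The factor \<open>Z\<close> stands on the right so that after transposition it
  acts on the left, giving equal kernels of the powers \<open>s\<close> and \<open>s + 1\<close> of
  the transpose.\<close>

lemma power_largest_jordan_block_factor: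
  fixes M :: "complex mat"
  assumes M: "M \<in> carrier_mat n n"
  defines "s \<equiv> largest_jordan_block M 0"
  shows "\<exists>Z\<in>carrier_mat n n. M ^\<^sub>m s = M ^\<^sub>m Suc s * Z"
proof -
  obtain n_as where jnf: "jordan_nf M n_as"
    using jordan_nf_exists[OF M] char_poly_factorized[OF M] by blast
  have bound: "m \<le> n" if "jordan_nf M n_as'" "(m, ev) \<in> set n_as'" for n_as' m and ev :: complex
  proof -
    have "similar_mat M (jordan_matrix n_as')" using that(1) by (simp add: jordan_nf_def)
    then have "n = sum_list (map fst n_as')" using similar_matD[of M] M by fastforce
    moreover have "m \<le> sum_list (map fst n_as')" using that(2) by (intro member_le_sum_list) force+
    ultimately show ?thesis by simp
  qed
  \<comment> \<open>Block sizes are at most \<open>n\<close>, so the \<open>Max\<close> in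
    \<open>largest_jordan_block\<close> ranges over a finite set and bounds the blocks of the chosen
    normal form.\<close>
  have "finite {m. \<exists>n_as. jordan_nf M n_as \<and> (m, 0) \<in> set n_as}"
    by (rule finite_subset[of _ "{..n}"]) (use bound in auto)
  then have s: "m \<le> s" if "(m, 0) \<in> set n_as" for m
    unfolding s_def largest_jordan_block_def using jnf that by (intro Max_ge) auto
  have "\<forall>b\<in>set n_as. \<exists>Z\<in>carrier_mat (fst b) (fst b).
      jordan_block (fst b) (snd b) ^\<^sub>m s = jordan_block (fst b) (snd b) ^\<^sub>m Suc s * Z"
    using s by (intro ballI jordan_block_power_factor) (metis prod.collapse)
  then obtain Z where Z: "\<And>b. b \<in> set n_as \<Longrightarrow> Z b \<in> carrier_mat (fst b) (fst b) \<and>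
      jordan_block (fst b) (snd b) ^\<^sub>m s = jordan_block (fst b) (snd b) ^\<^sub>m Suc s * Z b" by metis
  define J where "J = jordan_matrix n_as"
  define ZZ where "ZZ = diag_block_mat (map Z n_as)"
  let ?N = "sum_list (map fst n_as)"
  have J_pow: "J ^\<^sub>m r = diag_block_mat (map (\<lambda>b. jordan_block (fst b) (snd b) ^\<^sub>m r) n_as)" for r
    unfolding J_def jordan_matrix_pow by (simp add: case_prod_unfold)
  have "J ^\<^sub>m s = J ^\<^sub>m Suc s * ZZ \<and> ZZ \<in> carrier_mat ?N ?N"
    unfolding J_pow ZZ_def
    using diag_block_mat_factor[of n_as "\<lambda>b. jordan_block (fst b) (snd b) ^\<^sub>m s" fst
        "\<lambda>b. jordan_block (fst b) (snd b) ^\<^sub>m Suc s" Z] Z jordan_block_pow_carrier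
    by blast
  then have JZ: "J ^\<^sub>m s = J ^\<^sub>m Suc s * ZZ" "ZZ \<in> carrier_mat ?N ?N" by auto
  obtain P Q where wit: "similar_mat_wit M J P Q"
    using jnf unfolding jordan_nf_def similar_mat_def J_def by blast
  then have wit_n: "P * Q = 1\<^sub>m n" "Q * P = 1\<^sub>m n" "P \<in> carrier_mat n n" "Q \<in> carrier_mat n n" "J \<in> carrier_mat n n"
    using similar_mat_witD2[OF M wit] by auto
  have "J \<in> carrier_mat ?N ?N" unfolding J_def by simp
  with wit_n(5) have "?N = n" by auto
  with JZ have ZZn: "ZZ \<in> carrier_mat n n" by simp
  have pow: "M ^\<^sub>m r = P * J ^\<^sub>m r * Q" for r
    using similar_mat_wit_pow[OF wit, of r] similar_mat_witD2(3)[OF pow_carrier_mat[OF M]] by blast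
  let ?J = "J ^\<^sub>m Suc s"
  have Jc: "?J \<in> carrier_mat n n" using wit_n(5) by (rule pow_carrier_mat)
  \<comment> \<open>The witness is \<open>ZZ\<close> transported back by the similarity. All that
    follows is reassociation around \<open>Q * P = 1\<close>.\<close>
  have "M ^\<^sub>m Suc s * (P * ZZ * Q) = P * ?J * Q * (P * ZZ * Q)" unfolding pow ..
  also have "\<dots> = P * ?J * (Q * (P * ZZ * Q))"
    by (insert wit_n(3,4) ZZn Jc, rule assoc_mult_mat[of _ n n _ n _ n]; (assumption | rule mult_carrier_mat[of _ n n _ n])+)
  also have "P * ZZ * Q = P * (ZZ * Q)"
    by (insert wit_n(3,4) ZZn Jc, rule assoc_mult_mat[of _ n n _ n _ n]; (assumption | rule mult_carrier_mat[of _ n n _ n])+)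
  also have "Q * (P * (ZZ * Q)) = Q * P * (ZZ * Q)"
    by (insert wit_n(3,4) ZZn Jc, rule assoc_mult_mat[of _ n n _ n _ n, symmetric]; (assumption | rule mult_carrier_mat[of _ n n _ n])+)
  also have "\<dots> = ZZ * Q" unfolding wit_n(2) by (rule left_mult_one_mat[of _ n n], rule mult_carrier_mat[OF ZZn wit_n(4)])
  also have "P * ?J * (ZZ * Q) = P * (?J * (ZZ * Q))"
    by (insert wit_n(3,4) ZZn Jc, rule assoc_mult_mat[of _ n n _ n _ n]; (assumption | rule mult_carrier_mat[of _ n n _ n])+)
  also have "?J * (ZZ * Q) = ?J * ZZ * Q"
    by (insert wit_n(3,4) ZZn Jc, rule assoc_mult_mat[of _ n n _ n _ n, symmetric]; (assumption | rule mult_carrier_mat[of _ n n _ n])+)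
  also have "P * (?J * ZZ * Q) = P * (?J * ZZ) * Q"
    by (insert wit_n(3,4) ZZn Jc, rule assoc_mult_mat[of _ n n _ n _ n, symmetric]; (assumption | rule mult_carrier_mat[of _ n n _ n])+)
  also have "\<dots> = M ^\<^sub>m s" unfolding JZ(1)[symmetric] pow ..
  finally show ?thesis using mult_carrier_mat[OF wit_n(3) mult_carrier_mat[OF ZZn wit_n(4)]]
    by (intro bexI[of _ "P * (ZZ * Q)"]) (rule sym)
qed

lemma mult_mat_zero_vec: "A \<in> carrier_mat nr nc \<Longrightarrow> A *\<^sub>v 0\<^sub>v nc = 0\<^sub>v nr"
  by (intro eq_vecI) (auto simp: scalar_prod_def)

lemma vec_eq_if_minus_zero:
  fixes u v :: "'c::ab_group_add vec"
  assumes "u \<in> carrier_vec n" "v \<in> carrier_vec n" "u - v = 0\<^sub>v n"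
  shows "u = v"
proof (rule eq_vecI)
  fix i assume "i < dim_vec v"
  then have "(u - v) $ i = 0" using assms by simp
  then show "u $ i = v $ i" using \<open>i < dim_vec v\<close> by simp
qed (use assms in auto)

text \<open>Once zero, the orbit \<open>d\<close> stays zero, so \<open>d (s + t)\<close> vanishes
  for any \<open>t\<close>, also for \<open>t < s\<close>. From there the factorisation of the power
  \<open>s\<close> leads down to \<open>d s\<close> one index at a time.\<close>

lemma largest_jordan_block_stable:
  fixes M :: "complex mat" and d :: "nat \<Rightarrow> complex vec"
  assumes M: "M \<in> carrier_mat n n"
    and d: "\<And>i. d i \<in> carrier_vec n" "\<And>i. transpose_mat M *\<^sub>v d i = d (Suc i)"
    and zero: "d t = 0\<^sub>v n"
  shows "d (largest_jordan_block M 0) = 0\<^sub>v n"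
proof -
  define s where "s = largest_jordan_block M 0"
  let ?N = "transpose_mat M"
  have N: "?N \<in> carrier_mat n n" using M by simp
  obtain Z where Z: "Z \<in> carrier_mat n n" "M ^\<^sub>m s = M ^\<^sub>m Suc s * Z"
    using power_largest_jordan_block_factor[OF M] unfolding s_def by blast
  have N_pow: "?N ^\<^sub>m s = transpose_mat Z * ?N ^\<^sub>m Suc s"
    unfolding transpose_pow_mat[OF M, symmetric] Z(2)
    by (rule transpose_mult[of _ n n _ n]) (use M Z in auto)
  have iter: "?N ^\<^sub>m k *\<^sub>v d i = d (i + k)" for k i
  proof (induction k arbitrary: i)
    case 0
    then show ?case using d(1) M by simp
  next
    case (Suc k)
    have "?N ^\<^sub>m Suc k *\<^sub>v d i = ?N ^\<^sub>m k *\<^sub>v (?N *\<^sub>v d i)"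
      unfolding pow_mat.simps by (rule assoc_mult_mat_vec[of _ n n _ n]) (use N d(1) in auto)
    then show ?case using d(2) Suc by simp
  qed
  have descend: "d (s + k) = 0\<^sub>v n" if "d (s + Suc k) = 0\<^sub>v n" for k
  proof -
    have "d (s + k) = ?N ^\<^sub>m s *\<^sub>v d k" by (simp add: iter add.commute)
    also have "\<dots> = transpose_mat Z *\<^sub>v (?N ^\<^sub>m Suc s *\<^sub>v d k)"
      unfolding N_pow by (rule assoc_mult_mat_vec[of _ n n _ n]) (use N d(1) Z pow_carrier_mat[OF N] in \<open>auto simp del: pow_mat.simps\<close>)
    also have "?N ^\<^sub>m Suc s *\<^sub>v d k = 0\<^sub>v n" unfolding iter using that by (simp add: add.commute)
    also have "transpose_mat Z *\<^sub>v 0\<^sub>v n = 0\<^sub>v n"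
      by (rule mult_mat_zero_vec) (use Z(1) in simp)
    finally show ?thesis .
  qed
  have "d (t + k) = 0\<^sub>v n" for k
  proof (induction k)
    case (Suc k)
    then have "d (t + Suc k) = ?N *\<^sub>v 0\<^sub>v n" using d(2)[of "t + k"] by simp
    then show ?case unfolding mult_mat_zero_vec[OF N] .
  qed (simp add: zero)
  then have "d (s + t) = 0\<^sub>v n" by (metis add.commute)
  then have "d s = 0\<^sub>v n"
  proof (induction t)
    case (Suc t)
    then show ?case using descend by blast
  qed simp
  then show ?thesis unfolding s_def .
qed


section \<open>Lengths of iterated return words\<close>

lemma power_bracket:
  fixes c k X :: nat
  assumes "k \<ge> 2" "c \<ge> 1" "c \<le> X"
  shows "\<exists>m. c * k ^ m \<le> X \<and> X < c * k ^ Suc m"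
proof -
  have ex: "X < c * k ^ Suc X"
  proof -
    have "X < 2 ^ X" by simp
    also have "\<dots> \<le> k ^ X" using assms(1) by (rule power_mono) simp
    also have "\<dots> \<le> k ^ Suc X" using assms(1) by simp
    also have "\<dots> \<le> c * k ^ Suc X" using assms(2) by simp
    finally show ?thesis .
  qed
  define m where "m = (LEAST m. X < c * k ^ Suc m)"
  have m: "X < c * k ^ Suc m" unfolding m_def by (rule LeastI[of "\<lambda>m. X < c * k ^ Suc m", OF ex])
  have "c * k ^ m \<le> X"
  proof (cases m)
    case 0
    then show ?thesis using assms(3) by simp
  next
    case (Suc m')
    then show ?thesis using not_less_Least[of m' "\<lambda>m. X < c * k ^ Suc m"] by (simp add: m_def)
  qed
  with m show ?thesis by blast
qed

text \<open>The letter at offset \<open>i\<close> of \<open>\<psi>^m(c)\<close>: the automaton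
  started in \<open>c\<close> reads the \<open>m\<close> base-\<open>k\<close> digits of
  \<open>i\<close>, most significant first.\<close>

primrec constant_length_state :: "nat \<Rightarrow> ('c \<Rightarrow> 'c list) \<Rightarrow> nat \<Rightarrow> 'c \<Rightarrow> nat \<Rightarrow> 'c" where
  "constant_length_state k \<psi> 0 c i = c"
| "constant_length_state k \<psi> (Suc m) c i = \<psi> (constant_length_state k \<psi> m c (i div k)) ! (i mod k)"

lemma constant_length_state_correct:
  fixes z :: "nat \<Rightarrow> 'c"
  assumes k: "k > 0" and z: "\<And>n j. j < k \<Longrightarrow> z (k * n + j) = \<psi> (z n) ! j"
  shows "i < k ^ m \<Longrightarrow> z (k ^ m * n + i) = constant_length_state k \<psi> m (z n) i"
proof (induction m arbitrary: i)
  case (Suc m)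
  have "i div k < k ^ m" using Suc.prems k by (simp add: less_mult_imp_div_less mult.commute)
  moreover have "k ^ Suc m * n + i = k * (k ^ m * n + i div k) + i mod k"
    by (simp add: distrib_left mult.assoc)
  ultimately show ?case using Suc.IH z[of "i mod k" "k ^ m * n + i div k"] k by simp
qed simp

context primitive_sequence
begin

lemma R_in_pos: "w \<in> R \<Longrightarrow> 1 \<le> length (iterate \<phi> n w)"
proof -
  assume "w \<in> R"
  then have "w \<noteq> []" "set w \<subseteq> A" using R_sub by (auto simp: return_words_iff marked_def)
  then have "1 \<le> length w" "length w \<le> length (iterate \<phi> n w)"
    using length_iterate_mono[OF A, of w 0 n] by (auto simp: Suc_leI)
  then show ?thesis by linarith
qed

lemma length_iterate_concat:
  "length (iterate \<phi> n (concat vs)) = sum_list (map (\<lambda>w. length (iterate \<phi> n w)) vs)"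
  by (simp add: iterate_concat length_concat o_def)

lemma length_vector_in: "length_vector \<phi> n R \<in> carrier_vec (card R)"
  unfolding length_vector_def
  by (metis carrier_vec_dim_vec dim_vec_of_list finite_R length_letters length_map)

lemma length_vector_nth:
  "j < card R \<Longrightarrow> length_vector \<phi> n R $ j = of_nat (length (iterate \<phi> n (letters R ! j)))"
  by (simp add: length_vector_def vec_of_list_index length_letters[OF finite_R])

abbreviation "M \<equiv> incidence_matrix R (return_subst x a \<phi>) :: complex mat"

lemma M_in: "M \<in> carrier_mat (card R) (card R)"
  by (simp add: incidence_matrix_def)

text \<open>Cutting \<open>\<phi>(w)\<close> into return words before applying
  \<open>\<phi>^n\<close> turns its length into a sum weighted by a column of
  \<open>M\<close>.\<close>

lemma length_vector_step: "transpose_mat M *\<^sub>v length_vector \<phi> n R = length_vector \<phi> (Suc n) R"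
proof (rule eq_vecI)
  fix j assume "j < dim_vec (length_vector \<phi> (Suc n) R)"
  then have j: "j < card R" using length_vector_in by (metis carrier_vecD)
  let ?w = "letters R ! j"
  have w: "?w \<in> R" using nth_letters_in[OF finite_R j] .
  have "(transpose_mat M *\<^sub>v length_vector \<phi> n R) $ j
      = (\<Sum>i<card R. of_nat (count_list (return_subst x a \<phi> ?w) (letters R ! i)) *
          of_nat (length (iterate \<phi> n (letters R ! i))))"
    using j M_in length_vector_in[of n]
    by (simp add: scalar_prod_def atLeast0LessThan length_vector_nth incidence_matrix_def)
  also have "\<dots> = sum_list (map (\<lambda>v. of_nat (length (iterate \<phi> n v))) (return_subst x a \<phi> ?w))"
    using return_subst_lists[OF w] by (intro sum_list_letters[OF finite_R, symmetric]) auto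
  also have "\<dots> = of_nat (length (iterate \<phi> n (concat (return_subst x a \<phi> ?w))))"
    by (simp add: length_iterate_concat o_def flip: sum_list_of_nat)
  also have "\<dots> = of_nat (length (iterate \<phi> (Suc n) ?w))"
    by (simp only: concat_return_subst[OF w] iterate_Suc_right)
  also have "\<dots> = length_vector \<phi> (Suc n) R $ j" using j by (simp only: length_vector_nth)
  finally show "(transpose_mat M *\<^sub>v length_vector \<phi> n R) $ j = length_vector \<phi> (Suc n) R $ j" .
next
  show "dim_vec (transpose_mat M *\<^sub>v length_vector \<phi> n R) = dim_vec (length_vector \<phi> (Suc n) R)"
    using M_in length_vector_in by (metis carrier_matD(2) carrier_vecD dim_mult_mat_vec index_transpose_mat(2))
qed

lemma length_vector_nonzero: "length_vector \<phi> n R \<noteq> 0\<^sub>v (card R)"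
proof -
  obtain j where j: "j < card R" "letters R ! j \<in> R"
    using R_nonempty nth_letters_surj[OF finite_R] by blast
  have "1 \<le> length (iterate \<phi> n (letters R ! j))" by (rule R_in_pos[OF j(2)])
  then have "length (iterate \<phi> n (letters R ! j)) \<noteq> 0" by linarith
  then have "length_vector \<phi> n R $ j \<noteq> 0" unfolding length_vector_nth[OF j(1)] of_nat_eq_0_iff .
  then show ?thesis using j(1) by auto
qed

lemma left_eigenvector_iff:
  "left_eigenvector M (length_vector \<phi> s R) \<longleftrightarrow>
    (\<exists>ev. length_vector \<phi> (Suc s) R = ev \<cdot>\<^sub>v length_vector \<phi> s R)"
  unfolding left_eigenvector_def eigenvector_def
  using length_vector_in length_vector_nonzero M_in length_vector_step by simp

text \<open>Both \<open>u = L_n\<close> and \<open>v = L_{n+1}\<close> are multiplied by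
  \<open>q ^ n0\<close> under the positive matrix \<open>M^(h n0)\<close>. If \<open>c\<close> is
  the least ratio of \<open>v\<close> to \<open>u\<close>, attained at \<open>w0\<close>, then
  \<open>v - c u\<close> is nonnegative and vanishes at \<open>w0\<close>; the positive column of
  \<open>w0\<close> then makes it vanish everywhere.\<close>

lemma proportional_lengths:
  assumes h: "h > 0" and scale: "\<And>w. w \<in> R \<Longrightarrow> length (iterate \<phi> (n + h) w) = q * length (iterate \<phi> n w)"
  shows "\<exists>\<theta>::real. \<forall>w\<in>R. length (iterate \<phi> (Suc n) w) = \<theta> * length (iterate \<phi> n w)"
proof -
  have concat_scale: "length (iterate \<phi> (n + h) (concat vs)) = q * length (iterate \<phi> n (concat vs))"
    if "vs \<in> lists R" for vs
    using that unfolding length_iterate_concat sum_list_const_mult[symmetric]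
    by (intro arg_cong[of _ _ sum_list] map_cong refl scale) auto
  have more: "length (iterate \<phi> (n + m + h) w) = q * length (iterate \<phi> (n + m) w)" if "w \<in> R" for m w
  proof -
    obtain vs where vs: "vs \<in> lists R" "concat vs = iterate \<phi> m w"
      using iterate_factorization[OF \<open>w \<in> R\<close>, of m] by (elim bexE)
    have "length (iterate \<phi> (n + h) (iterate \<phi> m w)) = q * length (iterate \<phi> n (iterate \<phi> m w))"
      using concat_scale[OF vs(1)] unfolding vs(2) .
    then show ?thesis by (simp add: iterate_iterate add.commute add.left_commute)
  qed
  have mult: "length (iterate \<phi> (n + m + h * j) w) = q ^ j * length (iterate \<phi> (n + m) w)" if "w \<in> R" for m j w
  proof (induction j)
    case (Suc j)
    have "n + m + h * Suc j = n + (m + h * j) + h" by simp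
    then show ?case using more[OF that, of "m + h * j"] Suc by (simp add: ac_simps)
  qed simp
  define u v :: "'a list \<Rightarrow> real"
    where "u w = length (iterate \<phi> n w)" and "v w = length (iterate \<phi> (Suc n) w)" for w
  have u_pos: "u w > 0" if "w \<in> R" for w using R_in_pos[OF that, of n] by (simp add: u_def Suc_le_eq del: length_greater_0_conv)
  obtain w0 where w0: "w0 \<in> R" "\<And>w. w \<in> R \<Longrightarrow> v w0 / u w0 \<le> v w / u w"
    using finite_R R_nonempty arg_min_if_finite[of R "\<lambda>w. v w / u w"] by (metis not_less)
  define c where "c = v w0 / u w0"
  have nonneg: "0 \<le> v w - c * u w" if "w \<in> R" for w
    using w0(2)[OF that] u_pos[OF that] by (simp add: c_def field_simps)
  obtain n0 where n0: "\<And>n w vs. n \<ge> n0 \<Longrightarrow> w \<in> R \<Longrightarrow> vs \<in> lists R \<Longrightarrow> concat vs = iterate \<phi> n w \<Longrightarrow> R \<subseteq> set vs"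
    using return_words_appear by blast
  obtain vs where vs: "vs \<in> lists R" "concat vs = iterate \<phi> (h * n0) w0"
    using iterate_factorization[OF w0(1), of "h * n0"] by (elim bexE)
  have "n0 \<le> h * n0" using h by simp
  then have R_vs: "R \<subseteq> set vs" using n0[OF _ w0(1) vs] by blast
  have sum_u: "sum_list (map u vs) = real (length (iterate \<phi> (n + h * n0) w0))"
    and sum_v: "sum_list (map v vs) = real (length (iterate \<phi> (Suc n + h * n0) w0))"
  proof -
    have "sum_list (map (\<lambda>w. real (length (iterate \<phi> m w))) vs) = real (length (iterate \<phi> (m + h * n0) w0))" for m
    proof -
      have "sum_list (map (\<lambda>w. real (length (iterate \<phi> m w))) vs) = real (length (iterate \<phi> m (concat vs)))"
        unfolding length_iterate_concat by (induction vs) simp_all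
      then show ?thesis by (simp only: vs(2) iterate_iterate)
    qed
    then show "sum_list (map u vs) = real (length (iterate \<phi> (n + h * n0) w0))"
      "sum_list (map v vs) = real (length (iterate \<phi> (Suc n + h * n0) w0))"
      unfolding u_def v_def by blast+
  qed
  \<comment> \<open>The entry at \<open>w0\<close> of \<open>v - c u\<close> multiplied by
    \<open>M^(h n0)\<close>, written as a sum over the return words in
    \<open>\<phi>^(h n0)(w0)\<close>.\<close>
  have "sum_list (map (\<lambda>w. v w - c * u w) vs) = sum_list (map v vs) - c * sum_list (map u vs)"
    by (simp add: sum_list_subtractf sum_list_const_mult)
  also have "\<dots> = q ^ n0 * v w0 - c * (q ^ n0 * u w0)"
    using mult[OF w0(1), of 0 n0] mult[OF w0(1), of 1 n0] unfolding sum_u sum_v u_def v_def by simp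
  also have "\<dots> = 0" using u_pos[OF w0(1)] by (simp add: c_def)
  finally have "sum_list (map (\<lambda>w. v w - c * u w) vs) = 0" .
  moreover have "\<forall>w\<in>set vs. 0 \<le> v w - c * u w" using nonneg vs(1) by auto
  ultimately have "\<forall>w\<in>set vs. v w - c * u w = 0"
    by (subst (asm) sum_list_nonneg_eq_0_iff) auto
  then have "\<forall>w\<in>R. v w = c * u w" using R_vs by auto
  then show ?thesis unfolding u_def v_def by blast
qed

lemma eigenvector_if_proportional:
  fixes \<theta> :: real
  assumes theta: "\<forall>w\<in>R. length (iterate \<phi> (Suc t) w) = \<theta> * length (iterate \<phi> t w)"
  shows "left_eigenvector M (length_vector \<phi> (largest_jordan_block M 0) R)"
proof -
  define d where "d i = length_vector \<phi> (Suc i) R - of_real \<theta> \<cdot>\<^sub>v length_vector \<phi> i R" for i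
  have dim: "length_vector \<phi> i R \<in> carrier_vec (card R)" for i by (rule length_vector_in)
  have d_in: "d i \<in> carrier_vec (card R)" for i unfolding d_def using dim by simp
  have tM: "transpose_mat M \<in> carrier_mat (card R) (card R)" using M_in by simp
  have d_step: "transpose_mat M *\<^sub>v d i = d (Suc i)" for i
    unfolding d_def using tM dim
    by (simp add: mult_minus_distrib_mat_vec[OF tM] mult_mat_vec[OF tM] length_vector_step)
  have "d t = 0\<^sub>v (card R)"
  proof (rule eq_vecI)
    fix j assume "j < dim_vec (0\<^sub>v (card R) :: complex vec)"
    then have j: "j < card R" by simp
    then have "letters R ! j \<in> R" by (rule nth_letters_in[OF finite_R])
    then have "real (length (iterate \<phi> (Suc t) (letters R ! j))) = \<theta> * length (iterate \<phi> t (letters R ! j))"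
      using theta by blast
    then have "complex_of_real (real (length (iterate \<phi> (Suc t) (letters R ! j))))
        = complex_of_real (\<theta> * length (iterate \<phi> t (letters R ! j)))" by (rule arg_cong)
    then show "d t $ j = 0\<^sub>v (card R) $ j"
      using j dim[of t] dim[of "Suc t"] unfolding d_def by (simp add: length_vector_nth del: funpow.simps)
  qed (use d_in in simp)
  then have zero: "d (largest_jordan_block M 0) = 0\<^sub>v (card R)"
    using largest_jordan_block_stable[OF M_in, of d t] d_in d_step by blast
  have "length_vector \<phi> (Suc (largest_jordan_block M 0)) R
      = of_real \<theta> \<cdot>\<^sub>v length_vector \<phi> (largest_jordan_block M 0) R"
    by (rule vec_eq_if_minus_zero[OF dim smult_carrier_vec[THEN iffD2, OF dim] zero[unfolded d_def]])
  then show ?thesis unfolding left_eigenvector_iff by blast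
qed

end

section \<open>Automatic factors force proportional lengths\<close>

context primitive_sequence
begin

text \<open>Minimality of the system in terms of words: a window of \<open>x'\<close> of length
  \<open>N + length v\<close> occurs in \<open>x\<close>, and every window of that length in
  \<open>x\<close> contains \<open>v\<close>.\<close>

lemma subword_recurrent:
  fixes x' :: "nat \<Rightarrow> 'a"
  assumes lang: "\<And>i n. map (\<lambda>j. x' (i + j)) [0..<n] \<in> language x" and v: "v \<in> language x"
  shows "\<exists>N. \<forall>j. \<exists>j'\<in>{j..j+N}. occurs x' j' v"
proof -
  obtain N where N: "\<And>j. \<exists>j'\<in>{j..j+N}. occurs x j' v" using occurs_recurrent[OF v] by blast
  have "\<exists>j'\<in>{j..j+N}. occurs x' j' v" for j
  proof -
    let ?u = "map (\<lambda>t. x' (j + t)) [0..<N + length v]"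
    obtain i where i: "occurs x i ?u" using lang[of j "N + length v"] language_iff by blast
    obtain j1 where j1: "j1 \<in> {i..i+N}" "occurs x j1 v" using N by blast
    define d where "d = j1 - i"
    have d: "j1 = i + d" "d \<le> N" using j1(1) by (auto simp: d_def)
    have "v ! t = x' (j + d + t)" if "t < length v" for t
    proof -
      have "?u ! (d + t) = x (i + (d + t))" using i that d(2) by (simp add: occurs_def)
      moreover have "v ! t = x (j1 + t)" using j1(2) that by (simp add: occurs_def)
      ultimately show ?thesis using that d by (simp add: add.assoc)
    qed
    then have "occurs x' (j + d) v" by (simp add: occurs_def)
    then show ?thesis using d(2) by (intro bexI[of _ "j + d"]) auto
  qed
  then show ?thesis by blast
qed

text \<open>Here \<open>x'\<close> is a one-sided reading of a point of the system, \<open>y\<close>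
  its image under a block code of window \<open>r + 1\<close>, and \<open>z\<close> the sequence of
  states behind \<open>y\<close>.\<close>

lemma eigenvector_if_automatic_factor:
  fixes x' :: "nat \<Rightarrow> 'a" and y :: "nat \<Rightarrow> 'b" and z :: "nat \<Rightarrow> 'c"
  assumes lang: "\<And>i n. map (\<lambda>j. x' (i + j)) [0..<n] \<in> language x"
    and code: "\<And>i j. (\<And>t. t \<le> r \<Longrightarrow> x' (i + t) = x' (j + t)) \<Longrightarrow> y i = y j"
    and k: "k \<ge> 2" and C: "finite C" "range z \<subseteq> C"
    and z: "\<And>n j. j < k \<Longrightarrow> z (k * n + j) = \<psi> (z n) ! j" and y: "\<And>n. y n = \<rho> (z n)"
    and np: "\<not> eventually_periodic y"
  shows "left_eigenvector M (length_vector \<phi> (largest_jordan_block M 0) R)"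
proof -
  have agree_y: "agree y i j L" if "agree x' i j (L + r)" for i j L
    unfolding agree_def
  proof (intro allI impI code)
    fix t s assume "t < L" "s \<le> r"
    then have "t + s < L + r" by simp
    with that show "x' (i + t + s) = x' (j + t + s)" unfolding agree_def by (metis add.assoc)
  qed
  have rec: "uniformly_recurrent y"
    unfolding uniformly_recurrent_def
  proof (intro allI)
    fix i L
    let ?v = "map (\<lambda>j. x' (i + j)) [0..<L + r]"
    obtain N where N: "\<And>j. \<exists>j'\<in>{j..j+N}. occurs x' j' ?v" using subword_recurrent[OF lang lang] by blast
    have "\<exists>j'\<in>{j..j+N}. agree y i j' L" for j
    proof -
      obtain j' where j': "j' \<in> {j..j+N}" "occurs x' j' ?v" using N by blast
      then have "agree x' i j' (L + r)" by (simp add: occurs_def agree_def)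
      then show ?thesis using agree_y j'(1) by blast
    qed
    then show "\<exists>N. \<forall>j. \<exists>j'\<in>{j..j+N}. agree y i j' L" by blast
  qed
  have "range y \<subseteq> \<rho> ` C" using C(2) y by auto
  then have fin: "finite (range y)" using C(1) finite_subset by blast
  have blocks: "y (k ^ m * n + i) = \<rho> (constant_length_state k \<psi> m (z n) i)" if "i < k ^ m" for m n i
    using constant_length_state_correct[of k z \<psi> i m n] z k that y by simp
  obtain c0 where c0: "\<And>m i d. agree y i (i + d) (c0 * k ^ m) \<Longrightarrow> k ^ m div gcd d (k ^ m) \<le> card C"
    using long_repetition_distance[OF fin rec np k C, where g = "\<lambda>m c i. \<rho> (constant_length_state k \<psi> m c i)"] blocks
    by blast
  \<comment> \<open>Makes the constant positive, as \<open>power_bracket\<close> requires.\<close>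
  define c where "c = Suc c0"
  \<comment> \<open>Each quotient \<open>k ^ m div gcd d (k ^ m)\<close> is at most
    \<open>card C\<close> and so divides this factorial. One factor \<open>F\<close> thus turns all
    the gcd bounds into \<open>k ^ m dvd F * d\<close>.\<close>
  define F where "F = (fact (card C) :: nat)"
  have F: "F > 0" by (simp add: F_def)
  have divides: "k ^ m dvd F * d" if "agree y i (i + d) (c * k ^ m)" for m i d
  proof -
    let ?g = "gcd d (k ^ m)"
    have "agree y i (i + d) (c0 * k ^ m)" using that by (rule agree_mono) (simp add: c_def)
    then have le: "k ^ m div ?g \<le> card C" by (rule c0)
    have pos: "k ^ m > 0" using k by simp
    then have "1 \<le> k ^ m div ?g" by (metis One_nat_def Suc_leI div_greater_zero_iff gcd_le2_nat gcd_pos_nat not_gr_zero)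
    then have "k ^ m div ?g dvd F" unfolding F_def using le by (rule dvd_fact)
    then have "?g * (k ^ m div ?g) dvd d * F" by (intro mult_dvd_mono) auto
    then show ?thesis by (simp add: mult.commute)
  qed
  define l where "l n = length (iterate \<phi> n [a])" for n
  define L where "L n w = length (iterate \<phi> n w)" for n w
  have return: "\<exists>i. agree x' i (i + L n w) (l n)" if w: "w \<in> R" for n w
  proof -
    obtain w' where w': "w = a # w'" using w unfolding return_words_iff marked_iff by blast
    have "iterate \<phi> n (w @ [a]) \<in> language x" using w unfolding return_words_iff by (intro language_iterate) blast
    then obtain i where "occurs x' i (iterate \<phi> n (w @ [a]))" using subword_recurrent[OF lang] by blast
    then have i: "occurs x' i (iterate \<phi> n w)" "occurs x' (i + L n w) (iterate \<phi> n [a])"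
      by (simp_all add: occurs_append L_def)
    have "iterate \<phi> n w = iterate \<phi> n [a] @ iterate \<phi> n w'" unfolding w' by (rule iterate_Cons)
    with i(1) have "occurs x' i (iterate \<phi> n [a])" by (simp add: occurs_append)
    with i(2) show ?thesis unfolding l_def by (intro exI[of _ i]) (simp add: occurs_def agree_def)
  qed
  \<comment> \<open>With \<open>2 * r + c \<le> l n\<close>, the length \<open>l n - r\<close> that
    survives the block code is at least \<open>c\<close> and at least half of
    \<open>l n\<close>.\<close>
  obtain n1 where n1: "\<And>n. n \<ge> n1 \<Longrightarrow> 2 * r + c \<le> l n"
    using length_iterate_unbounded[OF A two, of "2 * r + c"] x_in unfolding l_def by blast
  have "\<exists>m. c * k ^ m \<le> l n - r \<and> l n - r < c * k ^ Suc m" if "n \<ge> n1" for n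
    by (rule power_bracket[OF k]) (use n1[OF that] in \<open>auto simp: c_def\<close>)
  then obtain m where m: "\<And>n. n \<ge> n1 \<Longrightarrow> c * k ^ m n \<le> l n - r"
    "\<And>n. n \<ge> n1 \<Longrightarrow> l n - r < c * k ^ Suc (m n)" by metis
  have dvd_L: "k ^ m n dvd F * L n w" if n: "n \<ge> n1" and w: "w \<in> R" for n w
  proof -
    obtain i where i: "agree x' i (i + L n w) (l n)" using return[OF w] by blast
    have "agree x' i (i + L n w) ((l n - r) + r)" using i n1[OF n] by simp
    then have "agree y i (i + L n w) (l n - r)" by (rule agree_y)
    then have "agree y i (i + L n w) (c * k ^ m n)" by (rule agree_mono) (rule m(1)[OF n])
    then show ?thesis by (rule divides)
  qed
  obtain B where B: "\<And>n w. w \<in> R \<Longrightarrow> L n w \<le> B * l n"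
    using length_iterate_comparable unfolding L_def l_def by blast
  define H where "H = F * (B * (2 * (c * k)))"
  have bound: "F * L n w \<le> H * k ^ m n" if n: "n \<ge> n1" and w: "w \<in> R" for n w
  proof -
    have "l n \<le> 2 * (l n - r)" using n1[OF n] by linarith
    also have "\<dots> \<le> 2 * (c * k ^ Suc (m n))" using m(2)[OF n] by linarith
    finally have "B * l n \<le> B * (2 * (c * k ^ Suc (m n)))" by (rule mult_le_mono2)
    with B[OF w, of n] have "F * L n w \<le> F * (B * (2 * (c * k ^ Suc (m n))))"
      by (meson le_trans mult_le_mono2)
    then show ?thesis by (simp add: H_def ac_simps)
  qed
  \<comment> \<open>Up to the scalar \<open>k ^ m n / F\<close>, the vector of lengths at
    \<open>n\<close> is the integer vector \<open>q n\<close> with entries at most \<open>H\<close>.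
    By pigeonhole two exponents share it.\<close>
  define q where "q n w = F * L n w div k ^ m n" for n w
  have q: "F * L n w = q n w * k ^ m n" "q n w \<le> H" if "n \<ge> n1" "w \<in> R" for n w
  proof -
    show "F * L n w = q n w * k ^ m n" using dvd_L[OF that] by (simp add: q_def)
    then have "q n w * k ^ m n \<le> H * k ^ m n" using bound[OF that] by simp
    then show "q n w \<le> H" using k by simp
  qed
  have "(\<lambda>n. restrict (q n) R) ` {n1..} \<subseteq> R \<rightarrow>\<^sub>E {..H}" using q(2) by auto
  moreover have "finite (R \<rightarrow>\<^sub>E {..H})" using finite_R by (intro finite_PiE) auto
  ultimately have "finite ((\<lambda>n. restrict (q n) R) ` {n1..})" by (rule finite_subset)
  then have "\<not> inj_on (\<lambda>n. restrict (q n) R) {n1..}"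
    using finite_imageD infinite_Ici by blast
  then obtain n n' where nn': "n \<ge> n1" "n' \<ge> n1" "n < n'" "restrict (q n) R = restrict (q n') R"
    unfolding inj_on_def by (metis atLeast_iff linorder_neqE_nat)
  have l_mono: "l n \<le> l n'" unfolding l_def using nn'(3) x_in by (intro length_iterate_mono[OF A]) auto
  \<comment> \<open>Needed for the ratio of the two length vectors to be a natural number.\<close>
  have mm: "m n \<le> m n'"
  proof (rule ccontr)
    assume "\<not> ?thesis"
    then have "c * k ^ Suc (m n') \<le> c * k ^ m n" using k by (intro mult_le_mono2 power_increasing) auto
    then show False using m(1)[OF nn'(1)] m(2)[OF nn'(2)] l_mono by linarith
  qed
  have "length (iterate \<phi> (n + (n' - n)) w) = k ^ (m n' - m n) * length (iterate \<phi> n w)" if w: "w \<in> R" for w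
  proof -
    have "q n w = q n' w" using nn'(4) w by (metis restrict_apply')
    then have "F * L n' w = q n w * k ^ m n * k ^ (m n' - m n)"
      using q(1)[OF nn'(2) w] mm by (simp add: mult.assoc flip: power_add)
    also have "\<dots> = F * (k ^ (m n' - m n) * L n w)" unfolding q(1)[OF nn'(1) w, symmetric] by simp
    finally have "L n' w = k ^ (m n' - m n) * L n w" using F by simp
    then show ?thesis using nn'(3) by (simp add: L_def)
  qed
  then obtain \<theta> :: real where "\<forall>w\<in>R. length (iterate \<phi> (Suc n) w) = \<theta> * length (iterate \<phi> n w)"
    using proportional_lengths[of "n' - n" n "k ^ (m n' - m n)"] nn'(3) by auto
  then show ?thesis by (rule eigenvector_if_proportional)
qed

text \<open>Every window of \<open>u\<close> recurs beyond the preperiod, so the eventual period can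
  be carried back to every index, negative ones included.\<close>

lemma periodic_if_eventually_periodic:
  fixes u :: "'i::comm_semiring_1 \<Rightarrow> 'a" and y :: "'i \<Rightarrow> 'b"
  assumes lang: "\<And>e n. map (\<lambda>j. u (e + of_nat j)) [0..<n] \<in> language x"
    and code: "\<And>e e'. (\<And>t. t \<le> r \<Longrightarrow> u (i0 + e + of_nat t) = u (i0 + e' + of_nat t)) \<Longrightarrow> y e = y e'"
    and per: "eventually_periodic (\<lambda>n. y (of_nat n))"
  shows "periodic y"
proof -
  obtain h M where h: "h > 0" "\<And>n. n \<ge> M \<Longrightarrow> y (of_nat (n + h)) = y (of_nat n)"
    using per unfolding eventually_periodic_def by blast
  define x' where "x' n = u (i0 + of_nat n)" for n
  have lang': "map (\<lambda>j. x' (i + j)) [0..<n] \<in> language x" for i n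
    using lang[of "i0 + of_nat i" n] by (simp add: x'_def add.assoc)
  have "y (e + of_nat h) = y e" for e
  proof -
    \<comment> \<open>This length covers the coding windows of both \<open>e\<close> and
      \<open>e + h\<close>.\<close>
    let ?v = "map (\<lambda>j. u (i0 + e + of_nat j)) [0..<Suc (h + r)]"
    obtain j where j: "j \<ge> M" "occurs x' j ?v"
      using subword_recurrent[OF lang' lang] by (meson atLeastAtMost_iff)
    have eq: "u (i0 + e + of_nat t) = u (i0 + of_nat j + of_nat t)" if "t \<le> h + r" for t
    proof -
      have "?v ! t = x' (j + t)" using j(2) that by (simp add: occurs_def del: upt_Suc)
      then show ?thesis using that by (simp add: x'_def add.assoc del: upt_Suc)
    qed
    have "y (e + of_nat h) = y (of_nat (j + h))"
    proof (rule code)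
      fix t assume "t \<le> r"
      then have "h + t \<le> h + r" by simp
      from eq[OF this] show "u (i0 + (e + of_nat h) + of_nat t) = u (i0 + of_nat (j + h) + of_nat t)"
        by (simp add: add.assoc)
    qed
    also have "\<dots> = y (of_nat j)" by (rule h(2)[OF j(1)])
    also have "\<dots> = y e" by (rule code, rule eq[symmetric]) simp
    finally show ?thesis .
  qed
  with h(1) show ?thesis unfolding periodic_def by blast
qed

end


section \<open>Automaticity from an eigenvector\<close>

lemma split_at_weight:
  fixes l :: "'b \<Rightarrow> nat"
  assumes "n < sum_list (map l vs)"
  shows "\<exists>vs1 v vs2 i. vs = vs1 @ v # vs2 \<and> n = sum_list (map l vs1) + i \<and> i < l v"
  using assms
proof (induction vs arbitrary: n)
  case (Cons v vs)
  show ?case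
  proof (cases "n < l v")
    case True
    then show ?thesis by (intro exI[of _ "[]"] exI[of _ v] exI[of _ vs] exI[of _ n]) simp
  next
    case False
    then have "n - l v < sum_list (map l vs)" using Cons.prems by simp
    then obtain vs1 v' vs2 i where s: "vs = vs1 @ v' # vs2" "n - l v = sum_list (map l vs1) + i" "i < l v'"
      using Cons.IH by blast
    have "n = sum_list (map l (v # vs1)) + i" using s(2) False by simp
    then show ?thesis using s(1,3)
      by (intro exI[of _ "v # vs1"] exI[of _ v'] exI[of _ vs2] exI[of _ i]) simp
  qed
qed simp

text \<open>All numbers \<open>(a / b) ^ m * b\<close> are integers, so every power of the reduced
  denominator \<open>b1\<close> divides \<open>b\<close>. Since \<open>2 ^ b > b\<close>, the
  exponent \<open>m = b\<close> already forces \<open>b1 = 1\<close>.\<close>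

lemma dvd_if_powers_dvd:
  fixes L :: "nat \<Rightarrow> nat"
  assumes "b > 0" "\<And>m. L m * b ^ m = a ^ m * b"
  shows "b dvd a"
proof -
  define g where "g = gcd a b"
  define a1 b1 where "a1 = a div g" and "b1 = b div g"
  have g: "g > 0" using assms(1) by (simp add: g_def)
  have ab: "a = g * a1" "b = g * b1" by (simp_all add: a1_def b1_def g_def)
  have cop: "coprime a1 b1" unfolding a1_def b1_def g_def using assms(1) by (intro div_gcd_coprime) simp
  have b1_pos: "b1 > 0" using ab(2) assms(1) by (cases b1) auto
  have "b1 ^ m dvd b" for m
  proof -
    have "g ^ m * (L m * b1 ^ m) = g ^ m * (a1 ^ m * b)"
      using assms(2)[of m] unfolding ab(1) by (subst (asm) ab(2)) (simp add: power_mult_distrib ac_simps)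
    then have "L m * b1 ^ m = a1 ^ m * b" using g by simp
    then have "b1 ^ m dvd a1 ^ m * b" by (metis dvd_triv_right)
    moreover have "coprime (b1 ^ m) (a1 ^ m)" using cop by (simp add: coprime_commute)
    ultimately show ?thesis by (simp add: coprime_dvd_mult_right_iff)
  qed
  then have le: "b1 ^ b \<le> b" using assms(1) by (simp add: dvd_imp_le)
  have "b1 = 1"
  proof (rule ccontr)
    assume "b1 \<noteq> 1"
    then have "2 \<le> b1" using b1_pos by simp
    then have "2 ^ b \<le> b1 ^ b" by (rule power_mono) simp
    with le have "2 ^ b \<le> b" by simp
    moreover have "b < 2 ^ b" by simp
    ultimately show False by simp
  qed
  then show ?thesis using ab by simp
qed

lemma automaticI:
  fixes x :: "'i::comm_semiring_1 \<Rightarrow> 'b" and z :: "'i \<Rightarrow> nat"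
  assumes k: "k \<ge> 2" and C: "finite C" "range z \<subseteq> C"
    and \<psi>: "\<And>c. c \<in> C \<Longrightarrow> length (\<psi> c) = k \<and> set (\<psi> c) \<subseteq> C"
    and z: "\<And>n j. j < k \<Longrightarrow> z (of_nat k * n + of_nat j) = \<psi> (z n) ! j"
    and x: "\<And>n. x n = \<rho> (z n)"
    and cover: "\<And>m::'i. \<exists>i. \<exists>j<k. m = of_nat k * i + of_nat j"
  shows "automatic x"
proof -
  have len: "length (\<psi> (z i)) = k" for i using \<psi> C(2) by blast
  have "is_image_seq \<psi> z z"
    unfolding is_image_seq_def len
    by (intro exI[of _ "\<lambda>i. of_nat k * i"]) (use z cover in \<open>auto simp: distrib_left\<close>)
  then have "fixed_point C \<psi> z" using C(2) by (simp add: fixed_point_def seqs_def)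
  moreover have "substitution C \<psi>" using C(1) \<psi> by (simp add: substitution_def)
  moreover have "constant_length C \<psi> k" using \<psi> by (simp add: constant_length_def)
  moreover have "x = \<rho> \<circ> z" using x by auto
  ultimately show ?thesis unfolding automatic_def k_automatic_def using k by blast
qed

context primitive_sequence
begin

text \<open>The eigenvalue is the quotient \<open>b' / b\<close> of two lengths, and
  \<open>b\<close> times any power of it is again the length of an iterate of \<open>w0\<close>; a
  rational number with this property is an integer.\<close>

lemma integral_eigenvalue:
  assumes ev: "length_vector \<phi> (Suc s) R = ev \<cdot>\<^sub>v length_vector \<phi> s R"
  shows "\<exists>k\<ge>2. \<forall>w\<in>R. length (iterate \<phi> (Suc s) w) = k * length (iterate \<phi> s w)"
proof -
  obtain w0 where w0: "w0 \<in> R" using R_nonempty by blast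
  define b b' where "b = length (iterate \<phi> s w0)" and "b' = length (iterate \<phi> (Suc s) w0)"
  have b: "b > 0" using R_in_pos[OF w0, of s] unfolding b_def by linarith
  have ev_w: "(of_nat (length (iterate \<phi> (Suc s) w)) :: complex) = ev * of_nat (length (iterate \<phi> s w))"
    if "w \<in> R" for w
  proof -
    obtain j where j: "j < card R" "letters R ! j = w" using nth_letters_surj[OF finite_R \<open>w \<in> R\<close>] by blast
    have "length_vector \<phi> (Suc s) R $ j = (ev \<cdot>\<^sub>v length_vector \<phi> s R) $ j" using ev by simp
    also have "\<dots> = ev * length_vector \<phi> s R $ j"
      using j(1) length_vector_in[of s] by (intro index_smult_vec) simp
    finally show ?thesis unfolding length_vector_nth[OF j(1)] j(2) .
  qed
  have proportion: "length (iterate \<phi> (Suc s) w) * b = b' * length (iterate \<phi> s w)" if "w \<in> R" for w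
  proof -
    have "(of_nat (length (iterate \<phi> (Suc s) w) * b) :: complex) = of_nat (b' * length (iterate \<phi> s w))"
      unfolding of_nat_mult ev_w[OF that] b'_def ev_w[OF w0] b_def by (simp add: ac_simps)
    then show ?thesis by (simp only: of_nat_eq_iff)
  qed
  have proportion_concat: "length (iterate \<phi> (Suc s) (concat vs)) * b = b' * length (iterate \<phi> s (concat vs))"
    if "set vs \<subseteq> R" for vs
    using that
  proof (induction vs)
    case (Cons v vs)
    have "length (iterate \<phi> (Suc s) (concat (v # vs))) * b
        = length (iterate \<phi> (Suc s) v) * b + length (iterate \<phi> (Suc s) (concat vs)) * b"
      by (simp only: concat.simps iterate_append length_append distrib_right)
    also have "\<dots> = b' * length (iterate \<phi> s v) + b' * length (iterate \<phi> s (concat vs))"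
      using proportion Cons by simp
    finally show ?case by (simp only: concat.simps iterate_append length_append distrib_left)
  qed simp
  define L where "L m = length (iterate \<phi> (s + m) w0)" for m
  have L: "L (Suc m) * b = b' * L m" for m
  proof -
    obtain vs where vs: "vs \<in> lists R" "concat vs = iterate \<phi> m w0"
      using iterate_factorization[OF w0, of m] by (elim bexE)
    have "set vs \<subseteq> R" using vs(1) by auto
    from proportion_concat[OF this] show ?thesis unfolding vs(2) iterate_iterate L_def by simp
  qed
  have L_pow: "L m * b ^ m = b' ^ m * b" for m
  proof (induction m)
    case 0
    then show ?case by (simp add: L_def b_def)
  next
    case (Suc m)
    have "L (Suc m) * b ^ Suc m = (L (Suc m) * b) * b ^ m" by simp
    also have "\<dots> = b' * (L m * b ^ m)" unfolding L by simp
    finally show ?case unfolding Suc by simp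
  qed
  have "b dvd b'" using dvd_if_powers_dvd[OF b L_pow] .
  then obtain k where k: "b' = b * k" by blast
  have scale: "length (iterate \<phi> (Suc s) w) = k * length (iterate \<phi> s w)" if "w \<in> R" for w
    using proportion[OF that] b unfolding k by simp
  have Lk: "L m = k ^ m * b" for m
  proof -
    have "L m * b ^ m = (k ^ m * b) * b ^ m" unfolding L_pow k power_mult_distrib by (simp add: ac_simps)
    then show ?thesis using b by simp
  qed
  \<comment> \<open>A factor of at most 1 would keep the lengths of the iterates of
    \<open>w0\<close> bounded.\<close>
  have "k \<ge> 2"
  proof (rule ccontr)
    assume "\<not> k \<ge> 2"
    then have "k \<le> 1" by simp
    then have small: "L m \<le> b" for m unfolding Lk using power_le_one[of k m] by simp
    obtain n1 where n1: "\<And>n b'. n \<ge> n1 \<Longrightarrow> b' \<in> A \<Longrightarrow> Suc b \<le> length (iterate \<phi> n [b'])"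
      using length_iterate_unbounded[OF A two, of "Suc b"] by blast
    obtain u where u: "w0 = a # u" using w0 unfolding return_words_iff marked_iff by blast
    have "Suc b \<le> length (iterate \<phi> (s + n1) [a])" by (rule n1[OF _ x_in]) simp
    also have "\<dots> \<le> L n1" unfolding L_def u iterate_Cons[of _ \<phi> a u] by simp
    finally show False using small[of n1] by simp
  qed
  with scale show ?thesis by blast
qed

lemma marked_gap:
  fixes X :: "int \<Rightarrow> 'a"
  assumes "marked a w" "occurs X q w" "0 < t" "t < length w"
  shows "X (q + int t) \<noteq> a"
proof -
  obtain u where u: "w = a # u" "a \<notin> set u" using assms(1) unfolding marked_iff by blast
  have "X (q + int t) = w ! t" using assms(2,4) by (simp add: occurs_def)
  also have "\<dots> = u ! (t - 1)" using u(1) assms(3) by (cases t) auto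
  also have "\<dots> \<in> set u" using assms(3,4) u(1) by (intro nth_mem) auto
  finally show ?thesis using u(2) by auto
qed

text \<open>Position \<open>N\<close> lies at offset \<open>i\<close> of the block \<open>\<phi>^s(w)\<close>, where \<open>w\<close> is the return word that starts
  at \<open>q\<close>. When \<open>|\<phi>^(s+1)(w)| = k |\<phi>^s(w)|\<close> for all return words, the state \<open>(w, i)\<close> of \<open>N\<close> determines
  the states of \<open>k N, \<dots>, k N + k - 1\<close>. The index set \<open>D\<close> allows one-sided sequences to be treated
  along with two-sided ones.\<close>

lemma uniform_states:
  fixes X P :: "int \<Rightarrow> _"
  assumes E: "expansion \<phi> D X P" and D: "D = UNIV \<or> D = {0..}" and X0: "X 0 = a"
    and lang: "\<And>i w. i \<in> D \<Longrightarrow> occurs X i w \<Longrightarrow> w \<in> language x"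
    and k: "k \<ge> 2" and scale: "\<And>w. w \<in> R \<Longrightarrow> length (iterate \<phi> (Suc s) w) = k * length (iterate \<phi> s w)"
  shows "\<exists>(z :: int \<Rightarrow> nat) C \<psi> \<rho>. finite C \<and> (\<forall>n\<in>D. z n \<in> C) \<and>
    (\<forall>c\<in>C. length (\<psi> c) = k \<and> set (\<psi> c) \<subseteq> C) \<and>
    (\<forall>n\<in>D. \<forall>j<k. z (int k * n + int j) = \<psi> (z n) ! j) \<and> (\<forall>n\<in>D. X n = \<rho> (z n))"
proof -
  interpret E: expansion \<phi> D X P by (rule E)
  let ?Q = "P ^^ s"
  define l where "l w = length (iterate \<phi> s w)" for w
  \<comment> \<open>The \<open>a\<close> after \<open>w\<close> fixes where \<open>w\<close> ends,
    so two return words recorded at the same \<open>q\<close> coincide.\<close>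
  define state where "state N w i \<longleftrightarrow> (\<exists>q\<in>D. occurs X q (w @ [a]) \<and> w \<in> R \<and> i < l w \<and> N = ?Q q + int i)" for N w i
  have D_up: "i \<in> D \<Longrightarrow> i \<le> j \<Longrightarrow> j \<in> D" for i j using D by auto
  have Q_word: "?Q (i + int (length w)) = ?Q i + int (l w)" if "i \<in> D" "occurs X i w" for i w
    using E.pos_add[OF that, of s] unfolding l_def by simp
  have l_ge: "length w \<le> l w" if "i \<in> D" "occurs X i w" for i w
    using length_iterate_mono[OF A, of w 0 s] language_set[OF x_A lang[OF that]] unfolding l_def by simp
  have Q_grow: "?Q i + (j - i) \<le> ?Q j" if "i \<in> D" "i \<le> j" for i j
  proof -
    let ?w = "map (\<lambda>t. X (i + of_nat t)) [0..<nat (j - i)]"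
    have w: "occurs X i ?w" by (rule occurs_map)
    have "j = i + int (length ?w)" using that(2) by simp
    then show ?thesis using Q_word[OF that(1) w] l_ge[OF that(1) w] by simp
  qed
  have end_a: "X (q + int (length w)) = a" if "occurs X q (w @ [a])" for q w
    using that by (simp add: occurs_append occurs_Cons)
  have start_a: "X q = a" "marked a w" "occurs X q w" if "occurs X q (w @ [a])" "w \<in> R" for q w
  proof -
    show m: "marked a w" using that(2) unfolding return_words_iff by blast
    show o: "occurs X q w" using that(1) by (simp add: occurs_append)
    obtain u where "w = a # u" using m unfolding marked_iff by blast
    with o show "X q = a" by (simp add: occurs_Cons)
  qed
  \<comment> \<open>The start \<open>q\<close> recorded in a state is the last return-word start
    whose image begins at or before \<open>N\<close>. Applied both ways, this gives
    uniqueness.\<close>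
  have separated: "q' \<le> q" if "state N w i" "occurs X q (w @ [a])" "q \<in> D" "N = ?Q q + int i" "i < l w"
      "w \<in> R" "occurs X q' (w' @ [a])" "w' \<in> R" "?Q q' \<le> N" for N w i q q' w'
  proof (rule ccontr)
    assume "\<not> q' \<le> q"
    then have "q < q'" by simp
    define t where "t = nat (q' - q)"
    have t: "q' = q + int t" "0 < t" using \<open>q < q'\<close> by (auto simp: t_def)
    have "X q' = a" by (rule start_a(1)[OF that(7,8)])
    then have "length w \<le> t" using marked_gap[OF start_a(2,3)[OF that(2,6)] t(2)] t(1) by force
    then have "?Q (q + int (length w)) \<le> ?Q q'"
      using Q_grow[of "q + int (length w)" q'] t(1) that(3) D_up[OF that(3), of "q + int (length w)"] by simp
    then show False using Q_word[OF that(3) start_a(3)[OF that(2,6)]] that(4,5,9) by simp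
  qed
  have unique: "w = w' \<and> i = i'" if st: "state N w i" "state N w' i'" for N w i w' i'
  proof -
    obtain q where q: "q \<in> D" "occurs X q (w @ [a])" "w \<in> R" "i < l w" "N = ?Q q + int i"
      using st(1) unfolding state_def by blast
    obtain q' where q': "q' \<in> D" "occurs X q' (w' @ [a])" "w' \<in> R" "i' < l w'" "N = ?Q q' + int i'"
      using st(2) unfolding state_def by blast
    have "q = q'"
      using separated[OF st(1) q(2,1,5,4,3) q'(2,3)] separated[OF st(2) q'(2,1,5,4,3) q(2,3)] q(5) q'(5)
      by simp
    have "length w' \<le> length w"
      using marked_gap[OF start_a(2,3)[OF q'(2,3)], of "length w"] end_a[OF q(2)] start_a(2)[OF q(2,3)] \<open>q = q'\<close>
      unfolding marked_def by (metis length_greater_0_conv not_le)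
    moreover have "length w \<le> length w'"
      using marked_gap[OF start_a(2,3)[OF q(2,3)], of "length w'"] end_a[OF q'(2)] start_a(2)[OF q'(2,3)] \<open>q = q'\<close>
      unfolding marked_def by (metis length_greater_0_conv not_le)
    ultimately have "w = w'"
      using occurs_eq[OF start_a(3)[OF q(2,3)]] start_a(3)[OF q'(2,3)] \<open>q = q'\<close> by simp
    then show ?thesis using q(5) q'(5) \<open>q = q'\<close> by simp
  qed
  obtain N0 where N0: "\<And>i w. occurs x i w \<Longrightarrow> length w > N0 \<Longrightarrow> a \<in> set w" using return_word_length by blast
  have near_a: "\<exists>t\<le>N0. X (i + int t) = a" if "i \<in> D" for i
  proof -
    let ?w = "map (\<lambda>t. X (i + of_nat t)) [0..<Suc N0]"
    have "?w \<in> language x" using lang[OF that occurs_map] .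
    then have "a \<in> set ?w" using N0 unfolding language_iff by force
    then show ?thesis by (auto simp: less_Suc_eq_le simp del: upt_Suc)
  qed
  have exists: "\<exists>w i. state N w i" if N: "N \<in> D" for N
  proof -
    \<comment> \<open>For \<open>D = {0..}\<close> position 0 serves. Otherwise an \<open>a\<close>
      is found among the \<open>N0 + 1\<close> positions ending at \<open>min N 0\<close>, and
      \<open>?Q\<close> moves nonpositive positions only further left.\<close>
    have "\<exists>q0\<in>D. X q0 = a \<and> ?Q q0 \<le> N"
      using D
    proof
      assume "D = {0..}"
      then show ?thesis using N X0 E.pos_0[of s] E.D_0 by (intro bexI[of _ 0]) auto
    next
      assume D: "D = UNIV"
      define b where "b = min N 0 - int N0"
      obtain t where t: "t \<le> N0" "X (b + int t) = a" using near_a[of b] D by auto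
      let ?q = "b + int t"
      have q: "?q \<le> 0" "?q \<le> N" using t(1) by (auto simp: b_def)
      have "?Q ?q + (0 - ?q) \<le> ?Q 0" by (rule Q_grow) (use q D in auto)
      then have "?Q ?q \<le> N" using q E.pos_0[of s] by simp
      then show ?thesis using t(2) D by auto
    qed
    then obtain q0 where q0: "q0 \<in> D" "X q0 = a" "?Q q0 \<le> N" by blast
    \<comment> \<open>The return word belonging to \<open>N\<close> starts at the last
      \<open>a\<close> whose image does not begin beyond \<open>N\<close>; \<open>Q_grow\<close>
      makes the candidates finite in number.\<close>
    define S where "S = {q. q0 \<le> q \<and> X q = a \<and> ?Q q \<le> N}"
    have "S \<subseteq> {q0..N - ?Q q0 + q0}" using Q_grow[OF q0(1)] by (force simp: S_def)
    then have finS: "finite S" by (rule finite_subset) simp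
    have "q0 \<in> S" using q0 by (simp add: S_def)
    define q where "q = Max S"
    have q: "q \<in> S" "\<And>q'. q' \<in> S \<Longrightarrow> q' \<le> q" unfolding q_def using finS \<open>q0 \<in> S\<close> by (auto intro: Max_in)
    have qD: "q \<in> D" using q(1) D_up[OF q0(1)] by (simp add: S_def)
    define t where "t = (LEAST t. 0 < t \<and> X (q + int t) = a)"
    obtain t0 where "X (q + 1 + int t0) = a" using near_a[OF E.D_step[OF qD]] by blast
    moreover have "q + 1 + int t0 = q + int (Suc t0)" by simp
    ultimately have "0 < Suc t0 \<and> X (q + int (Suc t0)) = a" by (simp only: zero_less_Suc simp_thms)
    then have t: "0 < t" "X (q + int t) = a" unfolding t_def by (metis (mono_tags, lifting) LeastI)+
    have t_least: "X (q + int t') \<noteq> a" if "0 < t'" "t' < t" for t'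
      using not_less_Least[of t' "\<lambda>t. 0 < t \<and> X (q + int t) = a"] that unfolding t_def by blast
    define w where "w = map (\<lambda>j. X (q + of_nat j)) [0..<t]"
    have w: "occurs X q w" "length w = t" unfolding w_def by (rule occurs_map) simp
    have wa: "occurs X q (w @ [a])" using w t(2) by (simp add: occurs_append occurs_Cons)
    have "w = a # map (\<lambda>j. X (q + of_nat j)) [1..<t]"
      using q(1) t(1) unfolding w_def by (simp add: upt_conv_Cons S_def)
    moreover have "a \<notin> set (map (\<lambda>j. X (q + of_nat j)) [1..<t])"
    proof
      assume "a \<in> set (map (\<lambda>j. X (q + of_nat j)) [1..<t])"
      then obtain t' where t': "t' \<in> set [1..<t]" "a = X (q + of_nat t')" unfolding set_map by (elim imageE)
      have "X (q + int t') \<noteq> a" by (rule t_least) (use t'(1) in simp_all)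
      from this t'(2)[symmetric] show False by (rule notE)
    qed
    ultimately have "marked a w" unfolding marked_iff by (intro exI conjI)
    then have wR: "w \<in> R" using lang[OF qD wa] unfolding return_words_iff by blast
    have "q + int t \<notin> S" using q(2)[of "q + int t"] t(1) by auto
    then have "N < ?Q (q + int t)" using t(2) q(1) by (auto simp: S_def)
    then have "N < ?Q q + int (l w)" using Q_word[OF qD w(1)] w(2) by simp
    then have "state N w (nat (N - ?Q q))"
      unfolding state_def using qD wa wR q(1) by (intro bexI[of _ q]) (auto simp: S_def)
    then show ?thesis by blast
  qed
  have scale_concat: "length (iterate \<phi> (Suc s) (concat vs)) = k * l (concat vs)" if "set vs \<subseteq> R" for vs
    using that
  proof (induction vs)
    case (Cons v vs)
    then have "length (iterate \<phi> (Suc s) v) = k * l v" "length (iterate \<phi> (Suc s) (concat vs)) = k * l (concat vs)"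
      using scale by (auto simp: l_def)
    then show ?case by (simp only: concat.simps iterate_append length_append distrib_left l_def)
  qed (simp add: l_def)
  have segment: "length (iterate \<phi> (Suc s) u) = k * l u"
    if seg: "i \<in> D" "occurs X i (u @ [a])" "u = [] \<or> hd u = a" for i u
  proof -
    obtain vs where vs: "vs \<in> lists (Collect (marked a))" "concat vs = u"
      using seg(3) by (rule marked_factorizationE)
    have "vs \<in> lists R" by (rule marked_factorization_language[OF vs(1)]) (use lang[OF seg(1,2)] vs(2) in simp)
    then have "set vs \<subseteq> R" by auto
    from scale_concat[OF this] show ?thesis unfolding vs(2) .
  qed
  have hd_word: "map (\<lambda>t. X (i + of_nat t)) [0..<n] = [] \<or> hd (map (\<lambda>t. X (i + of_nat t)) [0..<n]) = a" if "X i = a" for i n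
    using that by (cases n) (simp_all add: upt_conv_Cons del: upt_Suc)
  \<comment> \<open>Position 0 and \<open>q\<close> both carry \<open>a\<close>, so the stretch
    between them is a product of return words and \<open>\<phi>^(s+1)\<close> makes it
    \<open>k\<close> times as long as \<open>\<phi>^s\<close> does. The two cases measure it to the
    right and to the left of 0.\<close>
  have Q_P: "?Q (P q) = int k * ?Q q" if q: "q \<in> D" "X q = a" for q
  proof -
    have Suc_s: "(P ^^ Suc s) q = ?Q (P q)" by (simp add: funpow_swap1)
    show ?thesis
    proof (cases "q \<ge> 0")
      case True
      let ?u = "map (\<lambda>t. X (0 + of_nat t)) [0..<nat q]"
      have u: "occurs X 0 ?u" by (rule occurs_map)
      have "occurs X 0 (?u @ [a])" using u q(2) True by (simp add: occurs_append occurs_Cons)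
      from segment[OF E.D_0 this hd_word[OF X0]] have "length (iterate \<phi> (Suc s) ?u) = k * l ?u" .
      moreover have "(P ^^ Suc s) q = int (length (iterate \<phi> (Suc s) ?u))"
        using E.pos_add[OF E.D_0 u, of "Suc s"] E.pos_0[of "Suc s"] True by simp
      moreover have "?Q q = int (l ?u)" using Q_word[OF E.D_0 u] E.pos_0[of s] True by simp
      ultimately show ?thesis using Suc_s by simp
    next
      case False
      let ?u = "map (\<lambda>t. X (q + of_nat t)) [0..<nat (- q)]"
      have u: "occurs X q ?u" by (rule occurs_map)
      have zero: "q + int (length ?u) = 0" using False by simp
      have "occurs X q (?u @ [a])" using u zero X0 unfolding occurs_append occurs_Cons by simp
      from segment[OF q(1) this hd_word[OF q(2)]] have "length (iterate \<phi> (Suc s) ?u) = k * l ?u" .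
      moreover have "0 = (P ^^ Suc s) q + int (length (iterate \<phi> (Suc s) ?u))"
        using E.pos_add[OF q(1) u, of "Suc s"] E.pos_0[of "Suc s"] zero by (simp only: of_nat_id)
      moreover have "0 = ?Q q + int (l ?u)" using Q_word[OF q(1) u] E.pos_0[of s] zero by simp
      ultimately have "(P ^^ Suc s) q = - int (k * l ?u)" "?Q q = - int (l ?u)" by linarith+
      then show ?thesis using Suc_s by simp
    qed
  qed
  \<comment> \<open>Locates offset \<open>k * i + j\<close> of \<open>\<phi>^s(\<phi>(w))\<close> in
    the block of a factor \<open>w'\<close> of \<open>\<phi>(w)\<close>. As no position
    \<open>N\<close> is involved, this is a transition rule between states.\<close>
  define succ where "succ w i j w' i' \<longleftrightarrow> (\<exists>vs1 vs2. vs1 @ w' # vs2 \<in> lists R \<and>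
      concat (vs1 @ w' # vs2) = subst_word \<phi> w \<and> k * i + j = l (concat vs1) + i' \<and> i' < l w')" for w i j w' i'
  have l_concat: "l (concat vs) = sum_list (map l vs)" for vs
    unfolding l_def by (rule length_iterate_concat)
  have succ_ex: "\<exists>w' i'. succ w i j w' i'" if w: "w \<in> R" and i: "i < l w" and j: "j < k" for w i j
  proof -
    obtain vs where vs: "vs \<in> lists R" "concat vs = subst_word \<phi> w"
      using return_subst_word[OF w] by blast
    have "k * i + j < k * Suc i" using j by simp
    also have "\<dots> \<le> k * l w" using i by (intro mult_le_mono2) simp
    also have "\<dots> = l (concat vs)" unfolding vs(2) l_def by (simp only: scale[OF w, symmetric] iterate_Suc_right)
    finally obtain vs1 w' vs2 i' where "vs = vs1 @ w' # vs2" "k * i + j = sum_list (map l vs1) + i'" "i' < l w'"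
      unfolding l_concat using split_at_weight by blast
    then show ?thesis unfolding succ_def l_concat using vs
      by (intro exI[of _ w'] exI[of _ i'] exI[of _ vs1] exI[of _ vs2]) simp
  qed
  have succ_state: "state (int k * N + int j) w' i'" if st: "state N w i" and su: "succ w i j w' i'" for N w i j w' i'
  proof -
    obtain q where q: "q \<in> D" "occurs X q (w @ [a])" "w \<in> R" "i < l w" "N = ?Q q + int i"
      using st unfolding state_def by blast
    obtain vs1 vs2 where vs: "vs1 @ w' # vs2 \<in> lists R" "concat (vs1 @ w' # vs2) = subst_word \<phi> w"
      "k * i + j = l (concat vs1) + i'" "i' < l w'" using su unfolding succ_def by blast
    obtain u where u: "subst_word \<phi> [a] = a # u" using hd_iterate[of 1] by auto
    have "occurs X (P q) (subst_word \<phi> (w @ [a]))" using E.p_word[OF q(1,2)] by blast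
    then have "occurs X (P q) (concat (vs1 @ w' # vs2) @ [a])"
      unfolding subst_word_append u vs(2)[symmetric] by (simp only: occurs_append occurs_Cons occurs_Nil simp_thms)
    then have occ1: "occurs X (P q) (concat vs1)"
      and occ2: "occurs X (P q + int (length (concat vs1))) (w' @ concat vs2 @ [a])"
      by (simp_all only: concat_append concat.simps append_assoc occurs_append)
    let ?q = "P q + int (length (concat vs1))"
    have "vs2 \<in> lists (Collect (marked a))" using vs(1) return_words_lists[of "vs1 @ w' # vs2" x a] by simp
    then obtain t where t: "concat vs2 @ [a] = a # t"
      using concat_marked[of vs2 a] by (cases "concat vs2") auto
    have "occurs X ?q (w' @ [a])"
      using occ2 unfolding t by (simp only: occurs_append occurs_Cons occurs_Nil simp_thms)
    moreover have "?q \<in> D" using E.D_add[OF E.D_p[OF q(1)], of "length (concat vs1)"] by simp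
    moreover have "w' \<in> R" using vs(1) by simp
    moreover have "?Q ?q = int k * ?Q q + int (l (concat vs1))"
      using Q_word[OF E.D_p[OF q(1)] occ1] Q_P[OF q(1) start_a(1)[OF q(2,3)]] by simp
    moreover have "int k * N + int j = int k * ?Q q + int (k * i + j)" unfolding q(5) by (simp add: distrib_left)
    ultimately show ?thesis unfolding state_def using vs(4)
      by (intro bexI[of _ ?q] conjI) (simp_all only: vs(3) of_nat_add add.assoc)
  qed
  define S where "S = {(w, i). w \<in> R \<and> i < l w}"
  have "S = Sigma R (\<lambda>w. {..<l w})" by (auto simp: S_def)
  then have finS: "finite S" using finite_R by simp
  \<comment> \<open>Automatic sequences are defined with natural numbers as states, so the pairs are
    encoded.\<close>
  obtain e :: "'a list \<times> nat \<Rightarrow> nat" where e: "inj_on e S"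
    using finite_imp_inj_to_nat_seg[OF finS] by blast
  define st where "st N = (SOME wi. state N (fst wi) (snd wi))" for N
  have st: "state N (fst (st N)) (snd (st N))" if "N \<in> D" for N
    unfolding st_def using exists[OF that] by (intro someI_ex[of "\<lambda>wi. state N (fst wi) (snd wi)"]) auto
  have st_S: "st N \<in> S" if "N \<in> D" for N
    using st[OF that] unfolding S_def state_def by (cases "st N") auto
  define nx where "nx wi j = (SOME wi'. succ (fst wi) (snd wi) j (fst wi') (snd wi'))" for wi j
  have nx: "succ (fst wi) (snd wi) j (fst (nx wi j)) (snd (nx wi j))" if "wi \<in> S" "j < k" for wi j
    unfolding nx_def using succ_ex[of "fst wi" "snd wi" j] that
    by (intro someI_ex[of "\<lambda>wi'. succ (fst wi) (snd wi) j (fst wi') (snd wi')"]) (auto simp: S_def)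
  have nx_S: "nx wi j \<in> S" if "wi \<in> S" "j < k" for wi j
    using nx[OF that] unfolding succ_def S_def by (cases "nx wi j") auto
  have D_mult: "int k * N + int j \<in> D" if "N \<in> D" for N j
    using that D by auto
  have st_step: "st (int k * N + int j) = nx (st N) j" if "N \<in> D" "j < k" for N j
    using unique[OF st[OF D_mult[OF that(1)]] succ_state[OF st[OF that(1)] nx[OF st_S[OF that(1)] that(2)]]]
    by (simp add: prod_eq_iff)
  define dec where "dec = inv_into S e"
  have dec: "dec (e wi) = wi" if "wi \<in> S" for wi unfolding dec_def using e that by (rule inv_into_f_f)
  define z where "z N = e (st N)" for N
  define \<psi> where "\<psi> c = map (\<lambda>j. e (nx (dec c) j)) [0..<k]" for c
  define \<rho> where "\<rho> c = iterate \<phi> s (fst (dec c)) ! snd (dec c)" for c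
  have X_state: "X N = iterate \<phi> s w ! i" if state: "state N w i" for N w i
  proof -
    obtain q where q: "q \<in> D" "occurs X q (w @ [a])" "w \<in> R" "i < l w" "N = ?Q q + int i"
      using state unfolding state_def by blast
    have "occurs X (?Q q) (iterate \<phi> s w)" using E.occurs_pos[OF q(1) start_a(3)[OF q(2,3)]] .
    then show ?thesis using q(4,5) by (simp add: occurs_def l_def)
  qed
  show ?thesis
  proof (intro exI[of _ z] exI[of _ "e ` S"] exI[of _ \<psi>] exI[of _ \<rho>] conjI ballI allI impI)
    show "finite (e ` S)" using finS by simp
    show "z n \<in> e ` S" if "n \<in> D" for n using st_S[OF that] by (simp add: z_def)
    show "length (\<psi> c) = k" for c by (simp add: \<psi>_def)
    show "set (\<psi> c) \<subseteq> e ` S" if "c \<in> e ` S" for c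
      using that nx_S dec by (auto simp: \<psi>_def)
    show "z (int k * n + int j) = \<psi> (z n) ! j" if "n \<in> D" "j < k" for n j
      using st_step[OF that] dec[OF st_S[OF that(1)]] that(2) by (simp add: z_def \<psi>_def)
    show "X n = \<rho> (z n)" if "n \<in> D" for n
      using X_state[OF st[OF that]] dec[OF st_S[OF that]] by (simp add: z_def \<rho>_def)
  qed
qed

end


section \<open>Orbit closures and factors\<close>

lemma topspace_full_shift: "topspace (full_shift A) = seqs A"
  unfolding full_shift_def seqs_def by (auto simp: PiE_def Pi_def)

lemma compact_space_full_shift: "finite A \<Longrightarrow> compact_space (full_shift A)"
  unfolding full_shift_def by (simp add: compact_space_product_topology compact_space_discrete_topology)

lemma Hausdorff_space_full_shift: "Hausdorff_space (full_shift A)"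
  unfolding full_shift_def by (simp add: Hausdorff_space_product_topology)

lemma continuous_map_projection: "continuous_map (full_shift A) (discrete_topology A) (\<lambda>x. x i)"
  unfolding full_shift_def by (rule continuous_map_product_projection) simp

lemma continuous_map_into_full_shift:
  "continuous_map X (full_shift A) f \<longleftrightarrow> (\<forall>i. continuous_map X (discrete_topology A) (\<lambda>x. f x i))"
  unfolding full_shift_def by (rule continuous_map_componentwise_UNIV)

lemma continuous_map_translate: "continuous_map (full_shift A) (full_shift A) (\<lambda>x i. x (i + n))"
  unfolding continuous_map_into_full_shift by (intro allI continuous_map_projection)

lemma continuous_map_coding:
  assumes "\<rho> ` A \<subseteq> B"
  shows "continuous_map (full_shift A) (full_shift B) (\<lambda>x. \<rho> \<circ> x)"
  unfolding continuous_map_into_full_shift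
proof
  fix i
  have "continuous_map (discrete_topology A) (discrete_topology B) \<rho>" using assms by auto
  from continuous_map_compose[OF continuous_map_projection[of A i] this]
  show "continuous_map (full_shift A) (discrete_topology B) (\<lambda>x. (\<rho> \<circ> x) i)" by (simp add: o_def)
qed

lemma orbit_in: "x \<in> seqs A \<Longrightarrow> (\<lambda>i. x (i + n)) \<in> orbit_closure A x"
  unfolding orbit_closure_def
  by (rule closure_of_subset[THEN subsetD]) (auto simp: topspace_full_shift seqs_def)

lemma self_in_orbit_closure:
  fixes x :: "'i::comm_semiring_1 \<Rightarrow> 'a"
  shows "x \<in> seqs A \<Longrightarrow> x \<in> orbit_closure A x"
  using orbit_in[of x A 0] by simp

lemma orbit_closure_seqs: "orbit_closure A x \<subseteq> seqs A"
  unfolding orbit_closure_def topspace_full_shift[symmetric] by (rule closure_of_subset_topspace)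

lemma closedin_orbit_closure: "closedin (full_shift A) (orbit_closure A x)"
  unfolding orbit_closure_def by (rule closedin_closure_of)

lemma translate_orbit_closure:
  fixes x :: "'i::comm_semiring_1 \<Rightarrow> 'a"
  assumes "u \<in> orbit_closure A x"
  shows "(\<lambda>i. u (i + n)) \<in> orbit_closure A x"
proof -
  let ?T = "\<lambda>x (i::'i). x (i + n) :: 'a"
  let ?O = "range (\<lambda>m i. x (i + m))"
  have "?T ` (full_shift A closure_of ?O) \<subseteq> full_shift A closure_of (?T ` ?O)"
    by (rule continuous_map_image_closure_subset[OF continuous_map_translate])
  also have "\<dots> \<subseteq> full_shift A closure_of ?O"
  proof (rule closure_of_mono)
    have "?T (\<lambda>i. x (i + m)) = (\<lambda>i. x (i + (n + m)))" for m by (simp add: add.assoc)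
    then show "?T ` ?O \<subseteq> ?O" by force
  qed
  finally show ?thesis using assms unfolding orbit_closure_def by blast
qed

lemma subshift_orbit_closure: "subshift A (orbit_closure A x)"
  unfolding subshift_def shift_def using closedin_orbit_closure translate_orbit_closure by blast

lemma automatic_system_orbit_closure:
  "x \<in> seqs A \<Longrightarrow> automatic x \<Longrightarrow> automatic_system A (orbit_closure A x)"
  unfolding automatic_system_def using subshift_orbit_closure by blast

text \<open>One inclusion is continuity. For the other, the image is compact, hence closed in a
  Hausdorff space, and it contains the orbit of the coded point.\<close>

lemma orbit_closure_coding:
  fixes x :: "'i::comm_semiring_1 \<Rightarrow> 'a"
  assumes A: "finite A" and x: "x \<in> seqs A" and \<rho>: "\<rho> ` A \<subseteq> B"
  shows "(\<lambda>u. \<rho> \<circ> u) ` orbit_closure A x = orbit_closure B (\<rho> \<circ> x)"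
proof -
  let ?f = "\<lambda>u::'i \<Rightarrow> 'a. \<rho> \<circ> u"
  let ?O = "range (\<lambda>m i. x (i + m))" and ?O' = "range (\<lambda>m i. (\<rho> \<circ> x) (i + m))"
  have f: "continuous_map (full_shift A) (full_shift B) ?f" by (rule continuous_map_coding[OF \<rho>])
  have fO: "?f ` ?O = ?O'" by (auto simp: image_image o_def)
  have sub: "?f ` orbit_closure A x \<subseteq> orbit_closure B (\<rho> \<circ> x)"
    using continuous_map_image_closure_subset[OF f, of ?O] unfolding fO orbit_closure_def .
  have "compactin (full_shift A) (orbit_closure A x)"
    using compact_space_full_shift[OF A] closedin_orbit_closure by (rule closedin_compact_space)
  then have "compactin (full_shift B) (?f ` orbit_closure A x)" using f by (rule image_compactin)
  then have "closedin (full_shift B) (?f ` orbit_closure A x)"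
    using Hausdorff_space_full_shift by (rule compactin_imp_closedin[rotated])
  moreover have "?O' \<subseteq> ?f ` orbit_closure A x"
    unfolding fO[symmetric] by (rule image_mono) (use orbit_in[OF x] in auto)
  ultimately have "orbit_closure B (\<rho> \<circ> x) \<subseteq> ?f ` orbit_closure A x"
    unfolding orbit_closure_def[of B] by (rule closure_of_minimal[rotated])
  with sub show ?thesis by blast
qed

lemma topological_factor_coding:
  fixes x :: "'i::comm_semiring_1 \<Rightarrow> 'a"
  assumes A: "finite A" and x: "x \<in> seqs A" and \<rho>: "\<rho> ` A \<subseteq> B"
  shows "topological_factor A (orbit_closure A x) B (orbit_closure B (\<rho> \<circ> x))"
proof -
  let ?f = "\<lambda>u::'i \<Rightarrow> 'a. \<rho> \<circ> u"
  have img: "?f ` orbit_closure A x = orbit_closure B (\<rho> \<circ> x)" by (rule orbit_closure_coding[OF assms])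
  have "continuous_map (subtopology (full_shift A) (orbit_closure A x))
      (subtopology (full_shift B) (orbit_closure B (\<rho> \<circ> x))) ?f"
    unfolding continuous_map_in_subtopology
    by (intro conjI continuous_map_from_subtopology continuous_map_coding[OF \<rho>])
      (use img in \<open>auto simp: Pi_iff image_subset_iff\<close>)
  then show ?thesis unfolding topological_factor_def using img by (intro exI[of _ ?f]) (auto simp: shift_def)
qed

section \<open>Cylinders and block codes for factor maps\<close>

lemma openin_cylinder:
  assumes "u \<in> seqs A" "finite F"
  shows "openin (full_shift A) {v \<in> seqs A. \<forall>i\<in>F. v i = u i}"
proof -
  have "openin (full_shift A) {v \<in> topspace (full_shift A). v i \<in> {u i}}" for i
    by (rule openin_continuous_map_preimage[OF continuous_map_projection])
      (use assms(1) in \<open>auto simp: seqs_def\<close>)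
  then have one: "openin (full_shift A) {v \<in> seqs A. v i = u i}" for i by (simp add: topspace_full_shift)
  show ?thesis
    using assms(2)
  proof (induction F)
    case empty
    then show ?case using openin_topspace[of "full_shift A"] by (simp add: topspace_full_shift)
  next
    case (insert i F)
    have "{v \<in> seqs A. \<forall>j\<in>insert i F. v j = u j}
        = {v \<in> seqs A. v i = u i} \<inter> {v \<in> seqs A. \<forall>j\<in>F. v j = u j}" by auto
    then show ?case using one insert.IH by (simp add: openin_Int)
  qed
qed

lemma orbit_closure_agree:
  fixes x :: "'i::comm_semiring_1 \<Rightarrow> 'a"
  assumes "u \<in> orbit_closure A x" "finite F"
  shows "\<exists>n. \<forall>i\<in>F. u i = x (i + n)"
proof -
  have u: "u \<in> seqs A" using assms(1) orbit_closure_seqs by blast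
  define V where "V = {v \<in> seqs A. \<forall>i\<in>F. v i = u i}"
  have V: "openin (full_shift A) V" "u \<in> V" using openin_cylinder[OF u assms(2)] u by (auto simp: V_def)
  have "\<forall>T. u \<in> T \<and> openin (full_shift A) T \<longrightarrow> (\<exists>v. v \<in> range (\<lambda>n i. x (i + n)) \<and> v \<in> T)"
    using assms(1) unfolding orbit_closure_def in_closure_of by (rule conjunct2)
  then obtain v where v: "v \<in> range (\<lambda>n i. x (i + n))" "v \<in> V" using V by blast
  obtain n where "v = (\<lambda>i. x (i + n))" using v(1) by (rule rangeE)
  with v(2) show ?thesis unfolding V_def by (intro exI[of _ n]) simp
qed

lemma orbit_closure_language:
  fixes x :: "'i::comm_semiring_1 \<Rightarrow> 'a"
  assumes "u \<in> orbit_closure A x"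
  shows "map (\<lambda>j. u (e + of_nat j)) [0..<n] \<in> language x"
proof -
  obtain m where "\<forall>i\<in>(\<lambda>j. e + of_nat j) ` {..<n}. u i = x (i + m)"
    using orbit_closure_agree[OF assms, of "(\<lambda>j. e + of_nat j) ` {..<n}"] by auto
  then have "occurs x (e + m) (map (\<lambda>j. u (e + of_nat j)) [0..<n])"
    by (simp add: occurs_def ac_simps)
  then show ?thesis unfolding language_iff by (rule exI)
qed

lemma cylinder_basis:
  assumes "openin (full_shift A) V" "u \<in> V"
  shows "\<exists>F. finite F \<and> {v \<in> seqs A. \<forall>i\<in>F. v i = u i} \<subseteq> V"
proof -
  have "\<exists>U. finite {i \<in> UNIV. U i \<noteq> topspace (discrete_topology A)} \<and> u \<in> Pi\<^sub>E UNIV U \<and> Pi\<^sub>E UNIV U \<subseteq> V"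
    using assms(1)[unfolded full_shift_def openin_product_topology_alt, rule_format, OF assms(2)] by (elim exE conjE) (intro exI conjI)
  then obtain U where U: "finite {i. U i \<noteq> A}" "u \<in> Pi\<^sub>E UNIV U" "Pi\<^sub>E UNIV U \<subseteq> V" by auto
  have "{v \<in> seqs A. \<forall>i\<in>{i. U i \<noteq> A}. v i = u i} \<subseteq> Pi\<^sub>E UNIV U"
  proof
    fix v assume v: "v \<in> {v \<in> seqs A. \<forall>i\<in>{i. U i \<noteq> A}. v i = u i}"
    have "v i \<in> U i" for i
    proof (cases "U i = A")
      case True
      then show ?thesis using v by (auto simp: seqs_def)
    next
      case False
      then show ?thesis using v U(2) by (auto simp: PiE_def Pi_def)
    qed
    then show "v \<in> Pi\<^sub>E UNIV U" by (intro PiE_I) simp_all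
  qed
  then have "{v \<in> seqs A. \<forall>i\<in>{i. U i \<noteq> A}. v i = u i} \<subseteq> V" using U(3) by (rule subset_trans)
  with U(1) show ?thesis by (intro exI conjI)
qed

text \<open>The core of the Curtis-Hedlund-Lyndon theorem at one coordinate: continuity into a
  discrete space gives each point a finite window, and compactness of \<open>X\<close> a common
  one.\<close>

lemma finite_window:
  fixes f :: "('i \<Rightarrow> 'a) \<Rightarrow> ('i \<Rightarrow> 'b)"
  assumes A: "finite A" and X: "closedin (full_shift A) X"
    and f: "continuous_map (subtopology (full_shift A) X) (subtopology (full_shift B) Y) f"
  shows "\<exists>F. finite F \<and> (\<forall>u\<in>X. \<forall>v\<in>X. (\<forall>i\<in>F. u i = v i) \<longrightarrow> f u k = f v k)"
proof -
  have XA: "X \<subseteq> seqs A" using closedin_subset[OF X] by (simp add: topspace_full_shift)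
  have fk: "continuous_map (subtopology (full_shift A) X) (discrete_topology B) (\<lambda>u. f u k)"
    using f continuous_map_into_full_shift[of "subtopology (full_shift A) X" B f]
    by (simp add: continuous_map_in_subtopology)
  have "\<exists>F. finite F \<and> (\<forall>v\<in>X. (\<forall>i\<in>F. v i = u i) \<longrightarrow> f v k = f u k)" if u: "u \<in> X" for u
  proof -
    have top: "topspace (subtopology (full_shift A) X) = X" using XA by (auto simp: topspace_full_shift)
    have "f u k \<in> B" using continuous_map_image_subset_topspace[OF fk] u top by auto
    then have "openin (subtopology (full_shift A) X) {v \<in> topspace (subtopology (full_shift A) X). f v k \<in> {f u k}}"
      by (intro openin_continuous_map_preimage[OF fk]) simp
    then have "openin (subtopology (full_shift A) X) {v \<in> X. f v k = f u k}" unfolding top by simp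
    then obtain V where V: "openin (full_shift A) V" "{v \<in> X. f v k = f u k} = V \<inter> X"
      unfolding openin_subtopology by blast
    then have "u \<in> V" using u by blast
    then obtain F where "finite F" "{v \<in> seqs A. \<forall>i\<in>F. v i = u i} \<subseteq> V" using cylinder_basis[OF V(1)] by blast
    then show ?thesis using V(2) XA by (intro exI[of _ F]) blast
  qed
  then obtain F where F: "\<And>u. u \<in> X \<Longrightarrow> finite (F u)"
    "\<And>u v. u \<in> X \<Longrightarrow> v \<in> X \<Longrightarrow> (\<forall>i\<in>F u. v i = u i) \<Longrightarrow> f v k = f u k" by metis
  define V where "V u = {v \<in> seqs A. \<forall>i\<in>F u. v i = u i}" for u
  have "compactin (full_shift A) X" using compact_space_full_shift[OF A] X by (rule closedin_compact_space)
  moreover have "\<And>U. U \<in> V ` X \<Longrightarrow> openin (full_shift A) U" using F(1) XA openin_cylinder unfolding V_def by blast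
  moreover have "X \<subseteq> \<Union>(V ` X)" using XA by (auto simp: V_def)
  ultimately obtain \<F> where \<F>: "finite \<F>" "\<F> \<subseteq> V ` X" "X \<subseteq> \<Union>\<F>"
    using compactinD[of "full_shift A" X "V ` X"] by metis
  obtain S where S: "finite S" "S \<subseteq> X" "\<F> = V ` S" using finite_subset_image[OF \<F>(1,2)] by blast
  have "f u k = f v k" if uv: "u \<in> X" "v \<in> X" "\<forall>i\<in>\<Union>(F ` S). u i = v i" for u v
  proof -
    obtain w where w: "w \<in> S" "u \<in> V w" using \<F>(3) S(3) uv(1) by blast
    then have "\<forall>i\<in>F w. u i = w i" by (simp add: V_def)
    moreover have "\<forall>i\<in>F w. v i = w i" using calculation uv(3) w(1) by auto
    ultimately show ?thesis using F(2) w(1) S(2) uv(1,2) by (metis subsetD)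
  qed
  moreover have "finite (\<Union>(F ` S))" using S F(1) by blast
  ultimately show ?thesis by blast
qed

text \<open>Replaces order and subtraction of indices, so that the naturals and the integers can be
  treated together.\<close>

lemma common_origin:
  assumes idx: "\<And>n::'i::comm_semiring_1. \<exists>m::nat. n = of_nat m \<or> n + of_nat m = 0"
  shows "\<exists>e t t'. (i::'i) = e + of_nat t \<and> j = e + of_nat t'"
proof -
  have neg: "\<exists>e t t'. i = e + of_nat t \<and> j = e + of_nat t'" if "i = of_nat m" "j + of_nat m' = 0" for i j :: 'i and m m'
  proof (intro exI conjI)
    show "i = j + of_nat (m' + m)" using that by (simp add: add.assoc[symmetric])
    show "j = j + of_nat 0" by simp
  qed
  have negneg: "\<exists>e t t'. i = e + of_nat t \<and> j = e + of_nat t'"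
    if "i + of_nat m = 0" "j + of_nat m' = 0" "m \<le> m'" for i j :: 'i and m m'
  proof (intro exI conjI)
    have "j + of_nat (m' - m) = (i + of_nat m) + (j + of_nat (m' - m))" using that(1) by simp
    also have "\<dots> = i + (j + of_nat (m + (m' - m)))" by (simp only: of_nat_add ac_simps)
    also have "\<dots> = i" using that by simp
    finally show "i = j + of_nat (m' - m)" ..
    show "j = j + of_nat 0" by simp
  qed
  obtain m m' where m: "i = of_nat m \<or> i + of_nat m = 0" "j = of_nat m' \<or> j + of_nat m' = 0"
    using idx by metis
  show ?thesis
  proof (cases "i = of_nat m")
    case i: True
    show ?thesis
    proof (cases "j = of_nat m'")
      case True
      with i show ?thesis by (intro exI[of _ 0] exI[of _ m] exI[of _ m']) simp
    next
      case False
      then show ?thesis using neg[OF i] m(2) by blast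
    qed
  next
    case i: False
    show ?thesis
    proof (cases "j = of_nat m'")
      case True
      then show ?thesis using neg[OF True] m(1) i by blast
    next
      case False
      then show ?thesis using negneg[of i m j m'] negneg[of j m' i m] m i by (metis nat_le_linear)
    qed
  qed
qed

lemma window_interval:
  assumes idx: "\<And>n::'i::comm_semiring_1. \<exists>m::nat. n = of_nat m \<or> n + of_nat m = 0"
    and F: "finite (F :: 'i set)"
  shows "\<exists>i0 r. \<forall>i\<in>F. \<exists>t\<le>r. i = i0 + of_nat t"
  using F
proof (induction F)
  case (insert i F)
  then obtain i0 r where IH: "\<forall>i\<in>F. \<exists>t\<le>r. i = i0 + of_nat t" by blast
  obtain e t t' where e: "i = e + of_nat t" "i0 = e + of_nat t'" using common_origin[OF idx] by blast
  have "\<exists>s\<le>t + t' + r. j = e + of_nat s" if j: "j \<in> insert i F" for j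
  proof (cases "j = i")
    case True
    then show ?thesis using e(1) by (intro exI[of _ t]) simp
  next
    case False
    then obtain s where "s \<le> r" "j = i0 + of_nat s" using IH j by blast
    then show ?thesis using e(2) by (intro exI[of _ "t' + s"]) (simp add: add.assoc)
  qed
  then show ?case by blast
qed simp

text \<open>The block code is stated along a single preimage \<open>u\<close> of \<open>y\<close>,
  as the equality pattern it must respect; no code function is constructed.\<close>

lemma sliding_block_code:
  fixes x :: "'i::comm_semiring_1 \<Rightarrow> 'a"
  assumes idx: "\<And>n::'i. \<exists>m::nat. n = of_nat m \<or> n + of_nat m = 0"
    and A: "finite A" and factor: "topological_factor A (orbit_closure A x) B Y" and y: "y \<in> Y"
  shows "\<exists>u\<in>orbit_closure A x. \<exists>i0 r. \<forall>e e'.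
    (\<forall>t\<le>r. u (i0 + e + of_nat t) = u (i0 + e' + of_nat t)) \<longrightarrow> y e = y e'"
proof -
  let ?X = "orbit_closure A x"
  obtain f where f: "continuous_map (subtopology (full_shift A) ?X) (subtopology (full_shift B) Y) f"
    "f ` ?X = Y" "\<And>z. z \<in> ?X \<Longrightarrow> f (shift z) = shift (f z)"
    using factor unfolding topological_factor_def by blast
  have tr: "(\<lambda>i. z (i + n)) \<in> ?X" if "z \<in> ?X" for z n using translate_orbit_closure[OF that] .
  have f_nat: "f (\<lambda>i. z (i + of_nat m)) = (\<lambda>i. f z (i + of_nat m))" if "z \<in> ?X" for z m
  proof (induction m)
    case (Suc m)
    have "f (\<lambda>i. z (i + of_nat (Suc m))) = f (shift (\<lambda>i. z (i + of_nat m)))"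
      by (simp add: shift_def add.assoc)
    also have "\<dots> = shift (\<lambda>i. f z (i + of_nat m))" unfolding f(3)[OF tr[OF that]] Suc ..
    finally show ?case by (simp add: shift_def add.assoc)
  qed simp
  \<comment> \<open>Commutation is given for one forward step only. A backward translate is moved
    forward again and its image evaluated at a shifted index.\<close>
  have f_any: "f (\<lambda>i. z (i + n)) = (\<lambda>i. f z (i + n))" if z: "z \<in> ?X" for z n
  proof -
    obtain m where m: "n = of_nat m \<or> n + of_nat m = 0" using idx by blast
    show ?thesis
    proof (cases "n = of_nat m")
      case True
      then show ?thesis using f_nat[OF z] by simp
    next
      case False
      with m have nm: "n + of_nat m = 0" by simp
      then have mn: "of_nat m + n = 0" by (simp add: add.commute)
      have "f z = f (\<lambda>i. (\<lambda>i. z (i + n)) (i + of_nat m))" using mn by (simp add: add.assoc)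
      also have "\<dots> = (\<lambda>i. f (\<lambda>i. z (i + n)) (i + of_nat m))" by (rule f_nat[OF tr[OF z]])
      finally have "f z (i + n) = f (\<lambda>i. z (i + n)) (i + n + of_nat m)" for i by metis
      then show ?thesis using nm by (simp add: add.assoc)
    qed
  qed
  obtain F :: "'i set" where F: "finite F" "\<And>u v. u \<in> ?X \<Longrightarrow> v \<in> ?X \<Longrightarrow> (\<forall>i\<in>F. u i = v i) \<Longrightarrow> f u 0 = f v 0"
    using finite_window[OF A closedin_orbit_closure f(1), of 0] by blast
  obtain i0 r where win: "\<And>i. i \<in> F \<Longrightarrow> \<exists>t\<le>r. i = i0 + of_nat t" using window_interval[OF idx F(1)] by blast
  obtain u where u: "u \<in> ?X" "y = f u" using f(2) y by blast
  have "y e = y e'" if eq: "\<forall>t\<le>r. u (i0 + e + of_nat t) = u (i0 + e' + of_nat t)" for e e'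
  proof -
    have y_e: "y e = f (\<lambda>i. u (i + e)) 0" for e unfolding u(2) f_any[OF u(1)] by simp
    have "u (i + e) = u (i + e')" if "i \<in> F" for i
      using win[OF that] eq by (auto simp: ac_simps)
    then show ?thesis unfolding y_e by (intro F(2) tr u(1)) blast
  qed
  then show ?thesis using u(1) by blast
qed

lemma finite_orbit_closure:
  fixes y :: "'i::comm_semiring_1 \<Rightarrow> 'b"
  assumes idx: "\<And>n::'i. \<exists>m::nat. n = of_nat m \<or> n + of_nat m = 0"
    and y: "y \<in> seqs B" and per: "periodic y"
  shows "finite (orbit_closure B y)"
proof -
  obtain p :: nat where p: "p > 0" "\<And>i. y (i + of_nat p) = y i" using per unfolding periodic_def by blast
  have mult: "y (i + of_nat (p * m)) = y i" for i m
  proof (induction m)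
    case (Suc m)
    have "i + of_nat (p * Suc m) = i + of_nat (p * m) + of_nat p" by (simp add: ac_simps)
    then show ?case using p(2)[of "i + of_nat (p * m)"] Suc by (simp only:)
  qed simp
  have nat_mod: "y (i + of_nat m) = y (i + of_nat (m mod p))" for i m
  proof -
    have "of_nat m = (of_nat (m mod p) + of_nat (p * (m div p)) :: 'i)"
      by (simp only: of_nat_add[symmetric] mod_mult_div_eq)
    then show ?thesis using mult[of "i + of_nat (m mod p)" "m div p"] by (simp only: add.assoc)
  qed
  have "\<exists>m<p. (\<lambda>i. y (i + n)) = (\<lambda>i. y (i + of_nat m))" for n
  proof -
    obtain m where m: "n = of_nat m \<or> n + of_nat m = 0" using idx by blast
    have "\<exists>m'. \<forall>i. y (i + n) = y (i + of_nat m')"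
    proof (cases "n = of_nat m")
      case True
      then show ?thesis by blast
    next
      case False
      with m have nm: "n + of_nat m = 0" by simp
      \<comment> \<open>The index \<open>n\<close> stands for \<open>-m\<close>; adding the multiple
        \<open>p * m\<close> of the period makes it natural.\<close>
      have "y (i + n) = y (i + of_nat (p * m - m))" for i
      proof -
        have "n + of_nat (p * m) = (n + of_nat m) + of_nat (p * m - m)"
          using p(1) by (simp only: add.assoc of_nat_add[symmetric]) (simp add: Suc_leI)
        then have "n + of_nat (p * m) = of_nat (p * m - m)" using nm by simp
        then show ?thesis using mult[of "i + n" m] by (simp add: add.assoc)
      qed
      then show ?thesis by blast
    qed
    then obtain m' where "\<And>i. y (i + n) = y (i + of_nat m')" by blast
    then show ?thesis using nat_mod[of _ m'] p(1) by (intro exI[of _ "m' mod p"]) simp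
  qed
  then have "range (\<lambda>n i. y (i + n)) \<subseteq> (\<lambda>m i. y (i + of_nat m)) ` {..<p}" by force
  then have fin: "finite (range (\<lambda>n i. y (i + n)))" by (rule finite_subset) simp
  have "range (\<lambda>n i. y (i + n)) \<subseteq> topspace (full_shift B)"
    using y by (auto simp: topspace_full_shift seqs_def)
  then have "closedin (full_shift B) (range (\<lambda>n i. y (i + n)))"
    using fin by (intro closedin_Hausdorff_finite Hausdorff_space_full_shift)
  then have "orbit_closure B y = range (\<lambda>n i. y (i + n))"
    unfolding orbit_closure_def by (rule closure_of_closedin)
  then show ?thesis using fin by simp
qed

text \<open>Pigeonhole on the forward translates. A one-sided sequence can have a finite orbit
  closure and still a preperiod; recurrence removes it in
  \<open>periodic_if_eventually_periodic\<close>.\<close>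

lemma eventually_periodic_if_finite_orbit_closure:
  fixes y :: "'i::comm_semiring_1 \<Rightarrow> 'b"
  assumes y: "y \<in> seqs B" and fin: "finite (orbit_closure B y)"
  shows "eventually_periodic (\<lambda>n. y (of_nat n))"
proof -
  let ?g = "\<lambda>n::nat. \<lambda>i. y (i + of_nat n)"
  have "range ?g \<subseteq> orbit_closure B y" using orbit_in[OF y] by auto
  then have "finite (range ?g)" using fin by (rule finite_subset)
  then have "\<not> inj ?g" using finite_imageD infinite_UNIV_nat by blast
  then obtain n m where "n < m" "?g n = ?g m" unfolding inj_def by (metis linorder_neqE_nat)
  then obtain d where d: "d > 0" "?g n = ?g (n + d)" by (metis less_imp_add_positive)
  have "y (of_nat (i + d)) = y (of_nat i)" if "i \<ge> n" for i
    using fun_cong[OF d(2), of "of_nat (i - n)"] that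
    by (simp only: of_nat_add[symmetric]) (simp add: add.assoc[symmetric])
  then show ?thesis unfolding eventually_periodic_def using d(1) by blast
qed


section \<open>The equivalence\<close>

lemma automatic_coding: "automatic x \<Longrightarrow> automatic (\<rho> \<circ> x)"
  unfolding automatic_def k_automatic_def by (metis comp_assoc)

text \<open>Restricts a two-sided fixed point to its right half: block 0 starts at position 0 and
  all blocks have length \<open>k\<close>, so block \<open>n\<close> starts at
  \<open>k * n\<close>.\<close>

lemma automaticD:
  fixes y :: "'i::comm_semiring_1 \<Rightarrow> 'b"
  assumes "automatic y"
  shows "\<exists>k\<ge>2. \<exists>(C :: nat set) (z :: nat \<Rightarrow> nat) \<psi> \<rho>. finite C \<and> range z \<subseteq> C \<and>
    (\<forall>n j. j < k \<longrightarrow> z (k * n + j) = \<psi> (z n) ! j) \<and> (\<forall>n. y (of_nat n) = \<rho> (z n))"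
proof -
  obtain k C \<psi> z \<rho> where k: "k \<ge> 2" and C: "substitution C \<psi>" "constant_length C \<psi> k"
    and z: "fixed_point C \<psi> (z :: 'i \<Rightarrow> nat)" and y: "y = \<rho> \<circ> z"
    using assms unfolding automatic_def k_automatic_def by blast
  have z_C: "z i \<in> C" for i using z unfolding fixed_point_def seqs_def by auto
  have len: "length (\<psi> (z i)) = k" for i using z_C[of i] C(2) unfolding constant_length_def by blast
  obtain p :: "'i \<Rightarrow> 'i" where p: "p 0 = 0" "\<And>i. p (i + 1) = p i + of_nat k"
    "\<And>i j. j < k \<Longrightarrow> z (p i + of_nat j) = \<psi> (z i) ! j"
    using z unfolding fixed_point_def is_image_seq_def len by blast
  have p_nat: "p (of_nat n) = of_nat (k * n)" for n
  proof (induction n)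
    case (Suc n)
    then show ?case using p(2)[of "of_nat n"] by (simp add: add.commute)
  qed (simp add: p(1))
  have "z (of_nat (k * n + j)) = \<psi> (z (of_nat n)) ! j" if "j < k" for n j
    using p(3)[OF that, of "of_nat n"] unfolding p_nat by simp
  then have "\<forall>n j. j < k \<longrightarrow> z (of_nat (k * n + j)) = \<psi> (z (of_nat n)) ! j" by blast
  moreover have "finite C" using C(1) unfolding substitution_def by blast
  moreover have "range (\<lambda>n::nat. z (of_nat n)) \<subseteq> C" by (intro image_subsetI z_C)
  moreover have "\<forall>n. y (of_nat n) = \<rho> (z (of_nat n))" by (simp add: y)
  ultimately show ?thesis using k by (intro exI conjI) assumption+
qed

lemma return_words_cong: "language x = language y \<Longrightarrow> return_words x a = return_words y a"
  unfolding return_words_def by simp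

lemma return_subst_cong:
  assumes "language x = language y"
  shows "return_subst x a \<phi> = return_subst y a \<phi>"
  by (intro ext) (simp only: return_subst_def return_words_cong[OF assms])

lemma two_letters:
  fixes x :: "'i::comm_semiring_1 \<Rightarrow> 'a"
  assumes "\<not> periodic x"
  shows "\<exists>i. x i \<noteq> x 0"
proof (rule ccontr)
  assume "\<not> ?thesis"
  then have "\<forall>i. x (i + of_nat 1) = x i" by metis
  moreover have "(0::nat) < 1" by simp
  ultimately have "periodic x" unfolding periodic_def by (intro exI[of _ "1::nat"] conjI)
  with assms show False ..
qed

lemma all_equivalent_cycle:
  assumes "P1 \<Longrightarrow> P2" "P1 \<Longrightarrow> P3" "P2 \<Longrightarrow> P4" "P3 \<Longrightarrow> P4" "P4 \<Longrightarrow> P5" "P5 \<Longrightarrow> P1"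
  shows "all_equivalent [P1, P2, P3, P4, P5]"
  using assms unfolding all_equivalent_def by auto

context primitive_sequence
begin

text \<open>\<open>X\<close> is the given sequence, \<open>x\<close> itself or a two-sided sequence
  with the same language; return words and \<open>\<tau>\<close> depend on the language alone. The
  assumption \<open>uniform\<close> isolates the construction of the automaton, which is done
  separately for the two index types.\<close>

lemma conditions_equivalent:
  fixes X :: "'i::comm_semiring_1 \<Rightarrow> 'a"
  assumes idx: "\<And>n::'i. \<exists>m::nat. n = of_nat m \<or> n + of_nat m = 0"
    and X: "X \<in> seqs A" "X 0 = a" "language X = language x" "\<not> periodic X"
    and uniform: "\<And>k s. k \<ge> 2 \<Longrightarrow>
      (\<And>w. w \<in> R \<Longrightarrow> length (iterate \<phi> (Suc s) w) = k * length (iterate \<phi> s w)) \<Longrightarrow> automatic X"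
  shows "let Z = orbit_closure A X;
           R = return_words X (X 0);
           \<tau> = return_subst X (X 0) \<phi>;
           M = incidence_matrix R \<tau>;
           s = largest_jordan_block M 0
       in all_equivalent
         [automatic X,
          \<exists>(B :: nat set) \<rho>. finite B \<and> \<rho> ` A \<subseteq> B \<and>
            \<not> periodic (\<rho> \<circ> X) \<and> automatic (\<rho> \<circ> X),
          automatic_system A Z,
          \<exists>(B :: nat set) Y. finite B \<and> infinite Y \<and>
            automatic_system B Y \<and> topological_factor A Z B Y,
          left_eigenvector M (length_vector \<phi> s R)]"
proof -
  have R: "return_words X (X 0) = R" unfolding X(2) by (rule return_words_cong[OF X(3)])
  have \<tau>: "return_subst X (X 0) \<phi> = return_subst x a \<phi>" unfolding X(2) by (rule return_subst_cong[OF X(3)])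
  let ?O = "orbit_closure A X"
  have lang: "map (\<lambda>j. u (e + of_nat j)) [0..<n] \<in> language x" if "u \<in> ?O" for u e n
    using orbit_closure_language[OF that] unfolding X(3) .
  have X_O: "X \<in> ?O" by (rule self_in_orbit_closure[OF X(1)])
  have infinite_coded: "infinite (orbit_closure B (\<rho> \<circ> X))" if B: "\<rho> ` A \<subseteq> B" and np: "\<not> periodic (\<rho> \<circ> X)"
    for B and \<rho> :: "'a \<Rightarrow> 'b"
  proof
    assume fin: "finite (orbit_closure B (\<rho> \<circ> X))"
    have "\<rho> \<circ> X \<in> seqs B" using X(1) B by (auto simp: seqs_def)
    then have "eventually_periodic (\<lambda>n. (\<rho> \<circ> X) (of_nat n))"
      using fin by (rule eventually_periodic_if_finite_orbit_closure)
    then have "periodic (\<rho> \<circ> X)"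
      by (rule periodic_if_eventually_periodic[of X 0 0 "\<rho> \<circ> X", rotated 2]) (use lang[OF X_O] in auto)
    with np show False by blast
  qed
  \<comment> \<open>Conditions (ii) and (iv) take their alphabets from the natural numbers, so
    \<open>A\<close> has to be renamed.\<close>
  obtain e :: "'a \<Rightarrow> nat" where e: "inj_on e A" using finite_imp_inj_to_nat_seg[OF A(1)] by blast
  have e_np: "\<not> periodic (e \<circ> X)"
  proof
    assume "periodic (e \<circ> X)"
    then obtain h :: nat where h: "h > 0" "\<And>i. e (X (i + of_nat h)) = e (X i)" unfolding periodic_def by auto
    have "X (i + of_nat h) = X i" for i using inj_onD[OF e h(2)] X(1) by (auto simp: seqs_def)
    with h(1) X(4) show False unfolding periodic_def by blast
  qed
  show ?thesis
    unfolding Let_def R \<tau>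
  proof (rule all_equivalent_cycle)
    assume "automatic X"
    then show "automatic_system A ?O" by (rule automatic_system_orbit_closure[OF X(1)])
    have "automatic (e \<circ> X)" using \<open>automatic X\<close> by (rule automatic_coding)
    with e_np A(1) show "\<exists>(B :: nat set) \<rho>. finite B \<and> \<rho> ` A \<subseteq> B \<and> \<not> periodic (\<rho> \<circ> X) \<and> automatic (\<rho> \<circ> X)"
      by (intro exI[of _ "e ` A"] exI[of _ e]) auto
  next
    assume "\<exists>(B :: nat set) \<rho>. finite B \<and> \<rho> ` A \<subseteq> B \<and> \<not> periodic (\<rho> \<circ> X) \<and> automatic (\<rho> \<circ> X)"
    then obtain B :: "nat set" and \<rho> where B: "finite B" "\<rho> ` A \<subseteq> B" "\<not> periodic (\<rho> \<circ> X)" "automatic (\<rho> \<circ> X)"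
      by blast
    have "\<rho> \<circ> X \<in> seqs B" using X(1) B(2) by (auto simp: seqs_def)
    then show "\<exists>(B :: nat set) Y. finite B \<and> infinite Y \<and> automatic_system B Y \<and> topological_factor A ?O B Y"
      using B(1) infinite_coded[OF B(2,3)] automatic_system_orbit_closure[OF _ B(4), of B]
        topological_factor_coding[OF A(1) X(1) B(2)]
      by (intro exI conjI)
  next
    assume "automatic_system A ?O"
    then obtain X' where X': "X' \<in> seqs A" "automatic X'" "?O = orbit_closure A X'"
      unfolding automatic_system_def by blast
    let ?B = "e ` A"
    let ?Y = "orbit_closure ?B (e \<circ> X')"
    \<comment> \<open>The automatic generator \<open>X'\<close> may differ from \<open>X\<close>,
      but both generate the same system and so do their codings. Infinity then comes from the
      nonperiodic \<open>X\<close>.\<close>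
    have "?Y = orbit_closure ?B (e \<circ> X)"
      unfolding orbit_closure_coding[OF A(1) X'(1) subset_refl, symmetric] X'(3)[symmetric]
      by (rule orbit_closure_coding[OF A(1) X(1) subset_refl])
    then have "infinite ?Y" using infinite_coded[OF subset_refl e_np] by simp
    moreover have "e \<circ> X' \<in> seqs ?B" using X'(1) by (auto simp: seqs_def)
    then have "automatic_system ?B ?Y" using X'(2) by (intro automatic_system_orbit_closure automatic_coding)
    moreover have "topological_factor A ?O ?B ?Y"
      unfolding X'(3) by (rule topological_factor_coding[OF A(1) X'(1) subset_refl])
    moreover have "finite ?B" using A(1) by simp
    ultimately show "\<exists>(B :: nat set) Y. finite B \<and> infinite Y \<and> automatic_system B Y \<and> topological_factor A ?O B Y"
      by (intro exI conjI)
  next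
    assume "\<exists>(B :: nat set) Y. finite B \<and> infinite Y \<and> automatic_system B Y \<and> topological_factor A ?O B Y"
    then obtain B :: "nat set" and Y where Y: "finite B" "infinite Y" "automatic_system B Y" "topological_factor A ?O B Y"
      by blast
    obtain y where y: "y \<in> seqs B" "automatic y" "Y = orbit_closure B y"
      using Y(3) unfolding automatic_system_def by blast
    have "y \<in> Y" unfolding y(3) by (rule self_in_orbit_closure[OF y(1)])
    then obtain u i0 r where u: "u \<in> ?O" and code: "\<And>e e'. (\<forall>t\<le>r. u (i0 + e + of_nat t) = u (i0 + e' + of_nat t)) \<Longrightarrow> y e = y e'"
      using sliding_block_code[OF idx A(1) Y(4)] by blast
    \<comment> \<open>Recurrence of \<open>u\<close> would make an eventually periodic
      \<open>y\<close> periodic, with a finite orbit closure.\<close>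
    have np: "\<not> eventually_periodic (\<lambda>n. y (of_nat n))"
    proof
      assume "eventually_periodic (\<lambda>n. y (of_nat n))"
      then have "periodic y"
        by (rule periodic_if_eventually_periodic[of u r i0 y, rotated 2]) (use lang[OF u] code in blast)+
      then have "finite Y" unfolding y(3) by (rule finite_orbit_closure[OF idx y(1)])
      with Y(2) show False by blast
    qed
    obtain k C and z :: "nat \<Rightarrow> nat" and \<psi> \<rho> where k: "k \<ge> 2" and C: "finite C" "range z \<subseteq> C"
      and z: "\<And>n j. j < k \<Longrightarrow> z (k * n + j) = \<psi> (z n) ! j" "\<And>n. y (of_nat n) = \<rho> (z n)"
      using automaticD[OF y(2)] by blast
    show "left_eigenvector M (length_vector \<phi> (largest_jordan_block M 0) R)"
    proof (rule eigenvector_if_automatic_factor[where x' = "\<lambda>n. u (i0 + of_nat n)" and r = r, OF _ _ k C z np])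
      show "map (\<lambda>j. u (i0 + of_nat (i + j))) [0..<n] \<in> language x" for i n
        using lang[OF u, of "i0 + of_nat i" n] by (simp add: add.assoc)
      show "y (of_nat i) = y (of_nat j)"
        if "\<And>t. t \<le> r \<Longrightarrow> u (i0 + of_nat (i + t)) = u (i0 + of_nat (j + t))" for i j
        by (rule code) (use that in \<open>simp add: add.assoc\<close>)
    qed
  next
    assume "left_eigenvector M (length_vector \<phi> (largest_jordan_block M 0) R)"
    then obtain ev where "length_vector \<phi> (Suc (largest_jordan_block M 0)) R
        = ev \<cdot>\<^sub>v length_vector \<phi> (largest_jordan_block M 0) R" unfolding left_eigenvector_iff by blast
    then obtain k where "k \<ge> 2" "\<forall>w\<in>R. length (iterate \<phi> (Suc (largest_jordan_block M 0)) w)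
        = k * length (iterate \<phi> (largest_jordan_block M 0) w)"
      using integral_eigenvalue by blast
    then show "automatic X" by (intro uniform[of k "largest_jordan_block M 0"]) blast+
  qed
qed

text \<open>The sequence is extended to the integers by the value \<open>x 0\<close> at negative
  positions, and the index set \<open>{0..}\<close> keeps these out of the conclusions.\<close>

lemma uniform_automatic_nat:
  assumes k: "k \<ge> 2" and scale: "\<And>w. w \<in> R \<Longrightarrow> length (iterate \<phi> (Suc s) w) = k * length (iterate \<phi> s w)"
  shows "automatic x"
proof -
  let ?X = "\<lambda>i. x (nat i)" and ?P = "\<lambda>i. int (p (nat i))"
  have nat_Suc: "nat (i + 1) = nat i + 1" if "0 \<le> i" for i using that by simp
  have occ: "occurs ?X i w \<longleftrightarrow> occurs x (nat i) w" if "0 \<le> i" for i w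
    using that by (simp add: occurs_def nat_add_distrib)
  have E: "expansion \<phi> {0..} ?X ?P"
  proof
    fix i :: int assume "i \<in> {0..}"
    then have i: "0 \<le> i" by simp
    show "?P (i + 1) = ?P i + of_nat (length (\<phi> (?X i)))"
      unfolding nat_Suc[OF i] using p_step[of "nat i"] by simp
    show "occurs ?X (?P i) (\<phi> (?X i))" using occ[of "?P i"] occurs_p[of "nat i"] by simp
  qed (auto simp: p_0)
  have X0: "?X 0 = a" by simp
  have lang: "w \<in> language x" if "i \<in> {0..}" "occurs ?X i w" for i w
  proof -
    have "occurs x (nat i) w" using occ[of i w] that by simp
    then show ?thesis unfolding language_iff by (rule exI)
  qed
  have "\<exists>(z :: int \<Rightarrow> nat) C \<psi> \<rho>. finite C \<and> (\<forall>n\<in>{0..}. z n \<in> C) \<and>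
    (\<forall>c\<in>C. length (\<psi> c) = k \<and> set (\<psi> c) \<subseteq> C) \<and>
    (\<forall>n\<in>{0..}. \<forall>j<k. z (int k * n + int j) = \<psi> (z n) ! j) \<and> (\<forall>n\<in>{0..}. ?X n = \<rho> (z n))"
    by (rule uniform_states[OF E disjI2[OF refl] X0 _ k]) (fact lang, fact scale)
  then show ?thesis
  proof (elim exE conjE)
    fix z :: "int \<Rightarrow> nat" and C \<psi> \<rho>
    assume C: "finite C" "\<forall>n\<in>{0..}. z n \<in> C" and \<psi>: "\<forall>c\<in>C. length (\<psi> c) = k \<and> set (\<psi> c) \<subseteq> C"
      and z: "\<forall>n\<in>{0..}. \<forall>j<k. z (int k * n + int j) = \<psi> (z n) ! j" and \<rho>: "\<forall>n\<in>{0..}. ?X n = \<rho> (z n)"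
    show "automatic x"
    proof (rule automaticI[OF k C(1), of "\<lambda>n. z (int n)" \<psi> x \<rho>])
      show "range (\<lambda>n. z (int n)) \<subseteq> C" using C(2) by (intro image_subsetI) simp
      show "length (\<psi> c) = k \<and> set (\<psi> c) \<subseteq> C" if "c \<in> C" for c using \<psi> that by (rule bspec)
      show "z (int (of_nat k * n + of_nat j)) = \<psi> (z (int n)) ! j" if "j < k" for n j
        using z[rule_format, of "int n" j] that by simp
      show "\<exists>i. \<exists>j<k. m = of_nat k * i + of_nat j" for m :: nat
        using k by (intro exI[of _ "m div k"] exI[of _ "m mod k"]) simp
      show "x n = \<rho> (z (int n))" for n using \<rho>[rule_format, of "int n"] by simp
    qed
  qed
qed

lemma uniform_automatic_int:
  assumes E: "expansion \<phi> UNIV X P" and X: "X 0 = a" "language X = language x"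
    and k: "k \<ge> 2" and scale: "\<And>w. w \<in> R \<Longrightarrow> length (iterate \<phi> (Suc s) w) = k * length (iterate \<phi> s w)"
  shows "automatic (X :: int \<Rightarrow> 'a)"
proof -
  have "w \<in> language x" if "occurs X i w" for i w using that X(2) language_iff by blast
  then have lang: "w \<in> language x" if "i \<in> UNIV" "occurs X i w" for i w using that(2) .
  have "\<exists>(z :: int \<Rightarrow> nat) C \<psi> \<rho>. finite C \<and> (\<forall>n\<in>UNIV. z n \<in> C) \<and>
    (\<forall>c\<in>C. length (\<psi> c) = k \<and> set (\<psi> c) \<subseteq> C) \<and>
    (\<forall>n\<in>UNIV. \<forall>j<k. z (int k * n + int j) = \<psi> (z n) ! j) \<and> (\<forall>n\<in>UNIV. X n = \<rho> (z n))"
    by (rule uniform_states[OF E disjI1[OF refl] X(1) _ k]) (fact lang, fact scale)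
  then show ?thesis
  proof (elim exE conjE)
    fix z :: "int \<Rightarrow> nat" and C \<psi> \<rho>
    assume C: "finite C" "\<forall>n\<in>UNIV. z n \<in> C" and \<psi>: "\<forall>c\<in>C. length (\<psi> c) = k \<and> set (\<psi> c) \<subseteq> C"
      and z: "\<forall>n\<in>UNIV. \<forall>j<k. z (int k * n + int j) = \<psi> (z n) ! j" and \<rho>: "\<forall>n\<in>UNIV. X n = \<rho> (z n)"
    show "automatic X"
    proof (rule automaticI[OF k C(1), of z \<psi> X \<rho>])
      show "range z \<subseteq> C" using C(2) by (intro image_subsetI) (rule bspec)
      show "length (\<psi> c) = k \<and> set (\<psi> c) \<subseteq> C" if "c \<in> C" for c using \<psi> that by (rule bspec)
      show "z (of_nat k * n + of_nat j) = \<psi> (z n) ! j" if "j < k" for n j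
        using bspec[OF z UNIV_I, of n] that by simp
      show "\<exists>i. \<exists>j<k. m = of_nat k * i + of_nat j" for m :: int
        using k by (intro exI[of _ "m div int k"] exI[of _ "nat (m mod int k)"]) (simp add: nat_less_iff)
      show "X n = \<rho> (z n)" for n using \<rho> by (rule bspec) simp
    qed
  qed
qed

end

section \<open>Two-sided fixed points and their right halves\<close>

lemma occurs_sublist_int:
  fixes X :: "int \<Rightarrow> 'a"
  assumes v: "occurs X e v" and w: "occurs X i w" and le: "e \<le> i" "i + int (length w) \<le> e + int (length v)"
  shows "sublist w v"
proof -
  define d where "d = nat (i - e)"
  have d: "i = e + int d" using le(1) by (simp add: d_def)
  with le(2) have len: "d + length w \<le> length v" by simp
  have split: "v = take d v @ take (length w) (drop d v) @ drop (length w) (drop d v)"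
    by (simp only: append_take_drop_id)
  have "occurs X (e + int (length (take d v))) (take (length w) (drop d v))"
    using v split by (metis occurs_append of_nat_id)
  then have "occurs X i (take (length w) (drop d v))" using len d by (simp add: min_absorb2)
  then have "take (length w) (drop d v) = w" using len by (intro occurs_eq[OF _ w]) auto
  then show ?thesis using split by (metis sublist_appendI)
qed

text \<open>Admissibility places \<open>x_{-1} x_0\<close>, and with it every word of the two-sided sequence, in a word
  \<open>\<phi>^n(b)\<close>, which occurs in the right half.\<close>

lemma admissible_language:
  fixes X :: "int \<Rightarrow> 'a"
  assumes A: "finite A" "substitution A \<phi>" "primitive A \<phi>" and two: "c \<in> A" "c' \<in> A" "c \<noteq> c'"
    and X: "X \<in> seqs A" and E: "expansion \<phi> UNIV X P" and adm: "admissible A \<phi> X"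
    and E': "expansion \<phi> UNIV (\<lambda>n::nat. X (int n)) p"
  shows "language X = language (\<lambda>n::nat. X (int n))"
proof (intro equalityI subsetI)
  fix w assume "w \<in> language (\<lambda>n::nat. X (int n))"
  then obtain i where "occurs (\<lambda>n::nat. X (of_nat n)) i w" unfolding language_iff by auto
  then show "w \<in> language X" using occurs_nat language_iff by blast
next
  interpret E: expansion \<phi> UNIV X P by (rule E)
  interpret E': expansion \<phi> UNIV "\<lambda>n::nat. X (int n)" p by (rule E')
  have X_A: "X i \<in> A" for i using X by (auto simp: seqs_def)
  fix w assume "w \<in> language X"
  then obtain i where i: "occurs X i w" unfolding language_iff by blast
  obtain n where n: "\<And>b. b \<in> A \<Longrightarrow> nat \<bar>i\<bar> + length w \<le> length (iterate \<phi> n [b])"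
    using length_iterate_unbounded[OF A two, of "nat \<bar>i\<bar> + length w"] by blast
  have len: "\<bar>i\<bar> + int (length w) \<le> int (length (iterate \<phi> n [X j]))" for j using n[OF X_A[of j]] by linarith
  have occ: "occurs X (-1) [X (-1), X 0]" by (simp add: occurs_Cons)
  \<comment> \<open>The block \<open>\<phi>^n(X (-1))\<close> ends just before position 0, so for
    large \<open>n\<close> the image of the two central letters covers the occurrence of
    \<open>w\<close>.\<close>
  have start: "(P ^^ n) (-1) = - int (length (iterate \<phi> n [X (-1)]))"
    using E.pos_add[of "-1" "[X (-1)]" n] E.pos_0[of n] by (simp add: occurs_Cons)
  have "occurs X ((P ^^ n) (-1)) (iterate \<phi> n [X (-1), X 0])" using E.occurs_pos[OF _ occ] by simp
  moreover have "iterate \<phi> n [X (-1), X 0] = iterate \<phi> n [X (-1)] @ iterate \<phi> n [X 0]" by (rule iterate_Cons)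
  ultimately have sub: "sublist w (iterate \<phi> n [X (-1), X 0])"
    by (intro occurs_sublist_int[OF _ i]) (use len[of "-1"] len[of 0] start in auto)
  obtain b m where b: "b \<in> A" "sublist [X (-1), X 0] (iterate \<phi> m [b])"
    using adm unfolding admissible_def by blast
  \<comment> \<open>Brings the admissibility witness \<open>b\<close> into an iterate of
    \<open>X 0\<close>, whose further iterates are prefixes of the right half.\<close>
  obtain n0 where "b \<in> set (iterate \<phi> n0 [X 0])" using primitive_letters[OF A] b(1) X_A by blast
  then have "sublist [b] (iterate \<phi> n0 [X 0])" by (metis split_list append_Cons append_Nil sublist_appendI)
  then have "sublist (iterate \<phi> m [b]) (iterate \<phi> m (iterate \<phi> n0 [X 0]))" by (rule sublist_iterate)
  with b(2) have "sublist [X (-1), X 0] (iterate \<phi> m (iterate \<phi> n0 [X 0]))" by (rule sublist_order.order.trans)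
  then have "sublist (iterate \<phi> n [X (-1), X 0]) (iterate \<phi> n (iterate \<phi> m (iterate \<phi> n0 [X 0])))"
    by (rule sublist_iterate)
  with sub have "sublist w (iterate \<phi> n (iterate \<phi> m (iterate \<phi> n0 [X 0])))" by (rule sublist_order.order.trans)
  moreover have "iterate \<phi> (n + (m + n0)) [X 0] \<in> language (\<lambda>n::nat. X (int n))"
    unfolding language_iff using E'.occurs_prefix[of "n + (m + n0)"] by (intro exI[of _ 0]) simp
  ultimately show "w \<in> language (\<lambda>n::nat. X (int n))"
    unfolding iterate_iterate using language_sublist by blast
qed

lemma expansion_right_half:
  fixes X :: "int \<Rightarrow> 'a"
  assumes E: "expansion \<phi> UNIV X P"
  shows "expansion \<phi> UNIV (\<lambda>n::nat. X (int n)) (\<lambda>n. nat (P (int n)))"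
proof -
  interpret E: expansion \<phi> UNIV X P by (rule E)
  have nonneg: "0 \<le> P (int n)" for n
  proof (induction n)
    case (Suc n)
    then show ?case using E.p_step[of "int n"] by (simp add: add.commute)
  qed (simp add: E.p_0)
  show ?thesis
  proof
    fix n :: nat
    show "nat (P (int (n + 1))) = nat (P (int n)) + of_nat (length (\<phi> (X (int n))))"
      using E.p_step[of "int n"] nonneg[of n] by (simp add: nat_add_distrib add.commute[of 1])
    show "occurs (\<lambda>n::nat. X (int n)) (nat (P (int n))) (\<phi> (X (int n)))"
      using E.occurs_p[of "int n"] nonneg[of n] by (simp add: occurs_def)
  qed (simp_all add: E.p_0)
qed

theorem theorem2:
  fixes A :: "'a set" and \<phi> :: "'a \<Rightarrow> 'a list"
  assumes "finite A" and "substitution A \<phi>" and "primitive A \<phi>"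
  shows
   "(\<forall>x :: nat \<Rightarrow> 'a. fixed_point A \<phi> x \<and> \<not> periodic x \<longrightarrow>
      (let X = orbit_closure A x;
           R = return_words x (x 0);
           \<tau> = return_subst x (x 0) \<phi>;
           M = incidence_matrix R \<tau>;
           s = largest_jordan_block M 0
       in all_equivalent
         [automatic x,
          \<exists>(B :: nat set) \<rho>. finite B \<and> \<rho> ` A \<subseteq> B \<and>
            \<not> periodic (\<rho> \<circ> x) \<and> automatic (\<rho> \<circ> x),
          automatic_system A X,
          \<exists>(B :: nat set) Y. finite B \<and> infinite Y \<and>
            automatic_system B Y \<and> topological_factor A X B Y,
          left_eigenvector M (length_vector \<phi> s R)])) \<and>
    (\<forall>x :: int \<Rightarrow> 'a. fixed_point A \<phi> x \<and> admissible A \<phi> x \<and> \<not> periodic x \<longrightarrow>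
      (let X = orbit_closure A x;
           R = return_words x (x 0);
           \<tau> = return_subst x (x 0) \<phi>;
           M = incidence_matrix R \<tau>;
           s = largest_jordan_block M 0
       in all_equivalent
         [automatic x,
          \<exists>(B :: nat set) \<rho>. finite B \<and> \<rho> ` A \<subseteq> B \<and>
            \<not> periodic (\<rho> \<circ> x) \<and> automatic (\<rho> \<circ> x),
          automatic_system A X,
          \<exists>(B :: nat set) Y. finite B \<and> infinite Y \<and>
            automatic_system B Y \<and> topological_factor A X B Y,
          left_eigenvector M (length_vector \<phi> s R)]))"
proof (intro conjI allI impI, goal_cases)
  case (1 x)
  then have fp: "fixed_point A \<phi> x" and np: "\<not> periodic x" by auto
  have x_A: "x \<in> seqs A" using fp by (simp add: fixed_point_def)
  obtain p where E: "expansion \<phi> UNIV x p" using fixed_point_expansion[OF fp] by blast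
  obtain i where i: "x i \<noteq> x 0" using two_letters[OF np] by blast
  have "primitive_sequence \<phi> x p A (x i) (x 0)"
    unfolding primitive_sequence_def primitive_sequence_axioms_def
    using E assms x_A i by (auto simp: seqs_def)
  then interpret primitive_sequence \<phi> x p A "x i" "x 0" .
  show ?case
  proof (rule conditions_equivalent[OF _ x_A refl refl np])
    show "\<exists>m::nat. n = of_nat m \<or> n + of_nat m = 0" for n :: nat by (intro exI[of _ n]) simp
  qed (rule uniform_automatic_nat)
next
  case (2 X)
  then have fp: "fixed_point A \<phi> X" and adm: "admissible A \<phi> X" and np: "\<not> periodic X" by auto
  have X_A: "X \<in> seqs A" using fp by (simp add: fixed_point_def)
  obtain P where E: "expansion \<phi> UNIV X P" using fixed_point_expansion[OF fp] by blast
  obtain i where i: "X i \<noteq> X 0" using two_letters[OF np] by blast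
  have in_A: "X i \<in> A" "X 0 \<in> A" using X_A by (auto simp: seqs_def)
  \<comment> \<open>The locale is instantiated with the right half, whose language equals that of
    \<open>X\<close> by admissibility.\<close>
  define x where "x n = X (int n)" for n
  define p where "p n = nat (P (int n))" for n
  have E': "expansion \<phi> UNIV x p" using expansion_right_half[OF E] unfolding x_def p_def .
  have "primitive_sequence \<phi> x p A (X i) (X 0)"
    unfolding primitive_sequence_def primitive_sequence_axioms_def
    using E' assms X_A i by (auto simp: seqs_def x_def)
  then interpret primitive_sequence \<phi> x p A "X i" "X 0" .
  have lang: "language X = language x"
    using admissible_language[OF assms in_A i X_A E adm] E' unfolding x_def by blast
  have X0: "X 0 = x 0" by (simp add: x_def)
  show ?case
  proof (rule conditions_equivalent[OF _ X_A X0 lang np])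
    show "\<exists>m::nat. n = of_nat m \<or> n + of_nat m = 0" for n :: int
      by (intro exI[of _ "nat \<bar>n\<bar>"]) auto
  qed (rule uniform_automatic_int[OF E X0 lang])
qed

end
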